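(* There is an absolute constant $C>0$ such that for every modulus $q \geq 1$, all integers $L_1, L_2$ with $1 \leq L_1, L_2 \leq q$ and every integer $c$ with $(c,q)=1$, $$\sum_{a = 1}^{q} \sum_{b = 1}^{q} \Bigl( \mathop{\sum_{q_1 \in (a, a+L_1]} \mathop{{\sum\nolimits}'}_{q_2 \in (b, b+L_2]}}_{q_1 q_2 \equiv c \pmod q} 1 - \frac{1}{q} \sum_{q_1 \in (a, a+L_1]} \mathop{{\sum\nolimits}'}_{q_2 \in (b, b+L_2]} 1 \Bigr)^2 \leq C\, L_1 L_2\, q\, d(q)^3 .$$
   Context: The sums are over integers $q_1, q_2$ in the indicated half-open intervals. The notation $\sum'$ means that the summation is restricted to integers $q_2$ relatively prime to $q$. $d(q)$ denotes the number of positive divisors of $q$. *)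

theory Defs
  imports Complex_Main "HOL-Number_Theory.Cong"
begin

definition num_divisors :: "nat \<Rightarrow> nat" where
  "num_divisors n = card {k. k dvd n}"

definition hyperbola_count :: "nat \<Rightarrow> int \<Rightarrow> int \<Rightarrow> int \<Rightarrow> int \<Rightarrow> int \<Rightarrow> real" where
  "hyperbola_count q c L1 L2 a b =
     (\<Sum>(q1, q2) \<in> {(q1, q2). q1 \<in> {a<..a + L1} \<and> q2 \<in> {b<..b + L2} \<and>
        coprime q2 (int q) \<and> [q1 * q2 = c] (mod int q)}. 1)"

definition coprime_box_count :: "nat \<Rightarrow> int \<Rightarrow> int \<Rightarrow> int \<Rightarrow> int \<Rightarrow> real" where
  "coprime_box_count q L1 L2 a b =
     (\<Sum>q1 \<in> {a<..a + L1}. \<Sum>q2 \<in> {q2 \<in> {b<..b + L2}. coprime q2 (int q)}. 1)"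

end

theory Submission
  imports
    "HOL-Algebra.Algebraic_Closure_Type"
    "Berlekamp_Zassenhaus.Finite_Field"
    "HOL-Library.Product_Plus"
    "HOL-Library.Real_Mod"
    Defs
begin

text \<open>
  By Plancherel in \<open>a\<close> and \<open>b\<close>, the variance equals
  \<open>q\<^sup>-\<^sup>2 \<Sum> |E(h)|\<^sup>2 |F(k)|\<^sup>2 |Kl(h c, k; q)|\<^sup>2\<close> over \<open>h \<noteq> 0\<close> and \<open>k\<close>, where \<open>E\<close> and \<open>F\<close> are the exponential sums
  of the two intervals and \<open>Kl\<close> is a Kloosterman sum. The bound \<open>|Kl(m, n; q)|\<^sup>2 \<le> d(q)\<^sup>2 q gcd(m, n, q)\<close>
  then suffices, because \<open>\<Sum> gcd(h, q) |E(h)|\<^sup>2 \<le> d(q) q L1\<close> over \<open>h \<noteq> 0\<close>.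

  Multiplicativity and stationary phase reduce the Kloosterman bound to odd prime moduli \<open>p\<close>, i.e. to
  Weil's bound \<open>2 sqrt p\<close>. Let \<open>S(q)\<close> be the sum over \<open>F\<^sub>q\<close>, \<open>q = p^(2^k)\<close>, obtained by composing the
  additive character with the trace. Grouping pairs of elements of \<open>F\<^sub>q\<close>, and conjugate
  pairs in its quadratic extension, by sum and product gives \<open>S(q\<^sup>2) = 2 q - S(q)\<^sup>2\<close>, so a violation of Weil's bound at \<open>q = p\<close> would make some
  \<open>S(q) / sqrt q\<close> tend to \<open>- \<infinity>\<close>. This contradicts a lower bound \<open>q - O(sqrt q)\<close> for the number of points of
  \<open>x + b / x = y^p - y\<close> over \<open>F\<^sub>q\<close>, which comes from the Stepanov-Bombieri method applied to a twist of
  that curve.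
\<close>

section \<open>A curve over an algebraically closed field of positive characteristic\<close>

text \<open>Stepanov's method bounds numbers of points only from above. Applied to the twisted
  points, where Frobenius exchanges the two roots \<open>x\<close> and \<open>x'\<close> over a
  given \<open>y\<close>, it bounds the number of genuine points from below, because each
  \<open>y\<close> accounts for exactly two roots in all. The resulting control is one-sided and
  concerns only the sum, over all \<open>c\<close> in the prime field, of the Kloosterman sums with
  coefficients \<open>c\<close> and \<open>c b\<close>. One-sidedness is harmless: a value
  \<open>2 - t^2\<close> never exceeds 2, so the other terms cannot compensate for one that becomes
  very negative. This takes the place of the rationality of a zeta function and needs only
  extensions of degree \<open>2^k\<close>, whose sizes are squares \<open>r^2\<close> with
  \<open>r\<close> a power of \<open>p\<close>, as the Stepanov-Bombieri construction requires. In
  the final estimate two of the three divisor factors come from the Kloosterman bound and one from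
  averaging the gcd. The numbers of square roots modulo prime powers are absorbed by the divisor
  function without loss, so that \<open>C = 1\<close> works.\<close>

lemma homogeneous_system_nontrivial_solution:
  fixes w :: "'i \<Rightarrow> 'e \<Rightarrow> 'k::field"
  assumes "finite E" "finite I" "card E < card I"
  shows "\<exists>c. (\<exists>i\<in>I. c i \<noteq> 0) \<and> (\<forall>e\<in>E. (\<Sum>i\<in>I. c i * w i e) = 0)"
  using assms
proof (induction E arbitrary: I w rule: finite_induct)
  case empty
  then obtain i where "i \<in> I" by fastforce
  then show ?case by (intro exI[of _ "\<lambda>_. 1"]) auto
next
  case (insert e E)
  show ?case
  proof (cases "\<forall>i\<in>I. w i e = 0")
    case True
    have "card E < card I" using insert by simp
    from insert.IH[OF insert.prems(1) this, of w] obtain c where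
      "\<exists>i\<in>I. c i \<noteq> 0" "\<forall>e\<in>E. (\<Sum>i\<in>I. c i * w i e) = 0" by blast
    then show ?thesis using True by (intro exI[of _ c]) auto
  next
    case False
    then obtain i0 where i0: "i0 \<in> I" "w i0 e \<noteq> 0" by blast
    let ?I = "I - {i0}"
    \<comment> \<open>Elimination with pivot \<open>w i0 e\<close>: \<open>w' i e = 0\<close> for
      all \<open>i\<close>, so the equation \<open>e\<close> drops out together with the unknown
      \<open>i0\<close>, whose value \<open>d i0\<close> is then forced by that equation.\<close>
    define w' where "w' = (\<lambda>i f. w i f - w i e / w i0 e * w i0 f)"
    have "finite ?I" "card E < card ?I" using insert i0 by auto
    from insert.IH[OF this, of w'] obtain c where
      c: "\<exists>i\<in>?I. c i \<noteq> 0" "\<And>f. f \<in> E \<Longrightarrow> (\<Sum>i\<in>?I. c i * w' i f) = 0" by blast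
    define d where "d = (\<lambda>i. if i = i0 then - (\<Sum>i\<in>?I. c i * w i e) / w i0 e else c i)"
    have sum: "(\<Sum>i\<in>I. d i * w i f) = (\<Sum>i\<in>?I. c i * w' i f)" for f
    proof -
      have "(\<Sum>i\<in>I. d i * w i f) = d i0 * w i0 f + (\<Sum>i\<in>?I. d i * w i f)"
        using i0 insert.prems(1) by (simp add: sum.remove)
      also have "(\<Sum>i\<in>?I. d i * w i f) = (\<Sum>i\<in>?I. c i * w i f)"
        by (rule sum.cong) (auto simp: d_def)
      also have "d i0 * w i0 f = - (\<Sum>i\<in>?I. c i * (w i e / w i0 e * w i0 f))"
        by (simp add: d_def sum_distrib_left sum_distrib_right sum_divide_distrib mult_ac
            flip: sum_negf)
      finally show ?thesis by (simp add: w'_def right_diff_distrib sum_subtractf)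
    qed
    have "(\<Sum>i\<in>I. d i * w i f) = 0" if "f \<in> insert e E" for f
    proof (cases "f = e")
      case True
      then show ?thesis unfolding sum using i0(2) by (simp add: w'_def)
    next
      case False
      then show ?thesis unfolding sum using c(2) that by auto
    qed
    moreover have "\<exists>i\<in>I. d i \<noteq> 0" using c(1) by (auto simp: d_def)
    ultimately show ?thesis by blast
  qed
qed

text \<open>Euclid's argument: over a finite field the product of all \<open>X - a\<close>,
  increased by 1, has no root.\<close>

lemma infinite_UNIV_alg_closed: "infinite (UNIV :: 'a::alg_closed_field set)"
proof
  assume fin: "finite (UNIV :: 'a set)"
  define P :: "'a poly" where "P = (\<Prod>a\<in>UNIV. [:-a, 1:])"
  have "degree P = card (UNIV :: 'a set)"
    unfolding P_def by (subst degree_prod_eq_sum_degree) auto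
  moreover have "card (UNIV :: 'a set) > 0" using fin by (simp add: card_gt_0_iff)
  ultimately have "degree (P + 1) > 0" by (simp add: degree_add_eq_left)
  from alg_closed_imp_poly_has_root[OF this] obtain x where "poly (P + 1) x = 0" by blast
  moreover have "poly P x = 0" unfolding P_def poly_prod using fin by (intro prod_zero) auto
  ultimately show False by simp
qed

lemma poly_eqI_alg_closed:
  fixes P Q :: "'a::alg_closed_field poly"
  assumes "\<And>x. poly P x = poly Q x"
  shows "P = Q"
proof (rule ccontr)
  assume "P \<noteq> Q"
  then have "finite {x. poly (P - Q) x = 0}" by (intro poly_roots_finite) auto
  moreover have "{x. poly (P - Q) x = 0} = UNIV" using assms by auto
  ultimately show False using infinite_UNIV_alg_closed[where 'a='a] by simp
qed

text \<open>The norm form is quadratic, so a common factor of both coordinates enters it squared;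
  \<open>card_zeros_le_degree_nm\<close> obtains its double roots from this.\<close>

lemma factor_square:
  fixes z :: "'b::comm_ring_1"
  shows "(z * A)\<^sup>2 + z * A * (z * B) * G + c * (z * B)\<^sup>2 = z\<^sup>2 * (A\<^sup>2 + A * B * G + c * B\<^sup>2)"
  by (simp add: power2_eq_square algebra_simps)

section \<open>Coordinate ring of the curve as a rank-two module over \<open>K[y]\<close>\<close>

type_synonym 'a elt = "'a poly \<times> 'a poly"

text \<open>The curve \<open>x + b / x = y^p - y\<close> has degree \<open>p\<close> in
  \<open>y\<close> but is quadratic in \<open>x\<close>. Treating it as a double cover of the
  \<open>y\<close>-line reduces the arithmetic of functions on it to pairs of polynomials.\<close>

locale kloosterman_curve =
  fixes b :: "'k::alg_closed_field" and p r \<mu> :: nat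
  assumes prime_p: "prime p" and odd_p: "odd p" and char_p: "CHAR('k) = p"
    and b_nz: "b \<noteq> 0" and r_def: "r = p ^ \<mu>"
begin

lemma r_pos: "r > 0" using prime_p by (simp add: r_def prime_gt_0_nat)

lemma odd_r: "odd r" using odd_p by (simp add: r_def)

lemma p_ge_3: "p \<ge> 3"
  using prime_ge_2_nat[OF prime_p] odd_p by (cases "p = 2") auto

lemma two_nz: "(2::'k) \<noteq> 0"
proof
  assume "(2::'k) = 0"
  then have "of_nat 2 = (0::'k)" by simp
  then have "p dvd 2" unfolding of_nat_eq_0_iff_char_dvd char_p .
  then show False using p_ge_3 by (auto dest: dvd_imp_le)
qed

lemma frob_add: "(x + y :: 'k) ^ r = x ^ r + y ^ r"
  by (rule freshmans_dream'[of _ \<mu>]) (use prime_p in \<open>auto simp: char_p r_def\<close>)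

lemma frob_sum: "(sum f A :: 'k) ^ r = (\<Sum>i\<in>A. f i ^ r)"
  by (rule freshmans_dream_sum'[of _ \<mu>]) (use prime_p in \<open>auto simp: char_p r_def\<close>)

definition g :: "'k poly" where "g = monom 1 p - monom 1 1"

lemma poly_g: "poly g y = y ^ p - y" by (simp add: g_def poly_monom)

lemma degree_g: "degree g = p"
  unfolding g_def using p_ge_3
  by (subst diff_conv_add_uminus, subst degree_add_eq_left) (auto simp: degree_monom_eq)

lemma pderiv_g: "pderiv g = - 1"
proof -
  have "of_nat p = (0::'k)" by (metis char_p of_nat_CHAR)
  then show ?thesis by (simp add: g_def pderiv_diff pderiv_monom flip: one_pCons)
qed

text \<open>The pair \<open>(A, B)\<close> stands for the element \<open>A + B x\<close> of the coordinate ring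
  \<open>K[x, y] / (x\<^sup>2 - g(y) x + b)\<close>; the conjugate root is \<open>x' = g - x = b / x\<close>.\<close>

definition on_curve :: "'k \<Rightarrow> 'k \<Rightarrow> bool" where
  "on_curve x y \<longleftrightarrow> x ^ 2 = poly g y * x - b"

definition val :: "'k elt \<Rightarrow> 'k \<Rightarrow> 'k \<Rightarrow> 'k" where
  "val u x y = poly (fst u) y + poly (snd u) y * x"

text \<open>The norm \<open>(A + B x) (A + B x')\<close> down to \<open>K[y]\<close>, expanded with
  \<open>x + x' = g\<close> and \<open>x x' = b\<close>.\<close>

definition nm :: "'k elt \<Rightarrow> 'k poly" where
  "nm u = fst u ^ 2 + fst u * snd u * g + smult b (snd u ^ 2)"

definition mulp :: "'k elt \<Rightarrow> 'k elt \<Rightarrow> 'k elt" where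
  "mulp u v = (fst u * fst v - smult b (snd u * snd v),
     fst u * snd v + snd u * fst v + g * snd u * snd v)"

definition smul :: "'k poly \<Rightarrow> 'k elt \<Rightarrow> 'k elt" where
  "smul s u = (s * fst u, s * snd u)"

definition dle :: "nat \<Rightarrow> 'k elt \<Rightarrow> bool" where
  "dle d u \<longleftrightarrow> degree (fst u) \<le> d \<and> degree (snd u) \<le> d"

text \<open>The reduction of \<open>x ^ n\<close> to the form \<open>A + B x\<close>: each step
  multiplies by \<open>x\<close> and replaces \<open>x^2\<close> by \<open>g x - b\<close>.\<close>

primrec xpow :: "nat \<Rightarrow> 'k elt" where
  "xpow 0 = (1, 0)"
| "xpow (Suc n) = (- smult b (snd (xpow n)), fst (xpow n) + g * snd (xpow n))"

lemma smult_b: "smult b P = [:b:] * P" by simp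

lemma val_mulp: "on_curve x y \<Longrightarrow> val (mulp u v) x y = val u x y * val v x y"
  unfolding on_curve_def val_def mulp_def by simp Groebner_Basis.algebra

lemma val_smul: "val (smul s u) x y = poly s y * val u x y"
  by (simp add: val_def smul_def algebra_simps)

lemma val_add: "val (u + v) x y = val u x y + val v x y"
  by (simp add: val_def algebra_simps)

lemma val_0: "val 0 x y = 0"
  by (simp add: val_def)

lemma val_sum: "val (sum f A) x y = (\<Sum>i\<in>A. val (f i) x y)"
  by (induction A rule: infinite_finite_induct) (auto simp: val_add val_0)

lemma val_xpow: "on_curve x y \<Longrightarrow> val (xpow n) x y = x ^ n"
proof (induction n)
  case (Suc n)
  have "val (xpow (Suc n)) x y = x * val (xpow n) x y"
    using Suc.prems unfolding on_curve_def val_def by simp Groebner_Basis.algebra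
  with Suc show ?case by simp
qed (simp add: val_def)

lemma nm_xpow: "nm (xpow n) = [:b ^ n:]"
proof (induction n)
  case (Suc n)
  have "nm (xpow (Suc n)) = [:b:] * nm (xpow n)"
    unfolding nm_def smult_b xpow.simps fst_conv snd_conv by Groebner_Basis.algebra
  then show ?case by (simp add: Suc)
qed (simp add: nm_def flip: one_pCons)

lemma other_root:
  assumes "on_curve x y"
  shows "on_curve (poly g y - x) y" "x * (poly g y - x) = b"
  using assms unfolding on_curve_def by Groebner_Basis.algebra+

lemma ex_on_curve: "\<exists>x. on_curve x y"
proof -
  have "degree [:b, - poly g y, 1:] > 0" by simp
  from alg_closed_imp_poly_has_root[OF this] obtain x where "poly [:b, - poly g y, 1:] x = 0" ..
  then have "on_curve x y" unfolding on_curve_def by (simp, Groebner_Basis.algebra)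
  then show ?thesis ..
qed

text \<open>The left-hand side is \<open>x^r + x'^r\<close>, which Frobenius turns into
  \<open>(x + x')^r\<close>. Checking this at every point suffices because the field is
  infinite.\<close>

lemma trace_xpow_r: "2 * fst (xpow r) + g * snd (xpow r) = g ^ r"
proof (rule poly_eqI_alg_closed)
  fix y
  obtain x where x: "on_curve x y" using ex_on_curve by blast
  define x' where "x' = poly g y - x"
  have "poly (2 * fst (xpow r) + g * snd (xpow r)) y = val (xpow r) x y + val (xpow r) x' y"
    by (simp add: val_def x'_def algebra_simps)
  also have "\<dots> = x ^ r + x' ^ r" using x other_root[OF x] by (simp add: val_xpow x'_def)
  also have "\<dots> = poly (g ^ r) y" by (simp add: x'_def flip: frob_add)
  finally show "poly (2 * fst (xpow r) + g * snd (xpow r)) y = poly (g ^ r) y" .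
qed

lemma dle_mono: "dle d u \<Longrightarrow> d \<le> e \<Longrightarrow> dle e u" by (auto simp: dle_def)

lemma dle_sum: "(\<And>i. i \<in> A \<Longrightarrow> dle d (f i)) \<Longrightarrow> dle d (sum f A)"
  by (induction A rule: infinite_finite_induct) (auto simp: dle_def intro: degree_add_le)

lemma dle_smul: "degree s \<le> d \<Longrightarrow> dle e u \<Longrightarrow> dle (d + e) (smul s u)"
  by (auto simp: dle_def smul_def intro: order.trans[OF degree_mult_le] add_mono)

lemma dle_xpow: "dle (p * n) (xpow n)"
proof (induction n)
  case (Suc n)
  have "degree (g * snd (xpow n)) \<le> p + p * n"
    using Suc by (intro order.trans[OF degree_mult_le]) (simp add: degree_g dle_def)
  with Suc show ?case
    by (auto simp: dle_def intro!: degree_add_le intro: order.trans[OF degree_smult_le])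
qed (simp add: dle_def)

lemma degree_nm: "dle d u \<Longrightarrow> degree (nm u) \<le> 2 * d + p"
proof -
  assume d: "dle d u"
  have 1: "degree (fst u ^ 2) \<le> 2 * d" "degree (snd u ^ 2) \<le> 2 * d"
    using d order.trans[OF degree_power_le] by (auto simp: dle_def power2_eq_square
        intro: order.trans[OF degree_mult_le])
  have 2: "degree (fst u * snd u * g) \<le> d + d + p"
    using d by (intro order.trans[OF degree_mult_le] add_mono) (auto simp: dle_def degree_g)
  show ?thesis unfolding nm_def
    by (intro degree_add_le order.trans[OF degree_smult_le]) (use 1 2 in auto)
qed

text \<open>\<open>g\<^sup>2 - 4 b\<close> has a simple root because \<open>g' = -1\<close>, so it is not a square in \<open>K(y)\<close>.\<close>

lemma nm_eq_0_imp: 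
  assumes "nm u = 0" shows "u = 0"
proof -
  obtain A B where u: "u = (A, B)" by (cases u)
  have eq: "A ^ 2 + A * B * g + [:b:] * B ^ 2 = 0"
    using assms by (simp add: nm_def u)
  have "B = 0"
  proof (rule ccontr)
    assume B: "B \<noteq> 0"
    obtain \<gamma> where \<gamma>: "\<gamma> ^ 2 = 4 * b" using nth_root_exists[of 2 "4 * b"] by auto
    have "(4::'k) = 2 * 2" by simp
    then have four: "(4::'k) \<noteq> 0" using two_nz by (metis mult_eq_0_iff)
    have \<gamma>nz: "\<gamma> \<noteq> 0" using \<gamma> b_nz four by auto
    let ?G1 = "g - [:\<gamma>:]" and ?G2 = "g + [:\<gamma>:]"
    have deg: "degree ?G1 = p"
      using p_ge_3 degree_g
      by (subst diff_conv_add_uminus, subst degree_add_eq_left) auto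
    then obtain y where y: "poly ?G1 y = 0"
      using alg_closed_imp_poly_has_root[of ?G1] p_ge_3 by auto
    have G1nz: "?G1 \<noteq> 0" using deg p_ge_3 by auto
    have o1: "order y ?G1 = 1"
    proof -
      have "poly (pderiv ?G1) y \<noteq> 0" by (simp add: pderiv_diff pderiv_g pderiv_pCons)
      have "order y ?G1 \<le> 1"
      proof (rule ccontr)
        assume "\<not> order y ?G1 \<le> 1"
        then have "[:-y, 1:] ^ 2 dvd ?G1" unfolding order_divides by simp
        then obtain T where "?G1 = [:-y, 1:] ^ 2 * T" by (elim dvdE)
        then have T: "?G1 = [:-y, 1:] * ([:-y, 1:] * T)"
          by (simp only: power2_eq_square mult.assoc)
        have "poly (pderiv ?G1) y = 0" unfolding T
          by (simp add: pderiv_mult del: mult_pCons_left)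
        with \<open>poly (pderiv ?G1) y \<noteq> 0\<close> show False by simp
      qed
      moreover have "order y ?G1 > 0" using y order_gt_0_iff[OF G1nz] by blast
      ultimately show ?thesis by simp
    qed
    have "poly g y = \<gamma>" using y by simp
    then have "poly ?G2 y = 2 * \<gamma>" by simp
    then have G2: "poly ?G2 y \<noteq> 0" using \<gamma>nz two_nz by simp
    then have o2: "order y ?G2 = 0" by (rule order_0I)
    have G2nz: "?G2 \<noteq> 0" using G2 poly_0 by metis
    \<comment> \<open>Completing the square. At the root \<open>y\<close> of
      \<open>g - \<gamma>\<close> the left-hand side has even order and the right-hand side odd
      order.\<close>
    have "(2 * A + B * g) ^ 2 = B ^ 2 * (g ^ 2 - 4 * [:b:])" using eq by Groebner_Basis.algebra
    also have "4 * [:b:] = [:\<gamma>:] ^ 2"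
    proof -
      have "[:\<gamma>:] ^ 2 = [:\<gamma> ^ 2:]" by (simp add: power2_eq_square)
      also have "\<dots> = 4 * [:b:]" unfolding \<gamma> by (simp add: numeral_poly)
      finally show ?thesis by simp
    qed
    also have "g ^ 2 - [:\<gamma>:] ^ 2 = ?G1 * ?G2" by Groebner_Basis.algebra
    finally have sq: "(2 * A + B * g) ^ 2 = B ^ 2 * (?G1 * ?G2)" .
    have rnz: "B ^ 2 * (?G1 * ?G2) \<noteq> 0" using B G1nz G2nz by simp
    have o_sq: "order y (P ^ 2) = 2 * order y P" if "P \<noteq> 0" for P :: "'k poly"
      using that by (simp add: order_mult power2_eq_square)
    have "order y (B ^ 2 * (?G1 * ?G2)) = order y (B ^ 2) + (order y ?G1 + order y ?G2)"
      using rnz by (metis order_mult mult_not_zero)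
    then have "order y (B ^ 2 * (?G1 * ?G2)) = 2 * order y B + 1"
      unfolding o1 o2 o_sq[OF B] by simp
    moreover have "2 * A + B * g \<noteq> 0" using rnz sq by (metis zero_power2)
    then have "order y ((2 * A + B * g) ^ 2) = 2 * order y (2 * A + B * g)" by (rule o_sq)
    ultimately have "2 * order y (2 * A + B * g) = 2 * order y B + 1" unfolding sq by simp
    then show False by presburger
  qed
  with eq show ?thesis by (simp add: u zero_prod_def)
qed

text \<open>Zeros are counted through roots of the norm with multiplicity. One zero over
  \<open>y\<close> makes the norm vanish at \<open>y\<close>; two distinct zeros over the same
  \<open>y\<close> force both coordinates to vanish there, so the norm vanishes doubly.\<close>

lemma card_zeros_le_degree_nm:
  assumes nz: "nm u \<noteq> 0"
  shows "finite {(x, y). on_curve x y \<and> val u x y = 0}"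
    and "card {(x, y). on_curve x y \<and> val u x y = 0} \<le> degree (nm u)"
proof -
  let ?N = "nm u"
  let ?R = "{y. poly ?N y = 0}"
  let ?F = "\<lambda>y. {x. on_curve x y \<and> val u x y = 0}"
  let ?Z = "{(x, y). on_curve x y \<and> val u x y = 0}"
  have nmval: "poly ?N y = val u x y * val u (poly g y - x) y" if "on_curve x y" for x y
    using that unfolding on_curve_def nm_def val_def poly_add poly_mult poly_power poly_smult by Groebner_Basis.algebra
  have finR: "finite ?R" using nz by (rule poly_roots_finite)
  have sub: "?F y \<subseteq> {x0, poly g y - x0}" if "on_curve x0 y" for x0 y
  proof
    fix x assume "x \<in> ?F y"
    then have "(x - x0) * (x - (poly g y - x0)) = 0"
      using that unfolding on_curve_def by (simp, Groebner_Basis.algebra)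
    then show "x \<in> {x0, poly g y - x0}" by auto
  qed
  have finF: "finite (?F y)" for y
  proof -
    obtain x0 where "on_curve x0 y" using ex_on_curve by blast
    from finite_subset[OF sub[OF this]] show ?thesis by simp
  qed
  have Z: "?Z = (\<lambda>(y, x). (x, y)) ` (SIGMA y:?R. ?F y)"
  proof (intro Set.set_eqI iffI)
    fix z assume "z \<in> ?Z"
    then obtain x y where "z = (x, y)" "on_curve x y" "val u x y = 0" by blast
    moreover from this have "poly ?N y = 0" by (simp only: nmval) simp
    ultimately have "(y, x) \<in> (SIGMA y:?R. ?F y)" "z = (\<lambda>(y, x). (x, y)) (y, x)" by auto
    then show "z \<in> (\<lambda>(y, x). (x, y)) ` (SIGMA y:?R. ?F y)" by (rule rev_image_eqI)
  next
    fix z assume "z \<in> (\<lambda>(y, x). (x, y)) ` (SIGMA y:?R. ?F y)"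
    then show "z \<in> ?Z" by auto
  qed
  have finS: "finite (SIGMA y:?R. ?F y)" using finR finF by (rule finite_SigmaI)
  show "finite ?Z" by (subst Z) (rule finite_imageI[OF finS])
  have "card ?Z = card (SIGMA y:?R. ?F y)"
    by (subst Z, rule card_image) (auto simp: inj_on_def)
  also have "\<dots> = (\<Sum>y\<in>?R. card (?F y))" by (rule card_SigmaI[OF finR]) (use finF in blast)
  also have "\<dots> \<le> (\<Sum>y\<in>?R. order y ?N)"
  proof (rule sum_mono)
    fix y assume "y \<in> ?R"
    then have ord: "order y ?N \<ge> 1" using nz by (simp add: order_root Suc_le_eq)
    show "card (?F y) \<le> order y ?N"
    proof (cases "\<exists>x1 x2. x1 \<noteq> x2 \<and> x1 \<in> ?F y \<and> x2 \<in> ?F y")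
      case False
      then have "card (?F y) \<le> Suc 0"
        using card_le_Suc0_iff_eq[OF finF[of y]] by blast
      then show ?thesis using ord by simp
    next
      case True
      then obtain x1 x2 where x: "x1 \<noteq> x2" "x1 \<in> ?F y" "x2 \<in> ?F y" by blast
      then have "poly (snd u) y * (x1 - x2) = 0" unfolding val_def by (simp, Groebner_Basis.algebra)
      then have B: "poly (snd u) y = 0" using x(1) by simp
      then have A: "poly (fst u) y = 0" using x(2) by (simp add: val_def)
      obtain A' B' where AB: "fst u = [:-y, 1:] * A'" "snd u = [:-y, 1:] * B'"
        using A B unfolding poly_eq_0_iff_dvd by (auto elim!: dvdE)
      have "?N = [:-y, 1:] ^ 2 * nm (A', B')"
        unfolding nm_def AB smult_b fst_conv snd_conv by (rule factor_square)
      then have "[:-y, 1:] ^ 2 dvd ?N" by (rule dvdI)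
      then have o: "order y ?N \<ge> 2" using nz by (simp add: order_divides)
      have "card (?F y) \<le> card {x1, poly g y - x1}"
        using sub[of x1 y] x(2) by (intro card_mono) auto
      also have "\<dots> \<le> 2" by (simp add: card_insert_if)
      finally show ?thesis using o by simp
    qed
  qed
  also have "\<dots> \<le> degree ?N" using nz by (rule sum_order_le_degree)
  finally show "card ?Z \<le> degree ?N" .
qed

section \<open>The Stepanov-Bombieri argument\<close>

lemma smul_sum: "smul s (sum f A) = (\<Sum>i\<in>A. smul s (f i))"
  by (simp add: smul_def prod_eq_iff fst_sum snd_sum sum_distrib_left)

lemma smul_smul: "smul s (smul t u) = smul (s * t) u"
  by (simp add: smul_def mult.assoc)

lemma smul_eq_0_iff: "smul s u = 0 \<longleftrightarrow> s = 0 \<or> u = 0"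
  by (cases u) (auto simp: smul_def zero_prod_def)

lemma dle_add: "dle d u \<Longrightarrow> dle d v \<Longrightarrow> dle d (u + v)"
  by (auto simp: dle_def intro: degree_add_le)

lemma monom_dvd_g_power: "monom 1 n dvd g ^ n"
proof -
  have "monom (1::'k) 1 dvd g"
  proof
    show "g = monom 1 1 * (monom 1 (p - 1) - 1)"
      using p_ge_3 by (simp add: g_def right_diff_distrib mult_monom)
  qed
  then have "monom (1::'k) 1 ^ n dvd g ^ n" by (rule dvd_power_same)
  then show ?thesis by (simp add: monom_power)
qed

text \<open>Above \<open>y = 0\<close> lie two points \<open>x = \<beta>\<close> and \<open>x = - \<beta>\<close> with \<open>\<beta>\<^sup>2 = - b\<close>, and \<open>x^r\<close> agrees with
  \<open>\<beta>^r\<close> to order \<open>r\<close> at the first. Hence \<open>U + \<beta>^r V\<close> vanishes there to a higher order than its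
  poles allow, and likewise at the second point.\<close>

lemma leading_terms_vanish:
  assumes dU: "dle d U" and dV: "dle d V" and dr: "2 * d + p < r"
    and eq: "U + mulp V (xpow r) = smul (monom 1 r) W"
  shows "U = 0 \<and> V = 0"
proof -
  define P Q where "P = fst (xpow r)" and "Q = snd (xpow r)"
  define Y :: "'k poly" where "Y = monom 1 r"
  have xr: "xpow r = (P, Q)" by (simp add: P_def Q_def)
  obtain A B where U: "U = (A, B)" by (cases U)
  obtain C D where V: "V = (C, D)" by (cases V)
  obtain W1 W2 where W: "W = (W1, W2)" by (cases W)
  have eq1: "A + (C * P - [:b:] * (D * Q)) = Y * W1"
    and eq2: "B + (C * Q + D * P + g * D * Q) = Y * W2"
    using eq unfolding U V W xr mulp_def smul_def Y_def smult_b by auto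
  have nX: "P ^ 2 + P * Q * g + [:b:] * Q ^ 2 = [:b ^ r:]"
    using nm_xpow[of r] unfolding nm_def smult_b P_def Q_def .
  have tX: "2 * P + g * Q = g ^ r" using trace_xpow_r unfolding P_def Q_def .
  have key: "U + smul [:\<epsilon>:] V = 0" if \<epsilon>: "\<epsilon> ^ 2 = - (b ^ r)" for \<epsilon>
  proof -
    define E where "E = [:\<epsilon>:]"
    have E2: "E ^ 2 = - [:b ^ r:]" unfolding E_def using \<epsilon> by (simp add: power2_eq_square)
    \<comment> \<open>\<open>(Z1, Z2)\<close> is the product of \<open>V\<close> and
      \<open>x^r - E\<close>, so that \<open>U + E V = Y W - (Z1, Z2)\<close> by the
      hypothesis.\<close>
    define Z1 Z2 where "Z1 = (P - E) * C - [:b:] * (Q * D)"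
      and "Z2 = (P - E) * D + Q * C + g * Q * D"
    have a: "A + E * C = Y * W1 - Z1" unfolding Z1_def using eq1 by Groebner_Basis.algebra
    have b: "B + E * D = Y * W2 - Z2" unfolding Z2_def using eq2 by Groebner_Basis.algebra
    define T where "T = Y * W1 ^ 2 - 2 * W1 * Z1 + g * (Y * W1 * W2 - W1 * Z2 - W2 * Z1)
      + [:b:] * (Y * W2 ^ 2 - 2 * W2 * Z2)"
    have "nm (A + E * C, B + E * D) = Y * T + (Z1 ^ 2 + Z1 * Z2 * g + [:b:] * Z2 ^ 2)"
      unfolding a b nm_def smult_b fst_conv snd_conv T_def by Groebner_Basis.algebra
    also have "Z1 ^ 2 + Z1 * Z2 * g + [:b:] * Z2 ^ 2 = 
        ((P - E) ^ 2 + (P - E) * Q * g + [:b:] * Q ^ 2) * (C ^ 2 + C * D * g + [:b:] * D ^ 2)"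
      unfolding Z1_def Z2_def by Groebner_Basis.algebra
    \<comment> \<open>This is the norm of \<open>x^r - E\<close>. The constants \<open>b^r\<close>
      and \<open>E^2 = - b^r\<close> cancel, and only a multiple of the trace \<open>g^r\<close>
      remains, which \<open>y^r\<close> divides.\<close>
    also have "(P - E) ^ 2 + (P - E) * Q * g + [:b:] * Q ^ 2 = - E * g ^ r"
    proof -
      have "(P - E) ^ 2 + (P - E) * Q * g + [:b:] * Q ^ 2 =
          (P ^ 2 + P * Q * g + [:b:] * Q ^ 2) - E * (2 * P + g * Q) + E ^ 2" by Groebner_Basis.algebra
      then show ?thesis unfolding nX tX E2 by simp
    qed
    finally have "nm (A + E * C, B + E * D) = Y * T + - E * g ^ r * (C ^ 2 + C * D * g + [:b:] * D ^ 2)" .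
    moreover have "Y dvd g ^ r" unfolding Y_def by (rule monom_dvd_g_power)
    ultimately have dvd: "Y dvd nm (A + E * C, B + E * D)" by (simp add: dvd_add dvd_mult dvd_mult2)
    have UE: "U + smul E V = (A + E * C, B + E * D)" by (simp add: U V smul_def)
    have "dle (0 + d) (smul E V)" using dV by (intro dle_smul) (auto simp: E_def)
    then have "dle d (U + smul E V)" using dU by (intro dle_add) auto
    from degree_nm[OF this] have deg: "degree (nm (A + E * C, B + E * D)) < degree Y"
      using dr by (simp add: UE Y_def degree_monom_eq)
    have "nm (A + E * C, B + E * D) = 0"
    proof (rule ccontr)
      assume "nm (A + E * C, B + E * D) \<noteq> 0"
      from dvd_imp_degree_le[OF dvd this] deg show False by simp
    qed
    then show ?thesis unfolding E_def[symmetric] UE by (rule nm_eq_0_imp)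
  qed
  obtain \<epsilon> where \<epsilon>: "\<epsilon> ^ 2 = - (b ^ r)" using nth_root_exists[of 2 "- (b ^ r)"] by auto
  have \<epsilon>nz: "\<epsilon> \<noteq> 0" using \<epsilon> b_nz by auto
  have 1: "A + smult \<epsilon> C = 0" "B + smult \<epsilon> D = 0"
    using key[OF \<epsilon>] by (auto simp: U V smul_def zero_prod_def)
  have 2: "A - smult \<epsilon> C = 0" "B - smult \<epsilon> D = 0"
    using key[of "- \<epsilon>"] \<epsilon> by (auto simp: U V smul_def zero_prod_def)
  have "smult (2 * \<epsilon>) C = (A + smult \<epsilon> C) - (A - smult \<epsilon> C)" 
    "smult (2 * \<epsilon>) D = (B + smult \<epsilon> D) - (B - smult \<epsilon> D)"
    proof -
    have "smult (2 * \<epsilon>) R = smult \<epsilon> R + smult \<epsilon> R" for R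
      by (simp flip: smult_add_left)
    then show "smult (2 * \<epsilon>) C = (A + smult \<epsilon> C) - (A - smult \<epsilon> C)"
      "smult (2 * \<epsilon>) D = (B + smult \<epsilon> D) - (B - smult \<epsilon> D)" by simp_all
  qed
  then have "C = 0" "D = 0" using 1 2 \<epsilon>nz two_nz by auto
  then show ?thesis using 1 by (simp add: U V zero_prod_def)
qed

text \<open>Modulo \<open>y^r\<close> only the term \<open>k = 0\<close> survives, and
  \<open>leading_terms_vanish\<close> kills it. Cancelling \<open>y^r\<close> from the rest shifts
  the index by one. This is the linear independence that makes the auxiliary function in Stepanov's
  method nonzero.\<close>

lemma lacunary_sum_eq_0_imp:
  assumes "\<And>k. dle d (U k)" "\<And>k. dle d (V k)" "2 * d + p < r"
    and "(\<Sum>k<m. smul (monom 1 (k * r)) (U k + mulp (V k) (xpow r))) = 0"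
    and "k < m"
  shows "U k = 0 \<and> V k = 0"
  using assms
proof (induction m arbitrary: U V k)
  case (Suc m)
  define S where "S = (\<Sum>k<m. smul (monom 1 (k * r)) (U (Suc k) + mulp (V (Suc k)) (xpow r)))"
  have "(\<Sum>k<Suc m. smul (monom 1 (k * r)) (U k + mulp (V k) (xpow r))) =
      (U 0 + mulp (V 0) (xpow r)) + smul (monom 1 r) S"
    unfolding sum.lessThan_Suc_shift S_def smul_sum smul_smul
    by (simp add: mult_monom) (simp add: smul_def prod_eq_iff)
  with Suc.prems(4) have eq: "(U 0 + mulp (V 0) (xpow r)) + smul (monom 1 r) S = 0" by simp
  then have "U 0 + mulp (V 0) (xpow r) = smul (monom 1 r) (- S)"
    by (simp add: smul_def add_eq_0_iff prod_eq_iff)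
  from leading_terms_vanish[OF Suc.prems(1,2,3) this] have 0: "U 0 = 0" "V 0 = 0" by auto
  then have "smul (monom 1 r) S = 0" using eq by (simp add: mulp_def zero_prod_def)
  then have S: "S = 0" by (simp add: smul_eq_0_iff)
  show ?case
  proof (cases k)
    case 0
    then show ?thesis using \<open>U 0 = 0\<close> \<open>V 0 = 0\<close> by simp
  next
    case (Suc k')
    then show ?thesis using Suc.IH[of "\<lambda>k. U (Suc k)" "\<lambda>k. V (Suc k)" k'] Suc.prems S
      unfolding S_def by auto
  qed
qed simp

lemma coeff_sum_monom: "coeff (\<Sum>i<n. monom (a i) i) j = (if j < n then a j else 0)"
  by (auto simp: coeff_sum if_distrib sum.If_cases cong: if_cong)

text \<open>Bombieri's version of Stepanov's method, with \<open>q = r\<^sup>2\<close>: some nonzero combination \<open>h\<close> of the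
  \<open>y^(k r + i) x^e\<close> with \<open>e \<in> {0, 1, r, r + 1}\<close> vanishes wherever \<open>y^q = y\<close> and \<open>x^q = x'\<close>, because
  there \<open>h^r\<close> coincides with a function of low degree that linear algebra can make identically \<open>0\<close>.\<close>

theorem stepanov_bound:
  assumes r4p: "r > 4 * p"
  defines "Z \<equiv> {(x, y). on_curve x y \<and> y ^ (r * r) = y \<and> x ^ (r * r) = poly g y - x}"
  shows "finite Z" "card Z \<le> r * r + 6 * p * r"
proof -
  obtain s where s: "r = 2 * s + 1" using odd_r by (auto elim: oddE)
  \<comment> \<open>\<open>\<sigma>\<close> bounds the exponent \<open>i\<close> and
    \<open>m\<close> the exponent \<open>k\<close>. The value of \<open>\<sigma>\<close> ensures
    \<open>2 * \<sigma> + p < r\<close>, as the independence lemma requires. The value of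
    \<open>m\<close> makes the number of unknowns exceed the number of equations while
    \<open>2 * m = r + 4 * p - 1\<close> keeps the leading term of the final bound at
    \<open>r^2\<close>.\<close>
  define \<sigma> where "\<sigma> = s - p"
  have r: "r = 2 * p + 2 * \<sigma> + 1" and \<sigma>: "2 * p < 2 * \<sigma> + 1" using s r4p by (auto simp: \<sigma>_def)
  define m where "m = 3 * p + \<sigma>"
  define e where "e = (\<lambda>c::nat. if c = 0 then 0 else if c = 1 then 1 else if c = 2 then r else r + 1)"
  \<comment> \<open>\<open>F c\<close> represents the \<open>r\<close>-th power of
    \<open>x^(e c)\<close> at the twisted points, where \<open>x^(r^2)\<close> may be replaced by
    \<open>g - x\<close>; this keeps its degree of order \<open>p * r\<close> rather than
    \<open>p * r^2\<close>.\<close>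
  define F :: "nat \<Rightarrow> 'k elt" where "F = (\<lambda>c. if c = 0 then (1, 0) else if c = 1 then xpow r
     else if c = 2 then (g, -1) else mulp (g, -1) (xpow r))"
  define J where "J = {..<m} \<times> {..<4::nat} \<times> {..\<sigma>}"
  \<comment> \<open>\<open>w j\<close> is the \<open>r\<close>-th power of \<open>w' j\<close> after
    the substitutions \<open>y^(r^2) = y\<close> and \<open>x^(r^2) = g - x\<close>: the exponent
    \<open>k * r + i\<close> of \<open>y\<close> becomes \<open>k + i * r\<close>.\<close>
  define w where "w = (\<lambda>(k, c, i). smul (monom 1 (k + i * r)) (F c))"
  define w' where "w' = (\<lambda>(k, c, i). smul (monom 1 (k * r + i)) (xpow (e c)))"
  define D where "D = (m - 1) + \<sigma> * r + (p + p * r)"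
  have finJ: "finite J" by (simp add: J_def)
  have m_pos: "m > 0" using p_ge_3 by (simp add: m_def)
  have dF: "dle (p + p * r) (F c)" for c
  proof -
    have "degree (fst (xpow r)) \<le> p * r" "degree (snd (xpow r)) \<le> p * r"
      using dle_xpow[of r] by (auto simp: dle_def)
    moreover from this have "degree (g * fst (xpow r)) \<le> p + p * r"
      "degree (smult b (snd (xpow r))) \<le> p + p * r"
      by (auto intro: order.trans[OF degree_mult_le] simp: degree_g)
    moreover have "mulp (g, -1) (xpow r) = (g * fst (xpow r) + smult b (snd (xpow r)), - fst (xpow r))"
      by (simp add: mulp_def)
    ultimately show ?thesis
      by (auto simp: F_def dle_def degree_g intro!: degree_add_le)
  qed
  have dw: "dle D (w j)" if "j \<in> J" for j
  proof -
    obtain k c i where j: "j = (k, c, i)" by (cases j)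
    have "i * r \<le> \<sigma> * r" using that by (simp add: j J_def)
    moreover have "k \<le> m - 1" using that by (auto simp: j J_def)
    ultimately have "k + i * r \<le> (m - 1) + \<sigma> * r" by (rule add_mono[rotated])
    then have "degree (monom (1::'k) (k + i * r)) \<le> (m - 1) + \<sigma> * r" by (simp add: degree_monom_eq)
    then show ?thesis unfolding j w_def D_def by (simp add: dle_smul dF)
  qed
  define cf where "cf = (\<lambda>j (t, n). coeff (if t then fst (w j) else snd (w j)) n)"
  let ?E = "(UNIV :: bool set) \<times> {..D}"
  have "card ?E = 2 * (D + 1)" by (simp add: card_cartesian_product)
  also have "\<dots> < card J"
  proof -
    have "D + 1 = 4 * p + \<sigma> + (p + \<sigma>) * r" using m_pos by (simp add: D_def m_def algebra_simps)
    also have "\<dots> = 5 * p + 2 * \<sigma> + 2 * p * p + 4 * p * \<sigma> + 2 * \<sigma> * \<sigma>"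
      unfolding r by (simp add: algebra_simps)
    finally have D1: "D + 1 = 5 * p + 2 * \<sigma> + 2 * p * p + 4 * p * \<sigma> + 2 * \<sigma> * \<sigma>" .
    have J1: "card J = 2 * (6 * p * \<sigma> + 2 * \<sigma> * \<sigma> + 6 * p + 2 * \<sigma>)"
      by (simp add: J_def card_cartesian_product m_def algebra_simps)
    \<comment> \<open>The difference of these two products is half the surplus of unknowns over
      equations.\<close>
    have "p * (2 * p) < p * (2 * \<sigma> + 1)" using \<sigma> p_ge_3 by (intro mult_strict_left_mono) auto
    then show ?thesis unfolding D1 J1 by (simp add: algebra_simps)
  qed
  finally have "card ?E < card J" .
  from homogeneous_system_nontrivial_solution[OF _ finJ this, of cf] obtain \<beta> where
    \<beta>: "\<exists>j\<in>J. \<beta> j \<noteq> 0" "\<And>t n. n \<le> D \<Longrightarrow> (\<Sum>j\<in>J. \<beta> j * cf j (t, n)) = 0"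
    by auto
  have "(\<Sum>j\<in>J. smul [:\<beta> j:] (w j)) = 0"
  proof -
    have high: "coeff (fst (w j)) n = 0" "coeff (snd (w j)) n = 0" if "j \<in> J" "\<not> n \<le> D" for j n
      using dw[OF that(1)] that(2) by (auto simp: dle_def intro!: coeff_eq_0)
    have "coeff (\<Sum>j\<in>J. [:\<beta> j:] * fst (w j)) n = 0" for n
      by (cases "n \<le> D") (use \<beta>(2)[of n True] high in \<open>simp_all add: coeff_sum cf_def\<close>)
    moreover have "coeff (\<Sum>j\<in>J. [:\<beta> j:] * snd (w j)) n = 0" for n
      by (cases "n \<le> D") (use \<beta>(2)[of n False] high in \<open>simp_all add: coeff_sum cf_def\<close>)
    ultimately have "(\<Sum>j\<in>J. [:\<beta> j:] * fst (w j)) = 0" "(\<Sum>j\<in>J. [:\<beta> j:] * snd (w j)) = 0"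
      by (intro poly_eqI; simp)+
    moreover have "fst (\<Sum>j\<in>J. smul [:\<beta> j:] (w j)) = (\<Sum>j\<in>J. [:\<beta> j:] * fst (w j))"
      "snd (\<Sum>j\<in>J. smul [:\<beta> j:] (w j)) = (\<Sum>j\<in>J. [:\<beta> j:] * snd (w j))"
      by (simp_all only: fst_sum snd_sum smul_def fst_conv snd_conv)
    ultimately show ?thesis by (intro prod_eqI) (simp_all only: fst_zero snd_zero)
  qed
  then have wsum: "(\<Sum>j\<in>J. \<beta> j * val (w j) x y) = 0" for x y
    using val_sum[of "\<lambda>j. smul [:\<beta> j:] (w j)" J x y] by (simp add: val_smul val_0)
  \<comment> \<open>The linear system determines the coefficients of \<open>h^r\<close>. Since
    Frobenius is additive, those of \<open>h\<close> itself are their \<open>r\<close>-th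
    roots.\<close>
  have "\<exists>a. \<forall>j. a j ^ r = \<beta> j" using nth_root_exists[OF r_pos] by (intro choice) auto
  then obtain a where a: "\<And>j. a j ^ r = \<beta> j" by blast
  define h where "h = (\<Sum>j\<in>J. smul [:a j:] (w' j))"
  have h_zero: "val h x y = 0" if "(x, y) \<in> Z" for x y
  proof -
    have c: "on_curve x y" and y: "y ^ (r * r) = y" and x: "x ^ (r * r) = poly g y - x"
      using that by (auto simp: Z_def)
    have val': "val (w' j) x y ^ r = val (w j) x y" if "j \<in> J" for j
    proof -
      obtain k cc i where j: "j = (k, cc, i)" by (cases j)
      have "(x ^ e cc) ^ r = val (F cc) x y"
      proof -
        have "(x ^ (r + 1)) ^ r = x ^ (r * r) * x ^ r"
          by (simp add: power_mult_distrib power_mult)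
        then have "(x ^ (r + 1)) ^ r = (poly g y - x) * x ^ r" by (simp only: x)
        moreover have "(x ^ r) ^ r = poly g y - x" using x by (simp add: power_mult)
        ultimately show ?thesis
          by (auto simp: e_def F_def val_xpow[OF c] val_mulp[OF c]) (auto simp: val_def)
      qed
      moreover have "(y ^ (k * r + i)) ^ r = (y ^ (r * r)) ^ k * y ^ (i * r)"
        by (simp add: power_add power_mult_distrib flip: power_mult) (simp add: mult_ac)
      ultimately show ?thesis unfolding j w_def w'_def
        by (simp add: val_smul val_xpow[OF c] poly_monom power_mult_distrib y power_add)
    qed
    have "val h x y ^ r = (\<Sum>j\<in>J. (a j * val (w' j) x y) ^ r)"
      by (simp add: h_def val_sum val_smul frob_sum)
    also have "\<dots> = (\<Sum>j\<in>J. \<beta> j * val (w j) x y)"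
      by (rule sum.cong) (auto simp: power_mult_distrib a val')
    finally show ?thesis using wsum r_pos by simp
  qed
  have h_nz: "nm h \<noteq> 0"
  proof
    assume "nm h = 0"
    then have h0: "h = 0" by (rule nm_eq_0_imp)
    define A where "A = (\<lambda>k c. \<Sum>i<Suc \<sigma>. monom (a (k, c, i)) i)"
    define U where "U = (\<lambda>k. (A k 0, A k 1))"
    define V where "V = (\<lambda>k. (A k 2, A k 3))"
    have "degree (A k c) \<le> \<sigma>" for k c
      unfolding A_def by (intro degree_sum_le) (auto intro: order.trans[OF degree_monom_le])
    then have dUV: "dle \<sigma> (U k)" "dle \<sigma> (V k)" for k
      by (auto simp: dle_def U_def V_def)
    have "2 * \<sigma> + p < r" using r by simp
    moreover have "(\<Sum>k<m. smul (monom 1 (k * r)) (U k + mulp (V k) (xpow r))) = h"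
    proof -
      have inner: "(\<Sum>i\<le>\<sigma>. smul [:a (k, c, i):] (w' (k, c, i))) = smul (monom 1 (k * r)) (smul (A k c) (xpow (e c)))" for k c
      proof -
        have "smul [:a (k, c, i):] (w' (k, c, i)) = smul (monom 1 (k * r)) (smul (monom (a (k, c, i)) i) (xpow (e c)))" for i
          by (simp add: w'_def smul_smul mult_monom smult_monom)
        moreover have "smul (A k c) u = (\<Sum>i\<le>\<sigma>. smul (monom (a (k, c, i)) i) u)" for u
          unfolding A_def lessThan_Suc_atMost
          by (simp add: smul_def prod_eq_iff fst_sum snd_sum sum_distrib_right)
        ultimately show ?thesis by (simp add: smul_sum)
      qed
      have four: "{..<4::nat} = {0, 1, 2, 3}" by auto
      have "h = (\<Sum>k<m. \<Sum>c<4. \<Sum>i\<le>\<sigma>. smul [:a (k, c, i):] (w' (k, c, i)))"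
        unfolding h_def J_def by (simp add: sum.cartesian_product)
      also have "\<dots> = (\<Sum>k<m. smul (monom 1 (k * r)) (\<Sum>c<4. smul (A k c) (xpow (e c))))"
        by (simp only: inner smul_sum)
      finally have "h = (\<Sum>k<m. smul (monom 1 (k * r)) (\<Sum>c<4. smul (A k c) (xpow (e c))))" .
      moreover have "(\<Sum>c<4. smul (A k c) (xpow (e c))) = U k + mulp (V k) (xpow r)" for k
        unfolding four by (simp add: e_def U_def V_def smul_def mulp_def algebra_simps)
      ultimately show ?thesis by simp
    qed
    ultimately have UV0: "U k = 0 \<and> V k = 0" if "k < m" for k
      using lacunary_sum_eq_0_imp[OF dUV _ _ that] h0 by simp
    have "a j = 0" if "j \<in> J" for j
    proof -
      obtain k c i where j: "j = (k, c, i)" by (cases j)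
      have "c = 0 \<or> c = 1 \<or> c = 2 \<or> c = 3" using that by (auto simp: J_def j)
      then have "A k c = 0" using UV0[of k] that
        by (auto simp: J_def j U_def V_def zero_prod_def)
      then have "coeff (A k c) i = 0" by simp
      then show ?thesis using that unfolding A_def coeff_sum_monom by (simp add: j J_def)
    qed
    then show False using \<beta>(1) a r_pos by (metis power_0_left not_gr_zero)
  qed
  have dh: "dle ((m - 1) * r + \<sigma> + p * (r + 1)) h"
    unfolding h_def
  proof (rule dle_sum)
    fix j assume jJ: "j \<in> J"
    obtain k c i where j: "j = (k, c, i)" by (cases j)
    have k: "k \<le> m - 1" "i \<le> \<sigma>" using jJ by (auto simp: j J_def)
    have 1: "degree (monom (1::'k) (k * r + i)) \<le> (m - 1) * r + \<sigma>"
      using k by (simp add: degree_monom_eq add_mono)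
    have "e c \<le> r + 1" using r_pos by (auto simp: e_def)
    then have "p * e c \<le> p * (r + 1)" by (rule mult_left_mono) simp
    then have "dle (p * (r + 1)) (xpow (e c))" by (rule dle_mono[OF dle_xpow])
    from dle_smul[OF _ dle_smul[OF 1 this], of "[:a j:]" 0]
    show "dle ((m - 1) * r + \<sigma> + p * (r + 1)) (smul [:a j:] (w' j))"
      by (simp add: w'_def j)
  qed
  have sub: "Z \<subseteq> {(x, y). on_curve x y \<and> val h x y = 0}" using h_zero by (auto simp: Z_def)
  show "finite Z" using finite_subset[OF sub card_zeros_le_degree_nm(1)[OF h_nz]] .
  have "card Z \<le> degree (nm h)"
    using card_mono[OF card_zeros_le_degree_nm(1)[OF h_nz] sub] card_zeros_le_degree_nm(2)[OF h_nz]
    by linarith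
  also have "\<dots> \<le> 2 * ((m - 1) * r + \<sigma> + p * (r + 1)) + p" by (rule degree_nm[OF dh])
  \<comment> \<open>Here \<open>2 * (m - 1) = r + 4 * p - 3\<close>, the powers of \<open>x\<close>
    contribute \<open>2 * p * r\<close>, and the terms \<open>2 * \<sigma> + 3 * p\<close> fit into
    the spare \<open>3 * r\<close>.\<close>
  also have "\<dots> \<le> r * r + 6 * p * r"
  proof -
    obtain m' where m': "m = Suc m'" using m_pos by (cases m) auto
    then have "2 * m' = r + 4 * p - 3" using r p_ge_3 by (simp add: m_def)
    then have "2 * m' + 3 = r + 4 * p" using p_ge_3 by simp
    then have "(2 * m' + 3) * r = (r + 4 * p) * r" by simp
    then have "2 * (m' * r) + 3 * r = r * r + 4 * p * r" by (simp add: algebra_simps)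
    then show ?thesis using r by (simp add: m' algebra_simps)
  qed
  finally show "card Z \<le> r * r + 6 * p * r" .
qed

end

section \<open>Kloosterman sums\<close>

definition ec :: "nat \<Rightarrow> int \<Rightarrow> complex" where
  "ec q k = cis (2 * pi * of_int k / of_nat q)"

lemma ec_0 [simp]: "ec q 0 = 1"
  by (simp add: ec_def)

lemma norm_ec [simp]: "norm (ec q k) = 1"
  by (simp add: ec_def)

lemma ec_add: "ec q (k + l) = ec q k * ec q l"
  by (simp add: ec_def cis_mult ring_distribs add_divide_distrib)

lemma ec_uminus: "ec q (- k) = cnj (ec q k)"
  by (simp add: ec_def cis_cnj)

lemma ec_eq_1_iff:
  assumes "q > 0"
  shows "ec q k = 1 \<longleftrightarrow> int q dvd k"
proof
  assume "ec q k = 1"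
  then obtain n :: int where "2 * pi * of_int k / of_nat q = of_int n * (2 * pi)"
    by (auto simp: ec_def cis_eq_1_iff)
  then have "real_of_int k = real_of_int (n * int q)" using assms by (simp add: field_simps)
  then have "k = n * int q" by (simp only: of_int_eq_iff)
  then show "int q dvd k" by simp
next
  assume "int q dvd k"
  then obtain n where "k = int q * n" ..
  then show "ec q k = 1" using assms by (simp add: ec_def cis_eq_1_iff)
qed

lemma ec_cong:
  assumes "[k = l] (mod int q)"
  shows "ec q k = ec q l"
proof (cases "q = 0")
  case False
  have "int q dvd k - l" using assms by (simp add: cong_iff_dvd_diff)
  then have "ec q (k - l) = 1" using False by (simp add: ec_eq_1_iff)
  then show ?thesis using ec_add[of q "k - l" l] by simp
qed (simp add: ec_def)

lemma ec_scale: "d > 0 \<Longrightarrow> ec (d * q) (int d * k) = ec q k"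
  by (simp add: ec_def mult.assoc)

lemma ec_sum:
  assumes q: "q > 0"
  shows "(\<Sum>k\<in>{0..<int q}. ec q (k * t)) = (if int q dvd t then of_nat q else 0)"
proof (cases "int q dvd t")
  case True
  then have "ec q (k * t) = 1" for k using q by (simp add: ec_eq_1_iff)
  then show ?thesis using True by simp
next
  case False
  let ?S = "\<Sum>k\<in>{0..<int q}. ec q (k * t)"
  have "ec q t * ?S = (\<Sum>k\<in>{0..<int q}. ec q ((k + 1) * t))"
    by (simp add: sum_distrib_left ring_distribs ec_add mult.commute)
  also have "\<dots> = (\<Sum>k\<in>{1..<int q + 1}. ec q (k * t))"
    by (rule sum.reindex_bij_witness[of _ "\<lambda>k. k - 1" "\<lambda>k. k + 1"]) auto
  also have "\<dots> = ?S"
  proof -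
    have "{1..<int q + 1} = insert (int q) {1..<int q}" "{0..<int q} = insert 0 {1..<int q}"
      using q by auto
    moreover have "ec q (int q * t) = 1" using q by (simp add: ec_eq_1_iff)
    ultimately show ?thesis by simp
  qed
  finally have "(ec q t - 1) * ?S = 0" by (simp add: algebra_simps)
  moreover have "ec q t \<noteq> 1" using False q by (simp add: ec_eq_1_iff)
  ultimately show ?thesis using False by simp
qed

text \<open>Listing a residue together with its inverse avoids an inverse function and makes the
  symmetry between the two visible. For \<open>q = 1\<close> the set is \<open>{(0, 0)}\<close>, so
  the Kloosterman sum is 1.\<close>

definition inv_pairs :: "nat \<Rightarrow> (int \<times> int) set" where
  "inv_pairs q = {(x, y). x \<in> {0..<int q} \<and> y \<in> {0..<int q} \<and> [x * y = 1] (mod int q)}"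

definition kloosterman :: "nat \<Rightarrow> int \<Rightarrow> int \<Rightarrow> complex" where
  "kloosterman q m n = (\<Sum>(x, y)\<in>inv_pairs q. ec q (m * x + n * y))"

lemma finite_inv_pairs [simp]: "finite (inv_pairs q)"
  by (rule finite_subset[of _ "{0..<int q} \<times> {0..<int q}"]) (auto simp: inv_pairs_def)

section \<open>Finite subfields and their Kloosterman sums\<close>

lemma card_roots_eq_degree:
  fixes P :: "'a::alg_closed_field poly"
  assumes P: "P \<noteq> 0" and sep: "\<And>x. poly P x = 0 \<Longrightarrow> poly (pderiv P) x \<noteq> 0"
  shows "card {x. poly P x = 0} = degree P"
proof -
  obtain A where A: "size A = degree P" "P = smult (lead_coeff P) (\<Prod>x\<in>#A. [:-x, 1:])"
    using alg_closed_imp_factorization[OF P] by blast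
  have dvd: "(\<Prod>x\<in>#B. [:-x, 1:]) dvd P" if "B \<subseteq># A" for B
    using A(2) prod_mset_subset_imp_dvd[OF image_mset_subseteq_mono[OF that, of "\<lambda>x. [:-x, 1:]"]]
    by (metis dvd_smult)
  have "count A x \<le> 1" for x
  proof (rule ccontr)
    assume "\<not> count A x \<le> 1"
    then have "{#x, x#} \<subseteq># A" by (auto simp: subseteq_mset_def)
    from dvd[OF this] obtain T where "P = ([:-x, 1:] * [:-x, 1:]) * T"
      by (auto elim!: dvdE simp del: mult_pCons_left mult_pCons_right)
    then have T: "P = [:-x, 1:] * ([:-x, 1:] * T)" by (simp only: mult.assoc)
    have "poly P x = 0" "poly (pderiv P) x = 0"
      unfolding T by (simp_all add: pderiv_mult del: mult_pCons_left)
    then show False using sep by blast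
  qed
  then have cnt: "count A x = 1" if "x \<in># A" for x
    using that by (metis count_eq_zero_iff le_antisym less_one not_le)
  have "poly P x = 0 \<longleftrightarrow> x \<in># A" for x
    by (subst A(2)) (use P in \<open>auto simp: poly_prod_mset image_iff\<close>)
  then have "card {x. poly P x = 0} = card (set_mset A)" by simp
  also have "\<dots> = size A" unfolding size_multiset_overloaded_eq using cnt by simp
  finally show ?thesis using A(1) by simp
qed

text \<open>All finite fields of characteristic \<open>p\<close> are realised inside one
  algebraically closed field as fixed points of powers of Frobenius, so the degree \<open>n\<close>
  can be an ordinary variable.\<close>

locale finite_subfields =
  fixes p :: nat and ty :: "'k::alg_closed_field itself"
  assumes prime_p: "prime p" and odd_p: "odd p" and char_p: "CHAR('k) = p"
begin

lemma p_ge_3: "p \<ge> 3"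
  using prime_ge_2_nat[OF prime_p] odd_p by (cases "p = 2") auto

definition Fq :: "nat \<Rightarrow> 'k set" where "Fq n = {x. x ^ (p ^ n) = x}"

lemma frob_add: "(x + y :: 'k) ^ (p ^ n) = x ^ (p ^ n) + y ^ (p ^ n)"
  by (rule freshmans_dream'[of _ n]) (use prime_p in \<open>auto simp: char_p\<close>)

lemma frob_sum: "(sum f A :: 'k) ^ (p ^ n) = (\<Sum>i\<in>A. f i ^ (p ^ n))"
  by (rule freshmans_dream_sum'[of _ n]) (use prime_p in \<open>auto simp: char_p\<close>)

lemma frob_uminus: "(- x :: 'k) ^ (p ^ n) = - (x ^ (p ^ n))"
  using odd_p by simp

lemma frob_diff: "(x - y :: 'k) ^ (p ^ n) = x ^ (p ^ n) - y ^ (p ^ n)"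
  using frob_add[of x "- y" n] by (simp add: frob_uminus)

text \<open>The polynomial \<open>X^(p^n) - X\<close> has derivative -1 and is therefore
  separable.\<close>

lemma card_Fq:
  assumes "n > 0"
  shows "finite (Fq n)" "card (Fq n) = p ^ n"
proof -
  define P :: "'k poly" where "P = monom 1 (p ^ n) - monom 1 1"
  have pn: "p ^ n > 1" using p_ge_3 assms by (intro one_less_power) auto
  have deg: "degree P = p ^ n" unfolding P_def
    using pn by (subst diff_conv_add_uminus, subst degree_add_eq_left) (auto simp: degree_monom_eq)
  then have P: "P \<noteq> 0" using pn p_ge_3 by auto
  have roots: "Fq n = {x. poly P x = 0}" by (auto simp: Fq_def P_def poly_monom)
  show "finite (Fq n)" unfolding roots using P by (rule poly_roots_finite)
  have "of_nat p = (0::'k)" by (metis char_p of_nat_CHAR)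
  then have "pderiv P = - 1"
    using assms by (simp add: P_def pderiv_diff pderiv_monom power_0_left flip: one_pCons)
  then show "card (Fq n) = p ^ n" unfolding roots deg[symmetric]
    by (intro card_roots_eq_degree P) simp
qed

lemma Fq_closed [simp]:
  "0 \<in> Fq n" "1 \<in> Fq n"
  "x \<in> Fq n \<Longrightarrow> y \<in> Fq n \<Longrightarrow> x + y \<in> Fq n"
  "x \<in> Fq n \<Longrightarrow> y \<in> Fq n \<Longrightarrow> x - y \<in> Fq n"
  "x \<in> Fq n \<Longrightarrow> y \<in> Fq n \<Longrightarrow> x * y \<in> Fq n"
  "x \<in> Fq n \<Longrightarrow> y \<in> Fq n \<Longrightarrow> x / y \<in> Fq n"
  "x \<in> Fq n \<Longrightarrow> - x \<in> Fq n"
  "x \<in> Fq n \<Longrightarrow> x ^ k \<in> Fq n"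
  using p_ge_3 by (auto simp: Fq_def frob_add frob_diff frob_uminus power_mult_distrib power_divide
      power_0_left power_commutes simp flip: power_mult) (metis mult.commute power_mult)

lemma Fq_mono: "Fq n \<subseteq> Fq (n * k)"
proof (induction k)
  case (Suc k)
  have "x ^ (p ^ (n * Suc k)) = (x ^ (p ^ n)) ^ (p ^ (n * k))" for x :: 'k
    by (simp add: power_add flip: power_mult)
  then show ?case using Suc by (auto simp: Fq_def)
qed (auto simp: Fq_def)

lemma Fq_1_subset: "Fq 1 \<subseteq> Fq n" using Fq_mono[of 1 n] by simp

lemma of_int_in_Fq_1: "of_int k \<in> Fq 1"
proof -
  have nat: "of_nat j \<in> Fq 1" for j by (induction j) auto
  show ?thesis by (cases k) (use nat in \<open>auto simp del: of_nat_Suc\<close>)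
qed

lemma of_int_eq_iff_cong: "(of_int k :: 'k) = of_int l \<longleftrightarrow> [k = l] (mod int p)"
proof -
  have "(of_int k :: 'k) = of_int l \<longleftrightarrow> (of_int (k - l) :: 'k) = 0" by simp
  also have "\<dots> \<longleftrightarrow> int p dvd k - l" unfolding of_int_eq_0_iff_char_dvd char_p ..
  finally show ?thesis by (simp add: cong_iff_dvd_diff)
qed

lemma inj_on_of_int: "inj_on (of_int :: int \<Rightarrow> 'k) {0..<int p}"
  by (auto simp: inj_on_def of_int_eq_iff_cong cong_def)

lemma Fq_1_eq: "Fq 1 = of_int ` {0..<int p}"
proof (rule sym, rule card_subset_eq)
  show "finite (Fq 1)" using card_Fq[of 1] by simp
  show "of_int ` {0..<int p} \<subseteq> Fq 1" using of_int_in_Fq_1 by blast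
  show "card (of_int ` {0..<int p} :: 'k set) = card (Fq 1)"
    using card_Fq[of 1] by (simp add: card_image[OF inj_on_of_int])
qed

section \<open>Trace and additive characters of the finite fields\<close>

definition psi :: "'k \<Rightarrow> complex" where
  "psi x = ec p (SOME k. of_int k = x)"

text \<open>The choice of the integer representative does not matter, since \<open>ec p\<close> has
  period \<open>p\<close>. Outside the prime field there is no representative and \<open>psi\<close>
  is unspecified, hence the membership hypotheses below.\<close>

lemma psi_of_int: "psi (of_int k) = ec p k"
proof -
  have "(of_int (SOME l. of_int l = (of_int k :: 'k)) :: 'k) = of_int k"
    by (rule someI[of _ k]) simp
  then show ?thesis unfolding psi_def of_int_eq_iff_cong by (rule ec_cong)
qed

lemma psi_0: "psi 0 = 1" using psi_of_int[of 0] by simp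

lemma psi_add: "x \<in> Fq 1 \<Longrightarrow> y \<in> Fq 1 \<Longrightarrow> psi (x + y) = psi x * psi y"
  unfolding Fq_1_eq by (auto simp: psi_of_int ec_add simp flip: of_int_add)

lemma psi_uminus: "x \<in> Fq 1 \<Longrightarrow> psi (- x) = cnj (psi x)"
  unfolding Fq_1_eq by (auto simp: psi_of_int ec_uminus simp flip: of_int_minus)

lemma psi_eq_1_iff: "x \<in> Fq 1 \<Longrightarrow> psi x = 1 \<longleftrightarrow> x = 0"
proof -
  assume "x \<in> Fq 1"
  then obtain k where k: "x = of_int k" unfolding Fq_1_eq by blast
  have "x = 0 \<longleftrightarrow> int p dvd k" unfolding k of_int_eq_0_iff_char_dvd char_p ..
  then show ?thesis using p_ge_3 by (simp add: k psi_of_int ec_eq_1_iff)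
qed

definition Tr :: "nat \<Rightarrow> 'k \<Rightarrow> 'k" where "Tr n x = (\<Sum>i<n. x ^ (p ^ i))"

lemma Tr_add: "Tr n (x + y) = Tr n x + Tr n y"
  by (simp add: Tr_def frob_add sum.distrib)

lemma Tr_uminus: "Tr n (- x) = - Tr n x"
  by (simp add: Tr_def frob_uminus sum_negf)

lemma Tr_1 [simp]: "Tr (Suc 0) x = x" by (simp add: Tr_def)

lemma Tr_0 [simp]: "Tr n 0 = 0"
  using p_ge_3 by (simp add: Tr_def power_0_left)

lemma Fq_1_power: "x \<in> Fq 1 \<Longrightarrow> x ^ (p ^ i) = x"
  using Fq_1_subset[of i] by (auto simp: Fq_def)

lemma Tr_mult: "c \<in> Fq 1 \<Longrightarrow> Tr n (c * x) = c * Tr n x"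
  by (simp add: Tr_def power_mult_distrib Fq_1_power sum_distrib_left)

lemma Tr_frob: "(Tr n x) ^ p = Tr n (x ^ p)"
  using frob_sum[of "\<lambda>i. x ^ (p ^ i)" "{..<n}" 1]
  by (simp add: Tr_def mult.commute flip: power_mult)

text \<open>The sum telescopes. On \<open>Fq n\<close> the right-hand side is 0; this shows both
  that traces lie in the prime field and that points \<open>(x, y)\<close> of the curve over
  \<open>Fq n\<close> have \<open>x + b / x\<close> of trace zero.\<close>

lemma Tr_frob_diff: "Tr n (x ^ p - x) = x ^ (p ^ n) - x"
proof -
  have "Tr n (x ^ p - x) = (\<Sum>i<n. x ^ (p ^ Suc i) - x ^ (p ^ i))"
    by (simp add: Tr_def frob_diff flip: power_mult)
  also have "\<dots> = x ^ (p ^ n) - x" by (subst sum_lessThan_telescope) simp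
  finally show ?thesis .
qed

lemma Tr_in_Fq_1: "x \<in> Fq n \<Longrightarrow> Tr n x \<in> Fq 1"
proof -
  assume "x \<in> Fq n"
  then have "Tr n (x ^ p - x) = 0" unfolding Tr_frob_diff by (simp add: Fq_def)
  then have "Tr n (x ^ p) - Tr n x = 0" using Tr_add[of n "x ^ p" "- x"] by (simp add: Tr_uminus)
  then show ?thesis by (simp add: Fq_def Tr_frob)
qed

lemma Tr_double: "Tr (2 * n) x = Tr n (x + x ^ (p ^ n))"
proof -
  have split: "(\<Sum>i<n + m. f i) = (\<Sum>i<n. f i) + (\<Sum>i<m. f (n + i))" for m and f :: "nat \<Rightarrow> 'k"
    by (induction m) (auto simp: add.assoc)
  have "Tr (2 * n) x = (\<Sum>i<n. x ^ (p ^ i)) + (\<Sum>i<n. x ^ (p ^ (n + i)))"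
    unfolding Tr_def mult_2 split ..
  also have "\<dots> = Tr n x + Tr n (x ^ (p ^ n))"
    by (simp add: Tr_def power_add flip: power_mult)
  finally show ?thesis by (simp add: Tr_add)
qed

text \<open>As a polynomial the trace has degree \<open>p^(n - 1)\<close>, too small to vanish on
  all \<open>p^n\<close> elements.\<close>

lemma ex_Tr_nonzero: assumes "n > 0" shows "\<exists>x\<in>Fq n. Tr n x \<noteq> 0"
proof (rule ccontr)
  assume "\<not> ?thesis"
  then have sub: "Fq n \<subseteq> {x. poly (\<Sum>i<n. monom 1 (p ^ i)) x = 0}"
    by (auto simp: Tr_def poly_sum poly_monom)
  define P :: "'k poly" where "P = (\<Sum>i<n. monom 1 (p ^ i))"
  have "coeff P (p ^ (n - 1)) = (\<Sum>i<n. if i = n - 1 then 1 else 0)"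
    unfolding P_def coeff_sum using p_ge_3 by (intro sum.cong) (auto simp: power_inject_exp)
  also have "\<dots> = 1" using assms by simp
  finally have P: "P \<noteq> 0" by auto
  have "degree P \<le> p ^ (n - 1)" unfolding P_def using p_ge_3
    by (intro degree_sum_le) (auto simp: degree_monom_eq intro!: power_increasing)
  moreover have "card (Fq n) \<le> card {x. poly P x = 0}"
    using sub P by (intro card_mono poly_roots_finite) (auto simp: P_def)
  moreover have "card {x. poly P x = 0} \<le> degree P" using P by (rule card_poly_roots_bound)
  ultimately have "p ^ n \<le> p ^ (n - 1)" using card_Fq[OF assms] by linarith
  then show False using p_ge_3 assms power_strict_increasing[of "n - 1" n p] by simp
qed

lemma psi_Tr_orthogonality:
  assumes n: "n > 0" and u: "u \<in> Fq n"
  shows "(\<Sum>s\<in>Fq n. psi (Tr n (u * s))) = (if u = 0 then of_nat (p ^ n) else 0)"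
proof (cases "u = 0")
  case True
  then show ?thesis using card_Fq[OF n] by (simp add: psi_0)
next
  case False
  obtain t where t: "t \<in> Fq n" "Tr n t \<noteq> 0" using ex_Tr_nonzero[OF n] by blast
  let ?S = "\<Sum>s\<in>Fq n. psi (Tr n (u * s))"
  have "?S = (\<Sum>s\<in>Fq n. psi (Tr n (u * (s + t / u))))"
    by (rule sum.reindex_bij_witness[of _ "\<lambda>s. s + t / u" "\<lambda>s. s - t / u"]) (use u t in auto)
  also have "\<dots> = (\<Sum>s\<in>Fq n. psi (Tr n t) * psi (Tr n (u * s)))"
  proof (rule sum.cong)
    fix s assume s: "s \<in> Fq n"
    have "u * (s + t / u) = t + u * s" using False by (simp add: field_simps)
    then show "psi (Tr n (u * (s + t / u))) = psi (Tr n t) * psi (Tr n (u * s))"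
      using s t u by (simp add: Tr_add psi_add[OF Tr_in_Fq_1 Tr_in_Fq_1])
  qed simp
  also have "\<dots> = psi (Tr n t) * ?S" by (simp add: sum_distrib_left)
  finally have "(psi (Tr n t) - 1) * ?S = 0" by (simp add: left_diff_distrib)
  moreover have "psi (Tr n t) \<noteq> 1" using t psi_eq_1_iff[OF Tr_in_Fq_1] by blast
  ultimately show ?thesis using False by simp
qed

section \<open>Passing from \<open>F_q\<close> to its quadratic extension\<close>

text \<open>Frobenius permutes the two roots \<open>u\<close>, \<open>v\<close> of
  \<open>X^2 - s X + m\<close>. If it fixes them, the first set is \<open>{u, v}\<close>; if it
  swaps distinct roots, the second set is. A double root lies in both sets and is thus counted twice
  as well.\<close>

lemma card_quadratic_roots:
  assumes s: "s \<in> Fq n" and m: "m \<in> Fq n"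
  shows "card {x \<in> Fq n. x * (s - x) = m} + card {z. z + z ^ (p ^ n) = s \<and> z * z ^ (p ^ n) = m} = 2"
    (is "card ?A + card ?B = 2")
proof -
  have "degree [:m, - s, 1:] > 0" by simp
  from alg_closed_imp_poly_has_root[OF this] obtain u where "poly [:m, - s, 1:] u = 0" ..
  then have u: "u * (s - u) = m" by (simp, Groebner_Basis.algebra)
  define v where "v = s - u"
  have roots: "x * (s - x) = m \<longleftrightarrow> x = u \<or> x = v" for x
  proof -
    have "(x - u) * (x - v) = m - x * (s - x)"
      unfolding v_def u[symmetric] by (simp add: algebra_simps)
    then show ?thesis by (metis eq_iff_diff_eq_0 mult_eq_0_iff)
  qed
  have sq: "s ^ (p ^ n) = s" and mq: "m ^ (p ^ n) = m" using s m by (auto simp: Fq_def)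
  have "u ^ (p ^ n) * (s - u ^ (p ^ n)) = m"
    using arg_cong[OF u, of "\<lambda>x. x ^ (p ^ n)"] by (simp add: power_mult_distrib frob_diff sq mq)
  then have cases: "u ^ (p ^ n) = u \<or> u ^ (p ^ n) = v" unfolding roots .
  have vq: "v ^ (p ^ n) = s - u ^ (p ^ n)" by (simp add: v_def frob_diff sq)
  have A: "?A = {x \<in> {u, v}. x \<in> Fq n}" using roots by blast
  have B: "?B = {z \<in> {u, v}. z ^ (p ^ n) = s - z}"
  proof (intro Set.set_eqI iffI)
    fix z assume "z \<in> ?B"
    then have zq: "z ^ (p ^ n) = s - z" and "z * z ^ (p ^ n) = m" by (auto simp: eq_diff_eq add.commute)
    then have "z * (s - z) = m" by simp
    then show "z \<in> {z \<in> {u, v}. z ^ (p ^ n) = s - z}" using roots zq by auto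
  next
    fix z assume z: "z \<in> {z \<in> {u, v}. z ^ (p ^ n) = s - z}"
    then have "z * (s - z) = m" using roots by auto
    then show "z \<in> ?B" using z by auto
  qed
  show ?thesis
  proof (cases "u ^ (p ^ n) = u")
    case True
    then have uF: "u \<in> Fq n" "v \<in> Fq n" using s by (auto simp: Fq_def v_def frob_diff)
    then have "?A = {u, v}" unfolding A by auto
    moreover have "?B = (if u = v then {u} else {})"
      unfolding B using True vq by (auto simp: v_def)
    ultimately show ?thesis by (simp only:) (auto simp: card_insert_if)
  next
    case False
    then have uv: "u ^ (p ^ n) = v" "u \<noteq> v" using cases by auto
    then have vu: "v ^ (p ^ n) = u" using vq by (simp add: v_def)
    have "?A = {}" unfolding A using uv vu by (auto simp: Fq_def)
    moreover have "?B = {u, v}" unfolding B using uv vu by (auto simp: v_def)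
    ultimately show ?thesis using uv by (simp only:) simp
  qed
qed

definition S :: "nat \<Rightarrow> 'k \<Rightarrow> 'k \<Rightarrow> complex" where
  "S n a b = (\<Sum>x\<in>Fq n - {0}. psi (Tr n (a * x + b / x)))"

lemma psi_Tr_add:
  "x \<in> Fq n \<Longrightarrow> y \<in> Fq n \<Longrightarrow> psi (Tr n (x + y)) = psi (Tr n x) * psi (Tr n y)"
  by (simp add: Tr_add psi_add[OF Tr_in_Fq_1 Tr_in_Fq_1])

text \<open>Both \<open>(S n a b)\<^sup>2\<close> and \<open>S (2 n) a b\<close> sum the same function of (sum, product): over pairs of elements of
  \<open>Fq n\<close>, respectively over conjugate pairs in \<open>Fq (2 n)\<close>. Each (sum, product) is hit exactly twice in total.\<close>

theorem S_double:
  assumes n: "n > 0" and a: "a \<in> Fq n" "a \<noteq> 0" and b: "b \<in> Fq n" "b \<noteq> 0"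
  shows "S (2 * n) a b = 2 * of_nat (p ^ n) - (S n a b) ^ 2"
proof -
  define q where "q = p ^ n"
  \<comment> \<open>Since \<open>b / x + b / y = b * (x + y) / (x * y)\<close>, the exponent depends
    only on the sum \<open>s\<close> and the product \<open>m\<close>.\<close>
  define G where "G = (\<lambda>(s, m). psi (Tr n (a * s + b * s / m)))"
  define I where "I = Fq n \<times> (Fq n - {0})"
  have fin: "finite (Fq n)" "finite (Fq (2 * n))" using card_Fq n by auto
  have finI: "finite I" using fin by (simp add: I_def)
  let ?PA = "(Fq n - {0}) \<times> (Fq n - {0})"
  let ?PB = "Fq (2 * n) - {0}"
  have "(S n a b) ^ 2 = (\<Sum>(x, y)\<in>?PA. psi (Tr n (a * x + b / x)) * psi (Tr n (a * y + b / y)))"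
    by (simp add: S_def power2_eq_square sum_product sum.cartesian_product)
  also have "\<dots> = (\<Sum>z\<in>?PA. G (fst z + snd z, fst z * snd z))"
  proof (rule sum.cong)
    fix z assume "z \<in> ?PA"
    then obtain x y where z: "z = (x, y)" and xy: "x \<in> Fq n" "y \<in> Fq n" "x \<noteq> 0" "y \<noteq> 0" by auto
    have "a * (x + y) + b * (x + y) / (x * y) = (a * x + b / x) + (a * y + b / y)"
      using xy by (simp add: field_simps)
    then show "(case z of (x, y) \<Rightarrow> psi (Tr n (a * x + b / x)) * psi (Tr n (a * y + b / y))) =
        G (fst z + snd z, fst z * snd z)"
      using xy a b by (simp add: z G_def psi_Tr_add)
  qed simp
  also have "\<dots> = (\<Sum>i\<in>I. \<Sum>z\<in>{z\<in>?PA. (fst z + snd z, fst z * snd z) = i}.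
      G (fst z + snd z, fst z * snd z))"
    using fin finI by (intro sum.group[symmetric]) (auto simp: I_def)
  also have "\<dots> = (\<Sum>i\<in>I. of_nat (card {x\<in>Fq n. x * (fst i - x) = snd i}) * G i)"
  proof (rule sum.cong)
    fix i assume i: "i \<in> I"
    let ?X = "{z\<in>?PA. (fst z + snd z, fst z * snd z) = i}"
    have "(\<Sum>z\<in>?X. G (fst z + snd z, fst z * snd z)) = (\<Sum>z\<in>?X. G i)" by (rule sum.cong) auto
    moreover have "card ?X = card {x\<in>Fq n. x * (fst i - x) = snd i}"
    proof (rule bij_betw_same_card[of fst], rule bij_betwI[of _ _ _ "\<lambda>x. (x, fst i - x)"])
      show "(\<lambda>x. (x, fst i - x)) \<in> {x\<in>Fq n. x * (fst i - x) = snd i} \<rightarrow> ?X"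
        using i by (auto simp: I_def)
    qed auto
    ultimately show "(\<Sum>z\<in>?X. G (fst z + snd z, fst z * snd z)) =
        of_nat (card {x\<in>Fq n. x * (fst i - x) = snd i}) * G i" by simp
  qed simp
  finally have S1: "(S n a b) ^ 2 = (\<Sum>i\<in>I. of_nat (card {x\<in>Fq n. x * (fst i - x) = snd i}) * G i)" .
  have N: "z + z ^ q \<in> Fq n" "z * z ^ q \<in> Fq n" if "z \<in> Fq (2 * n)" for z
  proof -
    have "(z ^ q) ^ q = z"
      using that by (simp add: Fq_def q_def mult_2 power_add flip: power_mult)
    then show "z + z ^ q \<in> Fq n" "z * z ^ q \<in> Fq n"
      unfolding Fq_def mem_Collect_eq q_def[symmetric] power_mult_distrib
        frob_add[of _ _ n, folded q_def] by simp_all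
  qed
  have "S (2 * n) a b = (\<Sum>z\<in>?PB. G (z + z ^ q, z * z ^ q))"
    unfolding S_def
  proof (rule sum.cong)
    fix z assume z: "z \<in> ?PB"
    have aq: "a ^ q = a" "b ^ q = b" using a b by (auto simp: Fq_def q_def)
    have "(a * z + b / z) + (a * z + b / z) ^ q = a * (z + z ^ q) + b * (z + z ^ q) / (z * z ^ q)"
      using z by (simp add: q_def frob_add) 
        (simp add: power_mult_distrib power_divide aq field_simps flip: q_def)
    then show "psi (Tr (2 * n) (a * z + b / z)) = G (z + z ^ q, z * z ^ q)"
      by (simp add: Tr_double G_def flip: q_def)
  qed simp
  also have "\<dots> = (\<Sum>i\<in>I. \<Sum>z\<in>{z\<in>?PB. (z + z ^ q, z * z ^ q) = i}. G (z + z ^ q, z * z ^ q))"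
    using fin finI N by (intro sum.group[symmetric]) (auto simp: I_def)
  also have "\<dots> = (\<Sum>i\<in>I. of_nat (card {z. z + z ^ q = fst i \<and> z * z ^ q = snd i}) * G i)"
  proof (rule sum.cong)
    fix i assume i: "i \<in> I"
    let ?X = "{z\<in>?PB. (z + z ^ q, z * z ^ q) = i}"
    have "(\<Sum>z\<in>?X. G (z + z ^ q, z * z ^ q)) = (\<Sum>z\<in>?X. G i)" by (rule sum.cong) auto
    moreover have "?X = {z. z + z ^ q = fst i \<and> z * z ^ q = snd i}"
    proof -
      have "z \<in> ?PB" if z: "z + z ^ q = fst i" "z * z ^ q = snd i" for z
      proof -
        have "(z + z ^ q) ^ q = z + z ^ q" using i unfolding z(1) by (auto simp: I_def Fq_def q_def)
        then have "(z ^ q) ^ q = z" by (simp add: q_def frob_add)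
        then have "z \<in> Fq (2 * n)"
          by (simp add: Fq_def q_def mult_2 power_add flip: power_mult)
        moreover have "z \<noteq> 0" using z(2) i by (auto simp: I_def)
        ultimately show ?thesis by simp
      qed
      then show ?thesis by force
    qed
    ultimately show "(\<Sum>z\<in>?X. G (z + z ^ q, z * z ^ q)) =
        of_nat (card {z. z + z ^ q = fst i \<and> z * z ^ q = snd i}) * G i" by simp
  qed simp
  finally have "S (2 * n) a b + (S n a b) ^ 2 =
      (\<Sum>i\<in>I. of_nat (card {x\<in>Fq n. x * (fst i - x) = snd i} +
        card {z. z + z ^ q = fst i \<and> z * z ^ q = snd i}) * G i)"
    unfolding S1 by (simp add: ring_distribs sum.distrib)
  also have "\<dots> = (\<Sum>i\<in>I. 2 * G i)"
  proof (rule sum.cong)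
    fix i assume "i \<in> I"
    then have "card {x\<in>Fq n. x * (fst i - x) = snd i} +
        card {z. z + z ^ q = fst i \<and> z * z ^ q = snd i} = 2"
      unfolding q_def by (intro card_quadratic_roots) (auto simp: I_def)
    then show "of_nat (card {x\<in>Fq n. x * (fst i - x) = snd i} +
        card {z. z + z ^ q = fst i \<and> z * z ^ q = snd i}) * G i = 2 * G i" by (simp only:) simp
  qed simp
  \<comment> \<open>For fixed \<open>m\<close> the exponent is linear in \<open>s\<close>, so
    orthogonality leaves only \<open>m = - b / a\<close>, which contributes
    \<open>q\<close>.\<close>
  also have "\<dots> = 2 * (\<Sum>m\<in>Fq n - {0}. \<Sum>s\<in>Fq n. psi (Tr n ((a + b / m) * s)))"
    unfolding I_def G_def sum_distrib_left[symmetric]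
    by (subst sum.swap) (simp add: sum.cartesian_product case_prod_unfold algebra_simps)
  also have "(\<Sum>m\<in>Fq n - {0}. \<Sum>s\<in>Fq n. psi (Tr n ((a + b / m) * s))) =
      (\<Sum>m\<in>Fq n - {0}. if a + b / m = 0 then of_nat q else 0)"
    by (rule sum.cong) (use a b in \<open>auto simp: psi_Tr_orthogonality[OF n] q_def\<close>)
  also have "\<dots> = (\<Sum>m\<in>Fq n - {0}. if m = - b / a then of_nat q else 0)"
    by (rule sum.cong) (use a b in \<open>auto simp: field_simps add_eq_0_iff\<close>)
  also have "\<dots> = of_nat q" using a b fin by simp
  finally show ?thesis by (simp add: q_def algebra_simps)
qed

lemma S_real: "cnj (S n a b) = S n a b"
  if "a \<in> Fq n" "b \<in> Fq n"
proof -
  have "cnj (S n a b) = (\<Sum>x\<in>Fq n - {0}. psi (Tr n (a * (- x) + b / (- x))))"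
    unfolding S_def cnj_sum
  proof (rule sum.cong)
    fix x assume "x \<in> Fq n - {0}"
    then have "Tr n (a * x + b / x) \<in> Fq 1" using that by (intro Tr_in_Fq_1) simp
    moreover have "a * (- x) + b / (- x) = - (a * x + b / x)" by simp
    ultimately show "cnj (psi (Tr n (a * x + b / x))) = psi (Tr n (a * (- x) + b / (- x)))"
      by (simp only: Tr_uminus psi_uminus)
  qed simp
  also have "\<dots> = S n a b"
    unfolding S_def by (rule sum.reindex_bij_witness[of _ uminus uminus]) auto
  finally show ?thesis .
qed

section \<open>Point counts and Weil's bound\<close>

text \<open>For each \<open>y\<close> the roots in the field (\<open>A y\<close>) and the twisted
  roots (\<open>B y\<close>) number two in all, so Stepanov's upper bound on twisted points is a
  lower bound on genuine ones. These lie over elements \<open>x\<close> with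
  \<open>x + b / x\<close> of trace zero, at most \<open>p\<close> over each.\<close>

lemma trace_zero_count_lower_bound:
  assumes r: "p ^ \<mu> > 4 * p" and b: "b \<in> Fq (2 * \<mu>)" "b \<noteq> 0"
  shows "p ^ (2 * \<mu>) \<le> p * card {x \<in> Fq (2 * \<mu>) - {0}. Tr (2 * \<mu>) (x + b / x) = 0} + 6 * p * p ^ \<mu>"
proof -
  define r where "r = p ^ \<mu>"
  define n where "n = 2 * \<mu>"
  interpret kloosterman_curve b p r \<mu>
    by unfold_locales (use prime_p odd_p char_p b r_def in auto)
  have "\<mu> \<noteq> 0" using r p_ge_3 by (intro notI) simp
  then have n: "n > 0" by (simp add: n_def)
  have q: "p ^ n = r * r" by (simp add: n_def r_def mult_2 power_add)
  note finF = card_Fq(1)[OF n]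
  define T0 where "T0 = {x \<in> Fq n - {0}. Tr n (x + b / x) = 0}"
  define A where "A = (\<lambda>y. {x \<in> Fq n. x * (poly g y - x) = b})"
  define B where "B = (\<lambda>y. {z. z + z ^ (p ^ n) = poly g y \<and> z * z ^ (p ^ n) = b})"
  have gF: "poly g y \<in> Fq n" if "y \<in> Fq n" for y using that by (simp add: poly_g)
  have count: "card (A y) + card (B y) = 2" if "y \<in> Fq n" for y
    unfolding A_def B_def by (rule card_quadratic_roots) (use that b gF n_def in auto)
  have finB: "finite (B y)" if "y \<in> Fq n" for y
  proof (rule finite_subset)
    show "B y \<subseteq> {z. poly [:b, - poly g y, 1:] z = 0}"
    proof
      fix z assume "z \<in> B y"
      then have "z ^ (p ^ n) = poly g y - z" and "z * z ^ (p ^ n) = b"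
        by (auto simp: B_def eq_diff_eq add.commute)
      then have "z * (poly g y - z) = b" by simp
      then show "z \<in> {z. poly [:b, - poly g y, 1:] z = 0}" by (simp add: algebra_simps)
    qed
  qed (rule poly_roots_finite, simp)
  define Z where "Z = {(x, y). on_curve x y \<and> y ^ (r * r) = y \<and> x ^ (r * r) = poly g y - x}"
  have Z: "Z = (\<lambda>(y, x). (x, y)) ` (SIGMA y:Fq n. B y)"
  proof -
    have "on_curve x y \<and> x ^ (r * r) = poly g y - x \<longleftrightarrow> x \<in> B y" for x y
    proof -
      have "x + x ^ (r * r) = poly g y \<longleftrightarrow> x ^ (r * r) = poly g y - x"
        by (auto simp: eq_diff_eq add.commute)
      moreover have "on_curve x y \<longleftrightarrow> x * (poly g y - x) = b"
        unfolding on_curve_def by (simp add: algebra_simps power2_eq_square) (metis add_diff_cancel_left' diff_add_cancel add.commute)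
      ultimately show ?thesis unfolding B_def q by auto
    qed
    then have iff: "x \<in> B y \<longleftrightarrow> on_curve x y \<and> x ^ (r * r) = poly g y - x" for x y by blast
    show ?thesis unfolding Z_def Fq_def q by (auto simp: image_iff iff)
  qed
  have "card Z = card (SIGMA y:Fq n. B y)"
    unfolding Z by (rule card_image) (auto simp: inj_on_def)
  also have "\<dots> = (\<Sum>y\<in>Fq n. card (B y))" using finF finB by (intro card_SigmaI) auto
  finally have cardZ: "card Z = (\<Sum>y\<in>Fq n. card (B y))" .
  have "(\<Sum>y\<in>Fq n. card (A y)) + card Z = (\<Sum>y\<in>Fq n. card (A y) + card (B y))"
    unfolding cardZ by (simp add: sum.distrib)
  also have "\<dots> = (\<Sum>y\<in>Fq n. 2)" by (rule sum.cong) (use count in auto)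
  also have "\<dots> = 2 * (r * r)" using card_Fq(2)[OF n] q by simp
  finally have tot: "(\<Sum>y\<in>Fq n. card (A y)) + card Z = 2 * (r * r)" .
  have "card Z \<le> r * r + 6 * p * r"
    unfolding Z_def by (rule stepanov_bound(2)) (use r in \<open>simp add: r_def\<close>)
  with tot have low: "r * r \<le> (\<Sum>y\<in>Fq n. card (A y)) + 6 * p * r" by linarith
  define Y where "Y = (\<lambda>x. {y. poly g y = x + b / x})"
  have Y: "finite (Y x)" "card (Y x) \<le> p" for x
  proof -
    have deg: "degree (g - [:x + b / x:]) = p"
      using p_ge_3 degree_g by (subst diff_conv_add_uminus, subst degree_add_eq_left) auto
    then have nz: "g - [:x + b / x:] \<noteq> 0" using p_ge_3 by auto
    have Y: "Y x = {y. poly (g - [:x + b / x:]) y = 0}" by (auto simp: Y_def)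
    show "finite (Y x)" unfolding Y using nz by (rule poly_roots_finite)
    show "card (Y x) \<le> p" unfolding Y using card_poly_roots_bound[OF nz] deg by simp
  qed
  have finX: "finite T0" using finF by (simp add: T0_def)
  have "(\<Sum>y\<in>Fq n. card (A y)) = card (SIGMA y:Fq n. A y)"
    using finF by (subst card_SigmaI) (auto simp: A_def)
  also have "\<dots> \<le> card (SIGMA x:T0. Y x)"
  proof (rule card_inj_on_le[of "\<lambda>(y, x). (x, y)"])
    show "(\<lambda>(y, x). (x, y)) ` (SIGMA y:Fq n. A y) \<subseteq> (SIGMA x:T0. Y x)"
    proof (clarsimp)
      fix x y assume y: "y \<in> Fq n" and x: "x \<in> A y"
      then have x0: "x \<noteq> 0" using b by (auto simp: A_def)
      then have yx: "poly g y = x + b / x" using x by (auto simp: A_def field_simps)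
      have "Tr n (x + b / x) = y ^ (p ^ n) - y"
        unfolding yx[symmetric] poly_g Tr_frob_diff ..
      then have "Tr n (x + b / x) = 0" using y by (simp add: Fq_def)
      then show "x \<in> T0 \<and> y \<in> Y x" using yx x x0 by (simp add: T0_def Y_def A_def)
    qed
    show "finite (SIGMA x:T0. Y x)" using finX Y by auto
  qed (auto simp: inj_on_def)
  also have "\<dots> = (\<Sum>x\<in>T0. card (Y x))" using finX Y by auto
  also have "\<dots> \<le> (\<Sum>x\<in>T0. p)" using Y by (intro sum_mono) auto
  also have "\<dots> = p * card T0" by simp
  finally have "r * r \<le> p * card T0 + 6 * p * r" using low by linarith
  then show ?thesis unfolding T0_def q[symmetric] unfolding r_def n_def .
qed

text \<open>Summing \<open>psi (c * t)\<close> over the prime field detects \<open>t = 0\<close>;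
  scaling both coefficients by \<open>c\<close> scales the trace by \<open>c\<close>.\<close>

lemma sum_S_eq:
  assumes n: "n > 0" and b: "b \<in> Fq 1"
  shows "(\<Sum>c\<in>Fq 1. S n c (c * b)) = of_nat (p * card {x \<in> Fq n - {0}. Tr n (x + b / x) = 0})"
proof -
  have finF: "finite (Fq n)" "finite (Fq 1)" using card_Fq n by auto
  have bn: "b \<in> Fq n" using b Fq_1_subset by blast
  have "(\<Sum>c\<in>Fq 1. S n c (c * b)) = (\<Sum>x\<in>Fq n - {0}. \<Sum>c\<in>Fq 1. psi (Tr n (c * (x + b / x))))"
    unfolding S_def by (subst sum.swap) (simp add: algebra_simps)
  also have "\<dots> = (\<Sum>x\<in>Fq n - {0}. if Tr n (x + b / x) = 0 then of_nat p else 0)"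
  proof (rule sum.cong)
    fix x assume x: "x \<in> Fq n - {0}"
    have T: "Tr n (x + b / x) \<in> Fq 1" using x bn by (intro Tr_in_Fq_1) simp
    have "(\<Sum>c\<in>Fq 1. psi (Tr n (c * (x + b / x)))) = (\<Sum>c\<in>Fq 1. psi (Tr 1 (Tr n (x + b / x) * c)))"
      by (rule sum.cong) (simp_all add: Tr_mult mult.commute)
    also have "\<dots> = (if Tr n (x + b / x) = 0 then of_nat p else 0)"
      using psi_Tr_orthogonality[OF zero_less_one T] by simp
    finally show "(\<Sum>c\<in>Fq 1. psi (Tr n (c * (x + b / x)))) = (if Tr n (x + b / x) = 0 then of_nat p else 0)" .
  qed simp
  also have "\<dots> = of_nat (p * card {x \<in> Fq n - {0}. Tr n (x + b / x) = 0})"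
    using finF by (simp add: sum.If_cases Int_def set_diff_eq)
  finally show ?thesis .
qed

text \<open>The term \<open>c = 0\<close> of \<open>sum_S_eq\<close> equals
  \<open>p^(2 * \<mu>) - 1\<close> and accounts for the main term of the point count; what is left
  is the error.\<close>

lemma sum_S_lower_bound:
  assumes r: "p ^ \<mu> > 4 * p" and b: "b \<in> Fq 1" "b \<noteq> 0"
  shows "(\<Sum>c\<in>Fq 1 - {0}. Re (S (2 * \<mu>) c (c * b))) \<ge> - 6 * real p * real (p ^ \<mu>)"
proof -
  let ?n = "2 * \<mu>"
  have "\<mu> \<noteq> 0" using r p_ge_3 by (intro notI) simp
  then have n: "?n > 0" by simp
  have finF: "finite (Fq ?n)" "finite (Fq 1)" using card_Fq n by auto
  have bn: "b \<in> Fq ?n" using b Fq_1_subset by blast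
  define N where "N = card {x \<in> Fq ?n - {0}. Tr ?n (x + b / x) = 0}"
  have "S ?n 0 0 = of_nat (card (Fq ?n - {0}))" by (simp add: S_def psi_0)
  also have "card (Fq ?n - {0}) = p ^ ?n - 1" using card_Fq[OF n] by (simp add: card_Diff_subset)
  finally have S0: "S ?n 0 0 = of_nat (p ^ ?n - 1)" .
  have "of_nat (p * N) = S ?n 0 (0 * b) + (\<Sum>c\<in>Fq 1 - {0}. S ?n c (c * b))"
    unfolding N_def sum_S_eq[OF n b(1), symmetric] using finF by (subst sum.remove[of _ 0]) auto
  then have "complex_of_nat (p * N) = of_nat (p ^ ?n - 1) + (\<Sum>c\<in>Fq 1 - {0}. S ?n c (c * b))"
    using S0 by simp
  from arg_cong[OF this, of Re] have "real (p * N) = real (p ^ ?n - 1) + (\<Sum>c\<in>Fq 1 - {0}. Re (S ?n c (c * b)))"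
    by simp
  moreover have "p ^ ?n \<le> p * N + 6 * p * p ^ \<mu>"
    unfolding N_def by (rule trace_zero_count_lower_bound[OF r bn b(2)])
  then have "real (p ^ ?n) \<le> real (p * N + 6 * p * p ^ \<mu>)" by (simp only: of_nat_le_iff)
  moreover have "real (p ^ ?n - 1) \<le> real (p ^ ?n)" by simp
  ultimately show ?thesis by (simp only: of_nat_add of_nat_mult of_nat_numeral)
qed

text \<open>If some \<open>|S 1 c (c b)|\<close> exceeded \<open>2 sqrt p\<close>, the recursion \<open>t \<mapsto> 2 - t\<^sup>2\<close> for the normalised sums
  over \<open>F_(p^(2^k))\<close> would drive that term to \<open>- \<infinity>\<close> while keeping all others below \<open>2\<close>.\<close>

theorem norm_S_1_le:
  assumes c0: "c0 \<in> Fq 1" "c0 \<noteq> 0" and b: "b \<in> Fq 1" "b \<noteq> 0"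
  shows "norm (S 1 c0 (c0 * b)) \<le> 2 * sqrt p"
proof (rule ccontr)
  assume large: "\<not> ?thesis"
  define t where "t = (\<lambda>k c. Re (S (2 ^ k) c (c * b)) / sqrt (real (p ^ 2 ^ k)))"
  have p0: "real p > 0" using p_ge_3 by simp
  have real: "S (2 ^ k) c (c * b) = of_real (Re (S (2 ^ k) c (c * b)))" if "c \<in> Fq 1" for k c
  proof -
    have "c \<in> Fq (2 ^ k)" "b \<in> Fq (2 ^ k)" using that b Fq_1_subset by blast+
    then have "c \<in> Fq (2 ^ k)" "c * b \<in> Fq (2 ^ k)" by auto
    from S_real[OF this] show ?thesis by (metis Reals_cnj_iff of_real_Re)
  qed
  have sqrt_Suc: "sqrt (real (p ^ 2 ^ Suc k)) = real (p ^ 2 ^ k)" for k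
  proof -
    have "p ^ 2 ^ Suc k = (p ^ 2 ^ k) ^ 2" by (simp add: mult.commute flip: power_mult)
    then have "real (p ^ 2 ^ Suc k) = real (p ^ 2 ^ k) ^ 2" by (simp only: of_nat_power)
    then show ?thesis by (simp only: real_sqrt_abs abs_of_nat)
  qed
  have rec: "t (Suc k) c = 2 - (t k c) ^ 2" if c: "c \<in> Fq 1 - {0}" for k c
  proof -
    have "c \<in> Fq (2 ^ k)" "b \<in> Fq (2 ^ k)" using c b Fq_1_subset by blast+
    then have cb: "c \<in> Fq (2 ^ k)" "c \<noteq> 0" "c * b \<in> Fq (2 ^ k)" "c * b \<noteq> 0"
      using c b by auto
    have "S (2 ^ Suc k) c (c * b) = 2 * of_nat (p ^ 2 ^ k) - (S (2 ^ k) c (c * b)) ^ 2"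
      using S_double[OF _ cb] by simp
    then have "complex_of_real (Re (S (2 ^ Suc k) c (c * b))) =
        of_real (2 * real (p ^ 2 ^ k) - Re (S (2 ^ k) c (c * b)) ^ 2)"
      using real[of c k] real[of c "Suc k"] c by simp
    then have "Re (S (2 ^ Suc k) c (c * b)) = 2 * real (p ^ 2 ^ k) - Re (S (2 ^ k) c (c * b)) ^ 2"
      by (simp only: of_real_eq_iff)
    then show ?thesis unfolding t_def sqrt_Suc using p0
      by (simp add: power_divide diff_divide_distrib)
  qed
  define \<delta> where "\<delta> = (t 0 c0) ^ 2 - 4"
  have "\<delta> > 0"
  proof -
    have "norm (S 1 c0 (c0 * b)) = \<bar>Re (S 1 c0 (c0 * b))\<bar>"
      using real[of c0 0] c0 by (metis norm_of_real power_0)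
    then have "\<bar>Re (S 1 c0 (c0 * b))\<bar> > 2 * sqrt p" using large by simp
    then have "\<bar>t 0 c0\<bar> > 2" using p0 by (simp add: t_def abs_divide field_simps)
    then have "\<bar>t 0 c0\<bar> ^ 2 > 2 ^ 2" by (intro power_strict_mono) auto
    then show ?thesis by (simp add: \<delta>_def)
  qed
  \<comment> \<open>The excess of \<open>- t\<close> over 2 at least quadruples at each step,
    because \<open>(2 + z)^2 - 2 \<ge> 2 + 4 * z\<close>. After the first step it equals
    \<open>\<delta>\<close>.\<close>
  have drop: "t (Suc k) c0 \<le> - 2 - 4 ^ k * \<delta>" for k
  proof (induction k)
    case 0
    then show ?case using rec[of c0 0] c0 by (simp add: \<delta>_def)
  next
    case (Suc k)
    have "(2 + 4 ^ k * \<delta>) ^ 2 \<le> (- t (Suc k) c0) ^ 2"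
      using Suc \<open>\<delta> > 0\<close> by (intro power_mono) auto
    moreover have "(2 + 4 ^ k * \<delta>) ^ 2 \<ge> 4 + 4 * (4 ^ k * \<delta>)"
      using zero_le_power2[of "4 ^ k * \<delta>"] by (simp add: power2_sum)
    ultimately show ?case using rec[of c0 "Suc k"] c0 by simp
  qed
  have upper: "t (Suc k) c \<le> 2" if "c \<in> Fq 1 - {0}" for k c
    using rec[OF that, of k] by simp
  have finF: "finite (Fq 1)" and cardF: "card (Fq 1) = p" using card_Fq[of 1] by auto
  \<comment> \<open>The total is at least \<open>- 6 * p\<close>, while the terms other than
    \<open>c0\<close> add at most \<open>2 * p\<close>; hence the constant 8.\<close>
  have bound: "4 ^ k * \<delta> \<le> 8 * real p" if k: "p ^ 2 ^ k > 4 * p" for k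
  proof -
    have pos: "real (p ^ 2 ^ k) > 0" using p0 by simp
    have "- 6 * real p * real (p ^ 2 ^ k) \<le> (\<Sum>c\<in>Fq 1 - {0}. Re (S (2 ^ Suc k) c (c * b)))"
      using sum_S_lower_bound[OF k b] by simp
    also have "\<dots> = real (p ^ 2 ^ k) * (\<Sum>c\<in>Fq 1 - {0}. t (Suc k) c)"
      unfolding t_def sqrt_Suc sum_divide_distrib[symmetric] using pos by simp
    finally have "real (p ^ 2 ^ k) * (- 6 * real p) \<le> real (p ^ 2 ^ k) * (\<Sum>c\<in>Fq 1 - {0}. t (Suc k) c)"
      by (simp only: mult_ac)
    then have "- 6 * real p \<le> (\<Sum>c\<in>Fq 1 - {0}. t (Suc k) c)"
      using pos by (rule mult_left_le_imp_le)
    also have "\<dots> = t (Suc k) c0 + (\<Sum>c\<in>Fq 1 - {0} - {c0}. t (Suc k) c)"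
      using finF c0 by (subst sum.remove[of _ c0]) auto
    also have "\<dots> \<le> (- 2 - 4 ^ k * \<delta>) + (\<Sum>c\<in>Fq 1 - {0} - {c0}. 2)"
      using upper by (intro add_mono drop sum_mono) auto
    also have "(\<Sum>c\<in>Fq 1 - {0} - {c0}. 2 :: real) \<le> 2 * real p"
      using finF cardF card_mono[of "Fq 1" "Fq 1 - {0} - {c0}"] by auto
    finally show ?thesis by linarith
  qed
  obtain K where "8 * real p / \<delta> < of_nat K" using reals_Archimedean2 by blast
  then have K: "8 * real p < real K * \<delta>" using \<open>\<delta> > 0\<close> by (simp add: field_simps)
  \<comment> \<open>\<open>K\<close> makes the growth exceed \<open>8 * p\<close>; the 2 guarantees
    \<open>p^(2^k) \<ge> p^4 > 4 * p\<close>, as the point count requires.\<close>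
  define k where "k = max K 2"
  have "K < 4 ^ K" by (rule less_exp[THEN less_le_trans]) (simp add: power_mono)
  also have "(4::nat) ^ K \<le> 4 ^ k" by (intro power_increasing) (auto simp: k_def)
  finally have "real K \<le> real (4 ^ k)" by (simp only: of_nat_le_iff)
  then have Kk: "real K * \<delta> \<le> 4 ^ k * \<delta>"
    using \<open>\<delta> > 0\<close> by (intro mult_right_mono) simp_all
  have "p ^ 2 ^ k > 4 * p"
  proof -
    have "(2::nat) ^ 2 \<le> 2 ^ k" by (intro power_increasing) (auto simp: k_def)
    then have "p ^ 4 \<le> p ^ 2 ^ k" using p_ge_3 by (intro power_increasing) auto
    moreover have "4 * p < p ^ 4"
    proof -
      have "3 ^ 3 \<le> p ^ 3" using p_ge_3 by (intro power_mono) auto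
      then have "4 < p ^ 3" by simp
      then have "4 * p < p ^ 3 * p" using p_ge_3 by (intro mult_strict_right_mono) auto
      then show ?thesis by (simp add: numeral_eq_Suc mult_ac)
    qed
    ultimately show ?thesis by linarith
  qed
  from bound[OF this] K Kk show False by linarith
qed

theorem weil_kloosterman:
  assumes "\<not> int p dvd m" "\<not> int p dvd n"
  shows "norm (kloosterman p m n) \<le> 2 * sqrt p"
proof -
  have nz: "(of_int k :: 'k) = 0 \<longleftrightarrow> int p dvd k" for k
    by (simp add: of_int_eq_0_iff_char_dvd char_p)
  have in_F: "(of_int k :: 'k) \<in> Fq (Suc 0)" for k using of_int_in_Fq_1 by simp
  have "kloosterman p m n = (\<Sum>z\<in>inv_pairs p. psi (of_int m * of_int (fst z) + of_int n / of_int (fst z)))"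
    unfolding kloosterman_def
  proof (rule sum.cong)
    fix z assume "z \<in> inv_pairs p"
    then obtain x y where z: "z = (x, y)" and xy: "[x * y = 1] (mod int p)" by (auto simp: inv_pairs_def)
    then have "(of_int (x * y) :: 'k) = of_int 1" by (simp only: of_int_eq_iff_cong)
    then have "(of_int x :: 'k) * of_int y = 1" by simp
    then have "(of_int y :: 'k) = 1 / of_int x" by (metis mult_zero_left nonzero_mult_div_cancel_left zero_neq_one)
    then have "of_int m * of_int x + of_int n / of_int x = (of_int (m * x + n * y) :: 'k)" by simp
    then show "(case z of (x, y) \<Rightarrow> ec p (m * x + n * y)) =
        psi (of_int m * of_int (fst z) + of_int n / of_int (fst z))"
      by (simp add: z psi_of_int del: of_int_add of_int_mult)
  qed simp
  also have "\<dots> = (\<Sum>x\<in>Fq 1 - {0}. psi (of_int m * x + of_int n / x))"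
  proof (rule sum.reindex_bij_betw[of "\<lambda>z. of_int (fst z)"])
    show "bij_betw (\<lambda>z. of_int (fst z)) (inv_pairs p) (Fq 1 - {0 :: 'k})"
      unfolding bij_betw_def
    proof
      show "inj_on (\<lambda>z. of_int (fst z) :: 'k) (inv_pairs p)"
      proof (rule inj_onI)
        fix z z' assume z: "z \<in> inv_pairs p" and z': "z' \<in> inv_pairs p"
          and "(of_int (fst z) :: 'k) = of_int (fst z')"
        then have x: "fst z = fst z'" using inj_on_of_int by (auto simp: inv_pairs_def inj_on_def)
        have "[snd z' = snd z' * (fst z * snd z)] (mod int p)"
          using z cong_scalar_left[of "fst z * snd z" 1 "int p" "snd z'"]
          by (auto simp: inv_pairs_def cong_sym)
        moreover have "snd z' * (fst z * snd z) = snd z * (fst z' * snd z')" using x by simp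
        moreover have "[snd z * (fst z' * snd z') = snd z * 1] (mod int p)"
          using z' by (intro cong_scalar_left) (auto simp: inv_pairs_def)
        ultimately have "[snd z' = snd z] (mod int p)" by (metis cong_trans mult.right_neutral)
        then have "snd z' = snd z" using z z' by (auto simp: inv_pairs_def cong_def)
        then show "z = z'" using x by (simp add: prod_eq_iff)
      qed
      show "(\<lambda>z. of_int (fst z)) ` inv_pairs p = Fq 1 - {0 :: 'k}"
      proof (intro Set.set_eqI iffI)
        fix u :: 'k assume "u \<in> (\<lambda>z. of_int (fst z)) ` inv_pairs p"
        then obtain x y where u: "u = of_int x" and xy: "[x * y = 1] (mod int p)"
          by (auto simp: inv_pairs_def)
        then have "(of_int (x * y) :: 'k) = of_int 1" by (simp only: of_int_eq_iff_cong)
        then have "u * of_int y = 1" using u by simp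
        then have "u \<noteq> 0" by (metis mult_zero_left zero_neq_one)
        moreover have "u \<in> Fq 1" unfolding u by (rule of_int_in_Fq_1)
        ultimately show "u \<in> Fq 1 - {0}" by blast
      next
        fix u :: 'k assume "u \<in> Fq 1 - {0}"
        then have uF: "u \<in> Fq 1" and unz: "u \<noteq> 0" by simp_all
        from uF obtain x where x: "x \<in> {0..<int p}" "u = of_int x"
          unfolding Fq_1_eq by (rule imageE) simp
        have "1 / u \<in> Fq 1" using uF Fq_closed(2) by (rule Fq_closed(6)[rotated])
        then obtain y where y: "y \<in> {0..<int p}" "1 / u = of_int y"
          unfolding Fq_1_eq by (rule imageE) simp
        have "(of_int (x * y) :: 'k) = of_int 1" using x(2) y(2)[symmetric] unz by simp
        then have "[x * y = 1] (mod int p)" by (simp only: of_int_eq_iff_cong)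
        then show "u \<in> (\<lambda>z. of_int (fst z)) ` inv_pairs p"
          using x y by (intro image_eqI[of _ _ "(x, y)"]) (auto simp: inv_pairs_def)
      qed
    qed
  qed
  \<comment> \<open>The bound is applied with \<open>c0 = m\<close> and
    \<open>b = n / m\<close>.\<close>
  also have "\<dots> = S 1 (of_int m) (of_int m * (of_int n / of_int m))"
    using assms by (simp add: S_def nz)
  also have "norm \<dots> \<le> 2 * sqrt p"
    using assms in_F by (intro norm_S_1_le) (auto simp: nz)
  finally show ?thesis .
qed

end

section \<open>Kloosterman sums modulo prime powers\<close>

lemma inv_pairs_unique:
  assumes "(x, y) \<in> inv_pairs q" "(x, y') \<in> inv_pairs q"
  shows "y = y'"
proof -
  have xy: "[x * y = 1] (mod int q)" "[x * y' = 1] (mod int q)" using assms by (auto simp: inv_pairs_def)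
  have "[y' = y' * (x * y)] (mod int q)"
    using cong_scalar_left[OF xy(1), of y'] by (simp add: cong_sym)
  also have "y' * (x * y) = y * (x * y')" by simp
  also have "[y * (x * y') = y * 1] (mod int q)" using xy(2) by (rule cong_scalar_left)
  finally have "[y = y'] (mod int q)" by (simp add: cong_sym)
  then show ?thesis using assms by (auto simp: inv_pairs_def cong_def)
qed

lemma inv_pairs_sym: "(x, y) \<in> inv_pairs q \<longleftrightarrow> (y, x) \<in> inv_pairs q"
  by (auto simp: inv_pairs_def mult.commute)

lemma inv_pairs_modI:
  assumes "q > 0" "[x * y = 1] (mod int q)"
  shows "(x mod int q, y mod int q) \<in> inv_pairs q"
  using assms by (auto simp: inv_pairs_def cong_def mod_mult_eq)

lemma inv_pairs_coprime: "(x, y) \<in> inv_pairs q \<Longrightarrow> coprime x (int q) \<and> coprime y (int q)"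
  unfolding inv_pairs_def by (auto simp: coprime_iff_invertible_int mult.commute)

lemma ex_inv_pair:
  assumes "q > 0" "coprime x (int q)" "x \<in> {0..<int q}"
  shows "\<exists>y. (x, y) \<in> inv_pairs q"
proof -
  obtain y where "[x * y = 1] (mod int q)" using assms(2) cong_solve_coprime_int by blast
  from inv_pairs_modI[OF assms(1) this] show ?thesis using assms(3) by auto
qed

lemma inj_on_fst_inv_pairs: "inj_on fst (inv_pairs q)"
  using inv_pairs_unique by (intro inj_onI) (auto simp: prod_eq_iff)

lemma inj_on_snd_inv_pairs: "inj_on snd (inv_pairs q)"
proof (rule inj_onI)
  fix z z' assume "z \<in> inv_pairs q" "z' \<in> inv_pairs q" "snd z = snd z'"
  then show "z = z'" by (cases z, cases z') (metis inv_pairs_sym inv_pairs_unique snd_conv)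
qed

lemma fst_image_inv_pairs: "q > 0 \<Longrightarrow> fst ` inv_pairs q = {x \<in> {0..<int q}. coprime x (int q)}"
proof (intro Set.set_eqI iffI)
  fix x assume "x \<in> fst ` inv_pairs q"
  then show "x \<in> {x \<in> {0..<int q}. coprime x (int q)}"
    using inv_pairs_coprime by (auto simp: inv_pairs_def)
next
  fix x assume "q > 0" "x \<in> {x \<in> {0..<int q}. coprime x (int q)}"
  with ex_inv_pair[of q x] obtain y where "(x, y) \<in> inv_pairs q" by auto
  then show "x \<in> fst ` inv_pairs q" by (rule rev_image_eqI) simp
qed

lemma card_inv_pairs_le: "card (inv_pairs q) \<le> q"
proof -
  have "fst ` inv_pairs q \<subseteq> {0..<int q}" by (auto simp: inv_pairs_def)
  from card_inj_on_le[OF inj_on_fst_inv_pairs this] show ?thesis by simp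
qed

lemma kloosterman_commute: "kloosterman q m n = kloosterman q n m"
  unfolding kloosterman_def
  by (rule sum.reindex_bij_witness[of _ prod.swap prod.swap])
    (auto simp: add.commute inv_pairs_sym)

lemma norm_kloosterman_le: "norm (kloosterman q m n) \<le> card (inv_pairs q)"
proof -
  have "norm (kloosterman q m n) \<le> (\<Sum>z\<in>inv_pairs q. norm (case z of (x, y) \<Rightarrow> ec q (m * x + n * y)))"
    unfolding kloosterman_def by (rule norm_sum)
  also have "\<dots> = card (inv_pairs q)" by (simp add: case_prod_unfold)
  finally show ?thesis .
qed

text \<open>The term in \<open>n\<close> is trivial, and the complete sum over \<open>x\<close>
  loses only its term \<open>x = 0\<close>.\<close>

lemma kloosterman_prime_dvd:
  assumes p: "prime p" and n: "int p dvd n" and m: "\<not> int p dvd m"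
  shows "kloosterman p m n = - 1"
proof -
  have p0: "p > 0" using p by (simp add: prime_gt_0_nat)
  have "kloosterman p m n = (\<Sum>z\<in>inv_pairs p. ec p (fst z * m))"
    unfolding kloosterman_def
  proof (rule sum.cong)
    fix z assume "z \<in> inv_pairs p"
    have "[m * fst z + n * snd z = fst z * m] (mod int p)"
      using n by (simp add: cong_iff_dvd_diff mult.commute)
    from ec_cong[OF this] show "(case z of (x, y) \<Rightarrow> ec p (m * x + n * y)) = ec p (fst z * m)"
      by (simp add: case_prod_unfold)
  qed simp
  also have "\<dots> = (\<Sum>x\<in>{x \<in> {0..<int p}. coprime x (int p)}. ec p (x * m))"
    using sum.reindex[OF inj_on_fst_inv_pairs, of "\<lambda>x. ec p (x * m)" p]
    by (simp add: fst_image_inv_pairs[OF p0] o_def)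
  also have "{x \<in> {0..<int p}. coprime x (int p)} = {0..<int p} - {0}"
  proof -
    have "coprime x (int p) \<longleftrightarrow> x \<noteq> 0" if "x \<in> {0..<int p}" for x
    proof -
      have "coprime x (int p) \<longleftrightarrow> \<not> int p dvd x"
        using p by (metis coprime_commute prime_imp_coprime_int prime_nat_int_transfer
            coprime_absorb_left not_prime_unit)
      then show ?thesis using that by (auto dest: zdvd_imp_le)
    qed
    then show ?thesis by auto
  qed
  also have "(\<Sum>x\<in>{0..<int p} - {0}. ec p (x * m)) = (\<Sum>x\<in>{0..<int p}. ec p (x * m)) - 1"
    using p0 by (subst (2) sum.remove[of _ 0]) auto
  also have "\<dots> = - 1" using ec_sum[OF p0, of m] m by simp
  finally show ?thesis .
qed

text \<open>The phase depends only on residues modulo \<open>q\<close>. As \<open>p\<close> divides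
  \<open>q\<close>, all \<open>p\<close> lifts of a unit modulo \<open>q\<close> are units modulo
  \<open>p * q\<close>.\<close>

lemma kloosterman_descent:
  assumes p: "prime p" and pq: "p dvd q" and q: "q > 0"
  shows "kloosterman (p * q) (int p * m) (int p * n) = of_nat p * kloosterman q m n"
proof -
  have p0: "p > 0" using p by (simp add: prime_gt_0_nat)
  let ?f = "\<lambda>z. (fst z mod int q, snd z mod int q)"
  let ?F = "\<lambda>z :: int \<times> int. ec q (m * fst z + n * snd z)"
  have "kloosterman (p * q) (int p * m) (int p * n) = (\<Sum>z\<in>inv_pairs (p * q). ?F z)"
    unfolding kloosterman_def
  proof (rule sum.cong)
    fix z
    have "int p * m * fst z + int p * n * snd z = int p * (m * fst z + n * snd z)"
      by (simp add: algebra_simps)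
    then show "(case z of (x, y) \<Rightarrow> ec (p * q) (int p * m * x + int p * n * y)) = ?F z"
      using ec_scale[OF p0, of q] by (simp add: case_prod_unfold)
  qed simp
  also have "\<dots> = (\<Sum>w\<in>inv_pairs q. \<Sum>z\<in>{z \<in> inv_pairs (p * q). ?f z = w}. ?F z)"
  proof (rule sum.group[symmetric])
    show "?f ` inv_pairs (p * q) \<subseteq> inv_pairs q"
    proof (rule image_subsetI)
      fix z assume "z \<in> inv_pairs (p * q)"
      then have "[fst z * snd z = 1] (mod int p * int q)" by (auto simp: inv_pairs_def)
      then have "[fst z * snd z = 1] (mod int q)" by (rule cong_modulus_mult[rotated] cong_dvd_modulus) simp
      then show "?f z \<in> inv_pairs q" using inv_pairs_modI[OF q] by simp
    qed
  qed auto
  also have "\<dots> = (\<Sum>w\<in>inv_pairs q. of_nat p * ?F w)"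
  proof (rule sum.cong)
    fix w assume w: "w \<in> inv_pairs q"
    obtain u v where uv: "w = (u, v)" by (cases w)
    let ?X = "{z \<in> inv_pairs (p * q). ?f z = w}"
    have "?F z = ?F w" if "z \<in> ?X" for z
    proof (rule ec_cong)
      have "fst z mod int q = fst w mod int q" "snd z mod int q = snd w mod int q"
        using that by (auto simp: uv)
      then show "[m * fst z + n * snd z = m * fst w + n * snd w] (mod int q)"
        by (intro cong_add cong_scalar_left) (auto simp: cong_def)
    qed
    moreover have "card ?X = p"
    proof -
      have "fst ` ?X = (\<lambda>i. u + int q * i) ` {0..<int p}"
      proof (intro Set.set_eqI iffI)
        fix x assume "x \<in> fst ` ?X"
        then have x: "0 \<le> x" "x < int p * int q" "x mod int q = u" by (auto simp: inv_pairs_def uv)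
        then have "x = u + int q * (x div int q)" by (metis mod_mult_div_eq)
        moreover have "x div int q < int p"
        proof (rule ccontr)
          assume "\<not> x div int q < int p"
          then have "int p * int q \<le> x div int q * int q" by (intro mult_right_mono) auto
          moreover have "x div int q * int q + x mod int q = x" by simp
          moreover have "x mod int q \<ge> 0" using q by simp
          ultimately show False using x(2) by linarith
        qed
        then have "x div int q \<in> {0..<int p}"
          using x q by (simp add: pos_imp_zdiv_nonneg_iff)
        ultimately show "x \<in> (\<lambda>i. u + int q * i) ` {0..<int p}" by blast
      next
        fix x assume "x \<in> (\<lambda>i. u + int q * i) ` {0..<int p}"
        then obtain i where i: "0 \<le> i" "i < int p" "x = u + int q * i" by auto
        have u: "0 \<le> u" "u < int q" using w by (auto simp: uv inv_pairs_def)
        have "int q * i \<le> int q * (int p - 1)" using i by (intro mult_left_mono) auto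
        then have xr: "x \<in> {0..<int (p * q)}" using i u by (auto simp: algebra_simps)
        have xu: "x mod int q = u" using u i by simp
        have "coprime u (int q)" using w inv_pairs_coprime uv by blast
        then have "coprime x (int q)" using xu by (metis coprime_mod_left_iff of_nat_0_less_iff q less_numeral_extra(3))
        moreover from this have "coprime x (int p)" using pq by (meson coprime_divisors dvd_refl int_dvd_int_iff)
        ultimately have "coprime x (int (p * q))" by simp
        from ex_inv_pair[OF _ this xr] p0 q obtain y where y: "(x, y) \<in> inv_pairs (p * q)" by auto
        then have "[x * y = 1] (mod int p * int q)" by (auto simp: inv_pairs_def)
        then have "[x * y = 1] (mod int q)" by (rule cong_dvd_modulus) simp
        from inv_pairs_modI[OF q this] have "(u, y mod int q) \<in> inv_pairs q" unfolding xu .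
        then have "y mod int q = v" using w uv inv_pairs_unique by blast
        then have "(x, y) \<in> ?X" using y xu uv by simp
        then show "x \<in> fst ` ?X" by (rule rev_image_eqI) simp
      qed
      moreover have "card (fst ` ?X) = card ?X"
        by (rule card_image[OF inj_on_subset[OF inj_on_fst_inv_pairs]]) auto
      moreover have "card ((\<lambda>i. u + int q * i) ` {0..<int p}) = p"
        using q by (subst card_image) (auto simp: inj_on_def)
      ultimately show ?thesis by simp
    qed
    ultimately show "(\<Sum>z\<in>?X. ?F z) = of_nat p * ?F w" by simp
  qed simp
  also have "\<dots> = of_nat p * kloosterman q m n"
    by (simp add: kloosterman_def sum_distrib_left case_prod_unfold)
  finally show ?thesis .
qed

text \<open>If \<open>x y = 1\<close>, then the inverse of \<open>x + A t\<close> is \<open>y - A t y\<^sup>2\<close>, since \<open>q\<close> divides \<open>A\<^sup>2\<close>; averaging over \<open>t\<close>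
  leaves only the stationary points.\<close>

lemma kloosterman_stationary:
  assumes q: "q = A * M" "q > 0" and A2: "q dvd A * A"
  shows "kloosterman q m n = (\<Sum>z\<in>{z \<in> inv_pairs q. int M dvd m - n * (snd z)\<^sup>2}. ec q (m * fst z + n * snd z))"
proof -
  have M: "M > 0" and A: "A > 0" using q by auto
  let ?F = "\<lambda>z :: int \<times> int. ec q (m * fst z + n * snd z)"
  let ?\<phi> = "\<lambda>t z. ((fst z + int A * t) mod int q, (snd z - int A * t * (snd z)\<^sup>2) mod int q)"
  have bij: "bij_betw (?\<phi> t) (inv_pairs q) (inv_pairs q)" for t
  proof -
    have "?\<phi> t ` inv_pairs q \<subseteq> inv_pairs q"
    proof (rule image_subsetI)
      fix z assume z: "z \<in> inv_pairs q"
      obtain x y where xy: "z = (x, y)" by (cases z)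
      have "[x * y = 1] (mod int q)" using z xy by (auto simp: inv_pairs_def)
      then obtain k where k: "x * y = 1 + int q * k" by (metis cong_iff_lin cong_sym mult.commute)
      obtain l where l: "int A * int A = int q * l"
        using A2 by (metis dvd_def int_dvd_int_iff of_nat_mult)
      have "(x + int A * t) * (y - int A * t * y\<^sup>2) - 1 =
          int q * (k - int A * t * y * k - l * t\<^sup>2 * y\<^sup>2)"
        using k l by Groebner_Basis.algebra
      then have "[(x + int A * t) * (y - int A * t * y\<^sup>2) = 1] (mod int q)"
        by (simp add: cong_iff_dvd_diff)
      from inv_pairs_modI[OF q(2) this] show "?\<phi> t z \<in> inv_pairs q" by (simp add: xy)
    qed
    moreover have "inj_on (?\<phi> t) (inv_pairs q)"
    proof (rule inj_onI)
      fix z z' assume z: "z \<in> inv_pairs q" "z' \<in> inv_pairs q" and eq: "?\<phi> t z = ?\<phi> t z'"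
      then have "[fst z + int A * t = fst z' + int A * t] (mod int q)" by (simp add: cong_def)
      then have "[fst z = fst z'] (mod int q)" by (simp add: cong_add_rcancel)
      then have "fst z = fst z'" using z by (auto simp: inv_pairs_def cong_def)
      then show "z = z'" using z inj_on_fst_inv_pairs by (auto dest: inj_onD)
    qed
    ultimately show ?thesis
      using endo_inj_surj[OF finite_inv_pairs] by (simp add: bij_betw_def)
  qed
  have shift: "kloosterman q m n = (\<Sum>z\<in>inv_pairs q. ?F z * ec M (t * (m - n * (snd z)\<^sup>2)))" for t
  proof -
    have "kloosterman q m n = (\<Sum>z\<in>inv_pairs q. ?F (?\<phi> t z))"
      unfolding sum.reindex_bij_betw[OF bij, of ?F] by (simp add: kloosterman_def case_prod_unfold)
    also have "\<dots> = (\<Sum>z\<in>inv_pairs q. ?F z * ec M (t * (m - n * (snd z)\<^sup>2)))"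
    proof (rule sum.cong)
      fix z assume "z \<in> inv_pairs q"
      have "?F (?\<phi> t z) = ec q (m * (fst z + int A * t) + n * (snd z - int A * t * (snd z)\<^sup>2))"
        by (rule ec_cong, intro cong_add cong_scalar_left) (auto simp: cong_def)
      also have "m * (fst z + int A * t) + n * (snd z - int A * t * (snd z)\<^sup>2) =
          (m * fst z + n * snd z) + int A * (t * (m - n * (snd z)\<^sup>2))"
        by (simp add: algebra_simps)
      also have "ec q \<dots> = ?F z * ec M (t * (m - n * (snd z)\<^sup>2))"
        by (simp add: ec_add q(1) ec_scale[OF A])
      finally show "?F (?\<phi> t z) = ?F z * ec M (t * (m - n * (snd z)\<^sup>2))" .
    qed simp
    finally show ?thesis .
  qed
  have "of_nat M * kloosterman q m n = (\<Sum>t\<in>{0..<int M}. kloosterman q m n)" by simp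
  also have "\<dots> = (\<Sum>t\<in>{0..<int M}. \<Sum>z\<in>inv_pairs q. ?F z * ec M (t * (m - n * (snd z)\<^sup>2)))"
    by (rule sum.cong[OF refl shift])
  also have "\<dots> = (\<Sum>z\<in>inv_pairs q. ?F z * (if int M dvd m - n * (snd z)\<^sup>2 then of_nat M else 0))"
    by (subst sum.swap) (simp add: ec_sum[OF M] flip: sum_distrib_left)
  also have "\<dots> = of_nat M * (\<Sum>z\<in>{z \<in> inv_pairs q. int M dvd m - n * (snd z)\<^sup>2}. ?F z)"
    unfolding sum_distrib_left by (rule sum.mono_neutral_cong_right) auto
  finally show ?thesis using M by simp
qed

section \<open>Counting stationary points\<close>

definition roots_mod :: "nat \<Rightarrow> int \<Rightarrow> int \<Rightarrow> int set" where
  "roots_mod M m n = {v \<in> {0..<int M}. int M dvd m - n * v\<^sup>2}"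

lemma finite_roots_mod [simp]: "finite (roots_mod M m n)"
  by (rule finite_subset[of _ "{0..<int M}"]) (auto simp: roots_mod_def)

lemma card_roots_mod_le: "card (roots_mod M m n) \<le> M"
proof -
  have "roots_mod M m n \<subseteq> {0..<int M}" by (auto simp: roots_mod_def)
  from card_mono[OF _ this] show ?thesis by simp
qed

lemma roots_mod_diff:
  assumes p: "prime p" and m: "\<not> int p dvd m" and n: "\<not> int p dvd n" and j: "j > 0"
    and v: "v \<in> roots_mod (p ^ j) m n" and w: "w \<in> roots_mod (p ^ j) m n"
  shows "int p ^ j dvd (v - w) * (v + w)" "\<not> int p dvd v" "\<not> int p dvd w"
proof -
  have pj: "int p dvd int (p ^ j)" using j by (cases j) auto
  have dv: "int (p ^ j) dvd m - n * v\<^sup>2" and dw: "int (p ^ j) dvd m - n * w\<^sup>2"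
    using v w by (auto simp: roots_mod_def)
  have "int (p ^ j) dvd (m - n * w\<^sup>2) - (m - n * v\<^sup>2)" using dw dv by (rule dvd_diff)
  also have "\<dots> = n * ((v - w) * (v + w))" by (simp add: power2_eq_square algebra_simps)
  finally have "int (p ^ j) dvd n * ((v - w) * (v + w))" .
  moreover have "coprime (int (p ^ j)) n"
    using p n prime_imp_coprime[of "int p" n] by (simp add: prime_nat_int_transfer)
  ultimately show "int p ^ j dvd (v - w) * (v + w)"
    using coprime_dvd_mult_right_iff by (metis of_nat_power)
  have "\<not> int p dvd z" if "int (p ^ j) dvd m - n * z\<^sup>2" for z
  proof
    assume "int p dvd z"
    then have "int p dvd n * z\<^sup>2" by (simp add: power2_eq_square)
    moreover have "int p dvd m - n * z\<^sup>2" using pj that by (rule dvd_trans)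
    ultimately have "int p dvd m" by (metis dvd_add diff_add_cancel)
    then show False using m by simp
  qed
  then show "\<not> int p dvd v" "\<not> int p dvd w" using dv dw by auto
qed

text \<open>For two roots \<open>v\<close>, \<open>w\<close> the power \<open>p^j\<close> divides
  \<open>(v - w) * (v + w)\<close>. If \<open>p\<close> divided both factors it would divide
  \<open>2 * w\<close>; so the whole power divides one of them.\<close>

lemma card_roots_mod_odd:
  assumes p: "prime p" "odd p" and mn: "\<not> int p dvd m" "\<not> int p dvd n" and j: "j > 0"
  shows "card (roots_mod (p ^ j) m n) \<le> 2"
proof (cases "roots_mod (p ^ j) m n = {}")
  case False
  then obtain w where w: "w \<in> roots_mod (p ^ j) m n" by blast
  have pp: "prime (int p)" using p by simp
  have "roots_mod (p ^ j) m n \<subseteq> {w, (- w) mod int (p ^ j)}"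
  proof
    fix v assume v: "v \<in> roots_mod (p ^ j) m n"
    note d = roots_mod_diff[OF p(1) mn j v w]
    have range: "0 \<le> v" "v < int (p ^ j)" "0 \<le> w" "w < int (p ^ j)"
      using v w by (auto simp: roots_mod_def)
    have "\<not> (int p dvd v - w \<and> int p dvd v + w)"
    proof
      assume "int p dvd v - w \<and> int p dvd v + w"
      then have "int p dvd (v + w) - (v - w)" using dvd_diff by blast
      then have "int p dvd 2 * w" by simp
      then have "int p dvd 2" using d(3) pp by (simp add: prime_dvd_mult_iff)
      then have "p dvd 2" by presburger
      then show False using p by (metis primes_dvd_imp_eq two_is_prime_nat even_numeral dvd_refl)
    qed
    then consider "coprime (int p ^ j) (v - w)" | "coprime (int p ^ j) (v + w)"
      using prime_imp_coprime[OF pp] by (meson coprime_power_left_iff)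
    then show "v \<in> {w, (- w) mod int (p ^ j)}"
    proof cases
      case 1
      then have "int (p ^ j) dvd v - (- w)" using d(1) by (simp add: coprime_dvd_mult_right_iff)
      then have "v mod int (p ^ j) = (- w) mod int (p ^ j)" by (metis mod_eq_dvd_iff)
      then show ?thesis using range by simp
    next
      case 2
      then have "int (p ^ j) dvd v - w" using d(1) by (simp add: coprime_dvd_mult_left_iff)
      then have "v mod int (p ^ j) = w mod int (p ^ j)" by (metis mod_eq_dvd_iff)
      then show ?thesis using range by simp
    qed
  qed
  from card_mono[OF _ this] show ?thesis by (auto simp: card_insert_if split: if_splits)
qed simp

text \<open>All roots are odd, and of \<open>(v - w) / 2\<close> and \<open>(v + w) / 2\<close>
  exactly one is odd, because their sum is \<open>v\<close>. Hence \<open>v\<close> is congruent to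
  \<open>w\<close> or \<open>- w\<close> modulo half the modulus, which leaves four classes.\<close>

lemma card_roots_mod_2:
  assumes mn: "odd m" "odd n"
  shows "card (roots_mod (2 ^ Suc j) m n) \<le> 4"
proof (cases "roots_mod (2 ^ Suc j) m n = {}")
  case False
  then obtain w where w: "w \<in> roots_mod (2 ^ Suc j) m n" by blast
  define h :: int where "h = 2 ^ j"
  let ?N = "2 * h"
  have "roots_mod (2 ^ Suc j) m n \<subseteq> (\<lambda>x. x mod ?N) ` {w, w + h, - w, - w + h}"
  proof
    fix v assume v: "v \<in> roots_mod (2 ^ Suc j) m n"
    have d: "?N dvd (v - w) * (v + w)" "odd v" "odd w"
      using roots_mod_diff[OF two_is_prime_nat _ _ _ v w] mn by (auto simp: h_def)
    have range: "0 \<le> v" "v < ?N" using v by (auto simp: roots_mod_def h_def)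
    obtain a b where ab: "v - w = 2 * a" "v + w = 2 * b" using d by (metis dvd_def even_diff_iff even_add)
    have "odd (a + b)"
    proof -
      have "a + b = v" using ab by linarith
      then show ?thesis using d by simp
    qed
    have "(v - w) * (v + w) = 2 * (2 * (a * b))" unfolding ab by simp
    with d(1) have "?N dvd 2 * (2 * (a * b))" by (simp only:)
    then have hab: "h dvd 2 * (a * b)" unfolding dvd_mult_cancel_left by simp
    have "h dvd 2 * a \<or> h dvd 2 * b"
    proof (cases "even a")
      case True
      then have "odd b" using \<open>odd (a + b)\<close> by simp
      then have "coprime h b" unfolding h_def by simp
      then show ?thesis using hab by (metis coprime_dvd_mult_left_iff mult.assoc)
    next
      case False
      then have "coprime h a" unfolding h_def by simp
      then show ?thesis using hab by (metis coprime_dvd_mult_left_iff mult.assoc mult.commute)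
    qed
    then have "h dvd v - w \<or> h dvd v - (- w)" using ab by simp
    then obtain s i where s: "s = w \<or> s = - w" and i: "v = s + h * i"
      by (metis dvd_def diff_add_cancel add.commute)
    have "v mod ?N = s mod ?N \<or> v mod ?N = (s + h) mod ?N"
    proof (cases "even i")
      case True
      then obtain i' where "i = 2 * i'" by blast
      then have "v = s + ?N * i'" using i by simp
      then show ?thesis by simp
    next
      case False
      then obtain i' where "i = 2 * i' + 1" by (blast elim: oddE)
      then have "v = (s + h) + ?N * i'" using i by (simp add: algebra_simps)
      then show ?thesis by simp
    qed
    moreover have "v mod ?N = v" using range by simp
    ultimately show "v \<in> (\<lambda>x. x mod ?N) ` {w, w + h, - w, - w + h}" using s by auto
  qed
  then have "card (roots_mod (2 ^ Suc j) m n) \<le> card ((\<lambda>x. x mod ?N) ` {w, w + h, - w, - w + h})"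
    by (intro card_mono) auto
  also have "\<dots> \<le> card {w, w + h, - w, - w + h}" by (rule card_image_le) simp
  also have "\<dots> \<le> 4" by (simp add: card_insert_if)
  finally show ?thesis .
qed simp

lemma roots_mod_iff:
  assumes "M > 0"
  shows "int M dvd m - n * y\<^sup>2 \<longleftrightarrow> y mod int M \<in> roots_mod M m n"
proof -
  have "[m - n * y\<^sup>2 = m - n * (y mod int M)\<^sup>2] (mod int M)"
    by (intro cong_diff cong_scalar_left cong_pow) (auto simp: cong_def)
  then show ?thesis using assms by (simp add: roots_mod_def cong_dvd_iff)
qed

text \<open>Trivial estimate over the stationary points: every root modulo \<open>M\<close> has at
  most \<open>A\<close> lifts modulo \<open>q\<close>.\<close>

lemma norm_kloosterman_le_roots:
  assumes q: "q = A * M" "q > 0" and A2: "q dvd A * A"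
  shows "norm (kloosterman q m n) \<le> A * card (roots_mod M m n)"
proof -
  have M: "M > 0" and A: "A > 0" using q by auto
  let ?X = "{z \<in> inv_pairs q. int M dvd m - n * (snd z)\<^sup>2}"
  have "norm (kloosterman q m n) \<le> (\<Sum>z\<in>?X. norm (ec q (m * fst z + n * snd z)))"
    unfolding kloosterman_stationary[OF q A2] by (rule norm_sum)
  also have "\<dots> = card ?X" by simp
  also have "card ?X \<le> card (roots_mod M m n \<times> {0..<int A})"
  proof (rule card_inj_on_le[of "\<lambda>z. (snd z mod int M, snd z div int M)"])
    show "inj_on (\<lambda>z. (snd z mod int M, snd z div int M)) ?X"
    proof (rule inj_onI)
      fix z z' assume z: "z \<in> ?X" "z' \<in> ?X" 
        and eq: "(snd z mod int M, snd z div int M) = (snd z' mod int M, snd z' div int M)"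
      then have "snd z = snd z'" by (metis div_mult_mod_eq prod.inject)
      then show "z = z'" using z inj_on_snd_inv_pairs by (auto dest: inj_onD)
    qed
    show "(\<lambda>z. (snd z mod int M, snd z div int M)) ` ?X \<subseteq> roots_mod M m n \<times> {0..<int A}"
    proof (rule image_subsetI)
      fix z assume z: "z \<in> ?X"
      then have y: "0 \<le> snd z" "snd z < int A * int M" by (auto simp: inv_pairs_def q)
      have "snd z div int M < int A"
      proof (rule ccontr)
        assume "\<not> snd z div int M < int A"
        then have "int A * int M \<le> snd z div int M * int M" by (intro mult_right_mono) auto
        moreover have "snd z div int M * int M + snd z mod int M = snd z" by simp
        moreover have "snd z mod int M \<ge> 0" using M by simp
        ultimately show False using y by linarith
      qed
      then show "(snd z mod int M, snd z div int M) \<in> roots_mod M m n \<times> {0..<int A}"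
        using z y M by (simp add: roots_mod_iff[OF M] pos_imp_zdiv_nonneg_iff)
    qed
  qed simp
  also have "card (roots_mod M m n \<times> {0..<int A}) = A * card (roots_mod M m n)"
    by (simp add: card_cartesian_product)
  finally show ?thesis by simp
qed

lemma sum_mod_reduce:
  fixes f :: "int \<Rightarrow> complex"
  assumes "\<And>t. f (t mod int p) = f t" "p > 0"
  shows "(\<Sum>t\<in>{0..<int (p * M)}. f t) = of_nat M * (\<Sum>t\<in>{0..<int p}. f t)"
proof (induction M)
  case (Suc M)
  have "(\<Sum>t\<in>{0..<int (p * Suc M)}. f t) = (\<Sum>t\<in>{0..<int (p * M)}. f t) + (\<Sum>t\<in>{int (p * M)..<int (p * Suc M)}. f t)"
  proof -
    have "0 \<le> int (p * M)" "int (p * M) \<le> int (p * Suc M)" by simp_all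
    then have "{0..<int (p * Suc M)} = {0..<int (p * M)} \<union> {int (p * M)..<int (p * Suc M)}"
      by (simp only: ivl_disj_un)
    then show ?thesis by (simp only:) (rule sum.union_disjoint, auto)
  qed
  also have "(\<Sum>t\<in>{int (p * M)..<int (p * Suc M)}. f t) = (\<Sum>t\<in>{0..<int p}. f t)"
  proof (rule sum.reindex_bij_witness[of _ "\<lambda>t. t + int (p * M)" "\<lambda>t. t - int (p * M)"])
    fix t assume "t \<in> {int (p * M)..<int (p * Suc M)}"
    have "(t - int (p * M)) mod int p = t mod int p" by (simp add: mod_diff_eq[symmetric])
    then show "f (t - int (p * M)) = f t" by (metis assms(1))
  qed auto
  finally show ?case using Suc by (simp add: algebra_simps)
qed simp

text \<open>Multiplying by the conjugate and substituting \<open>t = s + h\<close> makes the phase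
  linear in \<open>s\<close>; since \<open>2 * \<alpha>\<close> is a unit, only \<open>h = 0\<close>
  survives.\<close>

lemma norm_gauss_sum:
  assumes p: "prime p" "odd p" and \<alpha>: "\<not> int p dvd \<alpha>"
  shows "norm (\<Sum>t\<in>{0..<int p}. ec p (\<beta> * t + \<alpha> * t\<^sup>2)) ^ 2 = p"
proof -
  have p0: "p > 0" using p by (simp add: prime_gt_0_nat)
  let ?f = "\<lambda>t. ec p (\<beta> * t + \<alpha> * t\<^sup>2)"
  let ?G = "\<Sum>t\<in>{0..<int p}. ?f t"
  have per: "?f (t mod int p) = ?f t" for t
    by (rule ec_cong, intro cong_add cong_scalar_left cong_pow) (auto simp: cong_def)
  have "of_real (norm ?G ^ 2) = cnj ?G * ?G"
    by (simp only: complex_norm_square mult.commute[of "cnj ?G"])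
  also have "\<dots> = (\<Sum>s\<in>{0..<int p}. cnj (?f s) * ?G)"
    by (simp only: cnj_sum sum_distrib_right)
  also have "\<dots> = (\<Sum>s\<in>{0..<int p}. \<Sum>h\<in>{0..<int p}. ?f h * ec p (s * (2 * \<alpha> * h)))"
  proof (rule sum.cong)
    fix s
    have "?G = (\<Sum>h\<in>{0..<int p}. ?f (s + h))"
    proof -
      have "bij_betw (\<lambda>h. (s + h) mod int p) {0..<int p} {0..<int p}"
        by (rule bij_betwI[of _ _ _ "\<lambda>h. (h - s) mod int p"]) (use p0 in \<open>auto simp: mod_simps\<close>)
      from sum.reindex_bij_betw[OF this, of ?f] show ?thesis by (simp only: per)
    qed
    then have "cnj (?f s) * ?G = (\<Sum>h\<in>{0..<int p}. cnj (?f s) * ?f (s + h))"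
      by (simp add: sum_distrib_left)
    also have "\<dots> = (\<Sum>h\<in>{0..<int p}. ?f h * ec p (s * (2 * \<alpha> * h)))"
    proof (rule sum.cong)
      fix h
      have "- (\<beta> * s + \<alpha> * s\<^sup>2) + (\<beta> * (s + h) + \<alpha> * (s + h)\<^sup>2) =
          (\<beta> * h + \<alpha> * h\<^sup>2) + s * (2 * \<alpha> * h)" by (simp add: power2_eq_square algebra_simps)
      then show "cnj (?f s) * ?f (s + h) = ?f h * ec p (s * (2 * \<alpha> * h))"
        by (simp only: flip: ec_uminus ec_add)
    qed simp
    finally show "cnj (?f s) * ?G = (\<Sum>h\<in>{0..<int p}. ?f h * ec p (s * (2 * \<alpha> * h)))" .
  qed simp
  also have "\<dots> = (\<Sum>h\<in>{0..<int p}. ?f h * (\<Sum>s\<in>{0..<int p}. ec p (s * (2 * \<alpha> * h))))"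
    by (subst sum.swap) (simp add: sum_distrib_left)
  also have "\<dots> = (\<Sum>h\<in>{0..<int p}. if h = 0 then of_nat p else 0)"
  proof (rule sum.cong)
    fix h assume h: "h \<in> {0..<int p}"
    have pp: "prime (int p)" using p by simp
    have "\<not> int p dvd 2"
    proof
      assume "int p dvd 2"
      then have "p dvd 2" by presburger
      then show False using p by (metis primes_dvd_imp_eq two_is_prime_nat even_numeral dvd_refl)
    qed
    then have "int p dvd 2 * \<alpha> * h \<longleftrightarrow> int p dvd h" using pp \<alpha> by (simp add: prime_dvd_mult_iff)
    also have "\<dots> \<longleftrightarrow> h = 0" using h by (auto dest: zdvd_imp_le)
    finally show "?f h * (\<Sum>s\<in>{0..<int p}. ec p (s * (2 * \<alpha> * h))) = (if h = 0 then of_nat p else 0)"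
      using ec_sum[OF p0, of "2 * \<alpha> * h"] by simp
  qed simp
  also have "\<dots> = of_nat p" using p0 by simp
  finally show ?thesis by (metis of_real_eq_iff of_real_of_nat_eq)
qed

section \<open>Prime powers with exponent at least two\<close>

text \<open>Writing \<open>y = v + M t\<close> and expanding its inverse to second order turns the
  phase into a constant plus \<open>M^2 * (w t + \<alpha> t^2)\<close>. Modulo
  \<open>q = M^2 p\<close> this is a quadratic Gauss sum modulo \<open>p\<close>, repeated
  \<open>M\<close> times.\<close>

lemma norm_stationary_class_sum:
  assumes p: "prime p" "odd p" and mn: "\<not> int p dvd m" "\<not> int p dvd n" and j: "j > 0"
    and M_def: "M = p ^ j" and q_def: "q = M * M * p" and v: "v \<in> roots_mod M m n"
  shows "norm (\<Sum>z\<in>{z \<in> inv_pairs q. snd z mod int M = v}. ec q (m * fst z + n * snd z)) = M * sqrt p"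
proof -
  have p0: "p > 0" using p by (simp add: prime_gt_0_nat)
  then have M0: "M > 0" by (simp add: M_def)
  with p0 have q0: "q > 0" by (simp add: q_def)
  have pp: "prime (int p)" using p by simp
  have vr: "0 \<le> v" "v < int M" using v by (auto simp: roots_mod_def)
  have vp: "\<not> int p dvd v" using roots_mod_diff(2)[OF p(1) mn j] v unfolding M_def by blast
  have "coprime v (int p)" using vp pp by (metis coprime_commute prime_imp_coprime)
  then have "coprime v (int q)" by (simp add: q_def M_def)
  then obtain u where vu: "[v * u = 1] (mod int q)" using cong_solve_coprime_int by blast
  obtain k where k: "v * u = 1 + int q * k" using vu by (metis cong_iff_lin cong_sym mult.commute)
  obtain M1 where M1: "M = p * M1" using j by (cases j) (auto simp: M_def)
  have up: "\<not> int p dvd u"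
  proof
    assume "int p dvd u"
    moreover have "int p dvd int q" by (simp add: q_def)
    ultimately have "int p dvd v * u - int q * k" by simp
    then show False using pp by (simp add: k)
  qed
  \<comment> \<open>The geometric expansion of \<open>1 / (v + M t)\<close> with
    \<open>u = 1 / v\<close>. The cubic term drops out because \<open>p\<close> divides
    \<open>M\<close>, so \<open>q\<close> divides \<open>M^3\<close>.\<close>
  define \<xi> where "\<xi> = (\<lambda>t. u - int M * t * u\<^sup>2 + (int M)\<^sup>2 * t\<^sup>2 * u ^ 3)"
  define \<psi> where "\<psi> = (\<lambda>t. (\<xi> t mod int q, v + int M * t))"
  have inv: "[\<xi> t * (v + int M * t) = 1] (mod int q)" for t
  proof -
    have qM: "int q * int M1 = int M ^ 3" by (simp add: q_def M1 power3_eq_cube)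
    have "\<xi> t * (v + int M * t) - 1 =
        int q * (k - k * (int M * t * u - (int M)\<^sup>2 * t\<^sup>2 * u\<^sup>2) + int M1 * t ^ 3 * u ^ 3)"
      unfolding \<xi>_def using k qM by Groebner_Basis.algebra
    then show ?thesis by (simp add: cong_iff_dvd_diff)
  qed
  have range: "0 \<le> v + int M * t \<and> v + int M * t < int q" if "t \<in> {0..<int (p * M)}" for t
  proof -
    have "int M * t \<le> int M * (int (p * M) - 1)" using that by (intro mult_left_mono) auto
    then have "int M * t \<le> int q - int M" by (simp add: q_def algebra_simps)
    moreover have "0 \<le> int M * t" using that by simp
    ultimately show ?thesis using vr by linarith
  qed
  have \<psi>_in: "\<psi> t \<in> inv_pairs q" if "t \<in> {0..<int (p * M)}" for t
    using inv_pairs_modI[OF q0 inv[of t]] range[OF that] by (simp add: \<psi>_def)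
  have "int M dvd m - n * v\<^sup>2" using v by (simp add: roots_mod_def)
  then obtain l where l: "m - n * v\<^sup>2 = int M * l" by (elim dvdE)
  \<comment> \<open>Substituting \<open>m = n v^2 + M l\<close> and \<open>v u = 1 + q k\<close>
    gives \<open>n - m u^2 = n (1 - (1 + q k)^2) - M l u^2\<close>; this is the quotient by
    \<open>M\<close>.\<close>
  define w where "w = - (u\<^sup>2 * l) - n * (2 * (int M * int p * k) + int M * int p * int q * k\<^sup>2)"
  have w: "n - m * u\<^sup>2 = int M * w"
  proof -
    have qq: "int q = int M * (int M * int p)" by (simp add: q_def)
    show ?thesis unfolding w_def using l k qq by Groebner_Basis.algebra
  qed
  define \<alpha> where "\<alpha> = m * u ^ 3"
  have \<alpha>: "\<not> int p dvd \<alpha>"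
    unfolding \<alpha>_def using pp mn up by (simp add: prime_dvd_mult_iff prime_dvd_power_iff)
  let ?f = "\<lambda>t. ec p (w * t + \<alpha> * t\<^sup>2)"
  have "(\<Sum>z\<in>{z \<in> inv_pairs q. snd z mod int M = v}. ec q (m * fst z + n * snd z)) =
      (\<Sum>t\<in>{0..<int (p * M)}. ec q (m * u + n * v) * ?f t)"
  proof (rule sum.reindex_bij_witness[of _ \<psi> "\<lambda>z. snd z div int M"])
    fix z assume "z \<in> {z \<in> inv_pairs q. snd z mod int M = v}"
    then have z: "z \<in> inv_pairs q" "snd z mod int M = v" by auto
    then have y: "0 \<le> snd z" "snd z < int q" by (auto simp: inv_pairs_def)
    have dm: "v + int M * (snd z div int M) = snd z" using z(2) by (metis mod_mult_div_eq)
    have "snd z div int M < int (p * M)"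
    proof (rule ccontr)
      assume "\<not> snd z div int M < int (p * M)"
      then have "int M * int (p * M) \<le> int M * (snd z div int M)" by (intro mult_left_mono) auto
      then have "int q \<le> int M * (snd z div int M)" by (simp add: q_def algebra_simps)
      then show False using dm y vr by linarith
    qed
    then show t: "snd z div int M \<in> {0..<int (p * M)}"
      using y M0 by (simp add: pos_imp_zdiv_nonneg_iff)
    show eq: "\<psi> (snd z div int M) = z"
      using inj_onD[OF inj_on_snd_inv_pairs _ \<psi>_in[OF t] z(1)] dm by (simp add: \<psi>_def)
    have "m * \<xi> t + n * (v + int M * t) = (m * u + n * v) + int (M * M) * (w * t + \<alpha> * t\<^sup>2)" for t
      using w unfolding \<xi>_def \<alpha>_def by (simp only: of_nat_mult) Groebner_Basis.algebra
    then have ph: "ec q (m * \<xi> t + n * (v + int M * t)) = ec q (m * u + n * v) * ?f t" for t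
      using ec_scale[of "M * M" p] M0 by (simp add: ec_add q_def del: of_nat_mult)
    have "[m * fst (\<psi> t) + n * snd (\<psi> t) = m * \<xi> t + n * (v + int M * t)] (mod int q)" for t
      by (intro cong_add cong_scalar_left) (auto simp: \<psi>_def cong_def)
    from ec_cong[OF this] ph have "ec q (m * fst (\<psi> t) + n * snd (\<psi> t)) = ec q (m * u + n * v) * ?f t" for t
      by simp
    from this[of "snd z div int M"]
    show "ec q (m * u + n * v) * ?f (snd z div int M) = ec q (m * fst z + n * snd z)"
      unfolding eq ..
  next
    fix t assume t: "t \<in> {0..<int (p * M)}"
    show "snd (\<psi> t) div int M = t" using vr M0 by (simp add: \<psi>_def)
    show "\<psi> t \<in> {z \<in> inv_pairs q. snd z mod int M = v}"
      using \<psi>_in[OF t] vr by (simp add: \<psi>_def)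
  qed
  also have "\<dots> = ec q (m * u + n * v) * (of_nat M * (\<Sum>t\<in>{0..<int p}. ?f t))"
  proof -
    have "?f (t mod int p) = ?f t" for t
      by (rule ec_cong, intro cong_add cong_scalar_left cong_pow) (auto simp: cong_def)
    from sum_mod_reduce[of ?f, OF this p0, of M] show ?thesis by (simp flip: sum_distrib_left)
  qed
  finally have "norm (\<Sum>z\<in>{z \<in> inv_pairs q. snd z mod int M = v}. ec q (m * fst z + n * snd z)) =
      M * norm (\<Sum>t\<in>{0..<int p}. ?f t)" by (simp add: norm_mult)
  also have "norm (\<Sum>t\<in>{0..<int p}. ?f t) = sqrt p"
    by (rule real_sqrt_unique[OF norm_gauss_sum[OF p \<alpha>] norm_ge_zero, symmetric])
  finally show ?thesis .
qed

text \<open>For odd exponents the trivial estimate over the stationary points is too large by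
  \<open>sqrt p\<close>; the Gauss sum in each class modulo \<open>M\<close> recovers this
  factor.\<close>

lemma norm_kloosterman_odd_exponent:
  fixes M :: nat
  assumes p: "prime p" "odd p" and mn: "\<not> int p dvd m" "\<not> int p dvd n" and j: "j > 0"
    and M_def: "M = p ^ j" and q_def: "q = M * M * p"
  shows "norm (kloosterman q m n) \<le> 2 * (M * sqrt p)"
proof -
  have p0: "p > 0" using p by (simp add: prime_gt_0_nat)
  then have M0: "M > 0" by (simp add: M_def)
  with p0 have q0: "q > 0" by (simp add: q_def)
  let ?F = "\<lambda>z. ec q (m * fst z + n * snd z)"
  let ?X = "{z \<in> inv_pairs q. int M dvd m - n * (snd z)\<^sup>2}"
  let ?R = "roots_mod M m n"
  have "kloosterman q m n = (\<Sum>z\<in>?X. ?F z)"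
    by (rule kloosterman_stationary[of q "M * p" M]) (use q0 in \<open>auto simp: q_def\<close>)
  also have "\<dots> = (\<Sum>v\<in>?R. \<Sum>z\<in>{z \<in> ?X. snd z mod int M = v}. ?F z)"
    by (rule sum.group[symmetric]) (auto simp: roots_mod_iff[OF M0])
  also have "\<dots> = (\<Sum>v\<in>?R. \<Sum>z\<in>{z \<in> inv_pairs q. snd z mod int M = v}. ?F z)"
    by (rule sum.cong, simp, rule sum.cong) (auto simp: roots_mod_iff[OF M0])
  finally have "norm (kloosterman q m n) \<le>
      (\<Sum>v\<in>?R. norm (\<Sum>z\<in>{z \<in> inv_pairs q. snd z mod int M = v}. ?F z))"
    by (simp only: norm_sum)
  also have "\<dots> = (\<Sum>v\<in>?R. M * sqrt p)"
    by (rule sum.cong) (use norm_stationary_class_sum[OF p mn j M_def q_def] in auto)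
  also have "\<dots> = card ?R * (M * sqrt p)" by simp
  also have "\<dots> \<le> 2 * (M * sqrt p)"
    using card_roots_mod_odd[OF p mn j] unfolding M_def
    by (intro mult_right_mono) auto
  finally show ?thesis .
qed

lemma norm_kloosterman_prime_power_units:
  assumes p: "prime p" and mn: "\<not> int p dvd m" "\<not> int p dvd n" and k: "k \<ge> 2"
  shows "norm (kloosterman (p ^ k) m n) ^ 2 \<le> real (k + 1) ^ 2 * p ^ k"
proof -
  have p0: "p > 0" using p by (simp add: prime_gt_0_nat)
  define j where "j = k div 2"
  define M where "M = p ^ j"
  have j: "j > 0" using k by (simp add: j_def)
  have M0: "M > 0" using p0 by (simp add: M_def)
  have p2: "odd m" "odd n" if "p = 2" using mn that by auto
  obtain j' where j': "j = Suc j'" using j by (cases j) auto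
  let ?\<rho> = "card (roots_mod M m n)"
  have \<rho>: "?\<rho> \<le> (if p = 2 then min 4 M else 2)"
  proof (cases "p = 2")
    case True
    then show ?thesis using card_roots_mod_2[OF p2, of j'] card_roots_mod_le by (simp add: M_def j')
  next
    case False
    then have "odd p" using p by (metis prime_odd_nat prime_ge_2_nat le_neq_implies_less)
    then show ?thesis using card_roots_mod_odd[OF p _ mn j] False by (simp add: M_def)
  qed
  consider "k = 2 * j" | "k = 2 * j + 1" unfolding j_def by linarith
  then show ?thesis
  proof cases
    case 1
    have pk: "p ^ k = M * M" by (simp add: 1 M_def mult_2 power_add)
    have "norm (kloosterman (p ^ k) m n) \<le> real M * ?\<rho>"
      using norm_kloosterman_le_roots[OF pk, of m n] M0 by (simp add: pk)
    also have "real M * ?\<rho> \<le> real M * (k + 1)"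
    proof -
      have "?\<rho> \<le> k + 1"
    proof (cases "j = 1")
      case True
      then show ?thesis using \<rho> k 1 by (auto simp: M_def split: if_splits)
    next
      case False
      then show ?thesis using \<rho> j 1 by (auto split: if_splits)
    qed
      then show ?thesis by (intro mult_left_mono) auto
    qed
    finally have "norm (kloosterman (p ^ k) m n) ^ 2 \<le> (real M * (k + 1)) ^ 2"
      by (intro power_mono) auto
    then show ?thesis by (simp add: pk power2_eq_square mult_ac flip: of_nat_power)
  next
    case 2
    have pk: "p ^ k = M * M * p" by (simp add: 2 M_def mult_2 power_add)
    show ?thesis
    proof (cases "p = 2")
      case False
      then have "odd p" using p by (metis prime_odd_nat prime_ge_2_nat le_neq_implies_less)
      from norm_kloosterman_odd_exponent[OF p this mn j M_def pk]
      have "norm (kloosterman (p ^ k) m n) ^ 2 \<le> (2 * (M * sqrt p)) ^ 2" by (intro power_mono) auto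
      also have "\<dots> = 2 ^ 2 * real (p ^ k)" by (simp add: pk power_mult_distrib power2_eq_square)
      also have "\<dots> \<le> real (k + 1) ^ 2 * real (p ^ k)"
        using k by (intro mult_right_mono power_mono) auto
      finally show ?thesis by simp
    next
      case True
      \<comment> \<open>For \<open>p = 2\<close> the trivial estimate loses only
        \<open>sqrt 2\<close>, which the factor \<open>k + 1\<close> absorbs.\<close>
      have q: "p ^ k = (2 * M) * M" using True by (subst pk) simp
      have "p ^ k dvd (2 * M) * (2 * M)" unfolding q by simp
      from norm_kloosterman_le_roots[OF q _ this, of m n]
      have "norm (kloosterman (p ^ k) m n) \<le> real (2 * M) * ?\<rho>" using p0 by simp
      then have "norm (kloosterman (p ^ k) m n) ^ 2 \<le> (real (2 * M) * ?\<rho>) ^ 2" by (intro power_mono) auto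
      also have "\<dots> = real (2 * ?\<rho> ^ 2) * real (p ^ k)"
        unfolding q by (simp add: power2_eq_square)
      also have "\<dots> \<le> real ((k + 1) ^ 2) * real (p ^ k)"
      proof (intro mult_right_mono)
        \<comment> \<open>For \<open>k = 3\<close> the count is at most \<open>M = 2\<close> and
          \<open>8 \<le> 16\<close>; for \<open>k \<ge> 5\<close> it is at most 4 and
          \<open>32 \<le> 36\<close>.\<close>
        have "2 * ?\<rho> ^ 2 \<le> (k + 1) ^ 2"
        proof (cases "j = 1")
          case j1: True
          then have "?\<rho> \<le> 2" using \<rho> True by (simp add: M_def)
          then have "?\<rho> ^ 2 \<le> 2 ^ 2" by (intro power_mono) auto
          then show ?thesis using 2 j1 by simp
        next
          case False
          have "?\<rho> ^ 2 \<le> 4 ^ 2" using \<rho> True by (intro power_mono) auto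
          moreover have "6 ^ 2 \<le> (k + 1) ^ 2" using 2 j False by (intro power_mono) auto
          ultimately show ?thesis by simp
        qed
        then show "real (2 * ?\<rho> ^ 2) \<le> real ((k + 1) ^ 2)" by (simp only: of_nat_le_iff)
      qed simp
      finally show ?thesis by simp
    qed
  qed
qed

text \<open>There are no stationary points: \<open>m - n y^2\<close> is never divisible by
  \<open>p\<close>.\<close>

lemma kloosterman_prime_power_eq_0:
  assumes p: "prime p" and k: "k \<ge> 2" and n: "int p dvd n" and m: "\<not> int p dvd m"
  shows "kloosterman (p ^ k) m n = 0"
proof -
  define j where "j = k div 2"
  have "p ^ k = p ^ (k - j) * p ^ j" by (simp add: j_def flip: power_add)
  moreover have "p ^ k dvd p ^ (k - j) * p ^ (k - j)"
    by (simp add: j_def le_imp_power_dvd flip: power_add)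
  ultimately have "kloosterman (p ^ k) m n =
      (\<Sum>z\<in>{z \<in> inv_pairs (p ^ k). int (p ^ j) dvd m - n * (snd z)\<^sup>2}. ec (p ^ k) (m * fst z + n * snd z))"
    using p by (intro kloosterman_stationary) (auto simp: prime_gt_0_nat)
  moreover have "\<not> int (p ^ j) dvd m - n * y\<^sup>2" for y
  proof
    assume "int (p ^ j) dvd m - n * y\<^sup>2"
    moreover have "int p dvd int (p ^ j)" using k by (cases j) (auto simp: j_def)
    ultimately have "int p dvd m - n * y\<^sup>2" by (rule dvd_trans[rotated])
    then have "int p dvd (m - n * y\<^sup>2) + n * y\<^sup>2" using n by (intro dvd_add dvd_mult2) auto
    then show False using m by simp
  qed
  ultimately show ?thesis by simp
qed

text \<open>Weil's bound is a hypothesis here because its proof takes place over a type of fixed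
  characteristic. When \<open>p\<close> divides both coefficients, descent costs \<open>p^2\<close>
  in the square, of which the modulus pays one \<open>p\<close> and the gcd the other.\<close>

lemma norm_kloosterman_prime_power:
  assumes p: "prime p"
    and weil: "\<And>m n. odd p \<Longrightarrow> \<not> int p dvd m \<Longrightarrow> \<not> int p dvd n \<Longrightarrow> norm (kloosterman p m n) \<le> 2 * sqrt p"
  shows "norm (kloosterman (p ^ k) m n) ^ 2 \<le>
    real (k + 1) ^ 2 * real (p ^ k) * of_int (gcd (gcd m n) (int (p ^ k)))"
proof (induction k arbitrary: m n)
  case 0
  have "norm (kloosterman 1 m n) \<le> 1"
    using norm_kloosterman_le[of 1 m n] card_inv_pairs_le[of 1] by linarith
  then have "norm (kloosterman 1 m n) ^ 2 \<le> 1 ^ 2" by (intro power_mono) auto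
  then show ?case by simp
next
  case (Suc k)
  have p0: "p > 0" using p by (simp add: prime_gt_0_nat)
  have g1: "gcd (gcd m n) (int (p ^ Suc k)) \<ge> 1"
    using p0 by (metis gcd_ge_0_int gcd_eq_0_iff of_nat_eq_0_iff int_one_le_iff_zero_less
        order_le_less power_not_zero not_gr_zero)
  show ?case
  proof (cases "int p dvd m \<and> int p dvd n")
    case True
    then obtain m' n' where mn: "m = int p * m'" "n = int p * n'" by (auto elim!: dvdE)
    have gcd: "gcd (gcd m n) (int (p ^ Suc k)) = int p * gcd (gcd m' n') (int (p ^ k))"
      by (simp add: mn gcd_mult_left)
    show ?thesis
    proof (cases "k = 0")
      case k0: True
      have "norm (kloosterman p m n) \<le> p"
        using norm_kloosterman_le[of p m n] card_inv_pairs_le[of p] by linarith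
      then have "norm (kloosterman p m n) ^ 2 \<le> real p ^ 2" by (intro power_mono) auto
      also have "\<dots> \<le> 4 * real p ^ 2" by simp
      finally show ?thesis unfolding gcd using k0 by (simp add: power2_eq_square)
    next
      case False
      have "kloosterman (p ^ Suc k) m n = of_nat p * kloosterman (p ^ k) m' n'"
        unfolding mn power_Suc using False p0 p by (intro kloosterman_descent) auto
      then have "norm (kloosterman (p ^ Suc k) m n) ^ 2 = real p ^ 2 * norm (kloosterman (p ^ k) m' n') ^ 2"
        by (simp add: norm_mult power_mult_distrib)
      also have "\<dots> \<le> real p ^ 2 * (real (k + 1) ^ 2 * real (p ^ k) * of_int (gcd (gcd m' n') (int (p ^ k))))"
        by (intro mult_left_mono Suc.IH) auto
      also have "\<dots> \<le> real p ^ 2 * (real (Suc k + 1) ^ 2 * real (p ^ k) * of_int (gcd (gcd m' n') (int (p ^ k))))"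
        by (intro mult_left_mono mult_right_mono power_mono) auto
      finally show ?thesis unfolding gcd by (simp add: power2_eq_square mult_ac)
    qed
  next
    case False
    have "norm (kloosterman (p ^ Suc k) m n) ^ 2 \<le> real (Suc k + 1) ^ 2 * real (p ^ Suc k)"
    proof (cases "int p dvd m \<or> int p dvd n")
      case True
      show ?thesis
      proof (cases "k = 0")
        case k0: True
        have "kloosterman p m n = - 1"
          using True False kloosterman_prime_dvd[OF p] kloosterman_commute by metis
        then show ?thesis using p0 k0 by simp
      next
        case False': False
        have "kloosterman (p ^ Suc k) m n = 0"
          using True False kloosterman_prime_power_eq_0[OF p, of "Suc k"] kloosterman_commute False'
          by (metis Suc_le_mono not_less_eq_eq One_nat_def Suc_1 le_zero_eq)
        then show ?thesis by simp
      qed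
    next
      case units: False
      show ?thesis
      proof (cases "k = 0")
        case k0: True
        show ?thesis
        proof (cases "odd p")
          case True
          have "norm (kloosterman p m n) ^ 2 \<le> (2 * sqrt p) ^ 2"
            using weil[OF True] units by (intro power_mono) auto
          then show ?thesis using k0 by (simp add: power_mult_distrib)
        next
          case False
          then have p2: "p = 2" using p by (metis prime_odd_nat prime_ge_2_nat le_neq_implies_less)
          have "norm (kloosterman p m n) \<le> 2"
            using norm_kloosterman_le[of p m n] card_inv_pairs_le[of p] p2 by linarith
          then have "norm (kloosterman p m n) ^ 2 \<le> 2 ^ 2" by (intro power_mono) auto
          then show ?thesis using k0 p2 by simp
        qed
      next
        case False
        then show ?thesis
          using norm_kloosterman_prime_power_units[OF p, of m n "Suc k"] units by simp
      qed
    qed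
    also have "\<dots> \<le> real (Suc k + 1) ^ 2 * real (p ^ Suc k) * of_int (gcd (gcd m n) (int (p ^ Suc k)))"
    proof -
      have "a * 1 \<le> a * of_int g" if "a \<ge> 0" "g \<ge> 1" for a :: real and g :: int
        using that by (intro mult_left_mono) auto
      from this[OF _ g1, of "real (Suc k + 1) ^ 2 * real (p ^ Suc k)"] show ?thesis by simp
    qed
    finally show ?thesis .
  qed
qed

section \<open>Kloosterman sums modulo arbitrary integers\<close>

lemma num_divisors_mult_ge:
  assumes "coprime a b" "a > 0" "b > 0"
  shows "num_divisors a * num_divisors b \<le> num_divisors (a * b)"
proof -
  have "card ({k. k dvd a} \<times> {k. k dvd b}) \<le> card {k. k dvd a * b}"
  proof (rule card_inj_on_le[of "\<lambda>(k, l). k * l"])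
    show "inj_on (\<lambda>(k, l). k * l) ({k. k dvd a} \<times> {k. k dvd b})"
    proof (rule inj_onI, clarsimp)
      fix k l k' l' assume d: "k dvd a" "l dvd b" "k' dvd a" "l' dvd b" and eq: "k * l = k' * l'"
      have cop: "coprime x y" if "x dvd a" "y dvd b" for x y
        using assms(1) that by (meson coprime_divisors)
      have "k dvd k' * l'" "k' dvd k * l" using eq by (metis dvd_triv_left)+
      then have "k dvd k'" "k' dvd k" 
        using cop[OF d(1,4)] cop[OF d(3,2)] by (simp_all add: coprime_dvd_mult_left_iff)
      then have "k = k'" by (rule dvd_antisym)
      moreover have "k' > 0" using d(3) assms(2) by (metis dvd_0_left_iff not_gr_zero)
      ultimately show "k = k' \<and> l = l'" using eq by simp
    qed
    show "finite {k. k dvd a * b}" using assms by simp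
  qed (auto intro: mult_dvd_mono)
  then show ?thesis by (simp add: num_divisors_def card_cartesian_product)
qed

lemma num_divisors_prime_power_ge:
  assumes "prime p"
  shows "num_divisors (p ^ k) \<ge> k + 1"
proof -
  have p: "p > 1" using assms by (rule prime_gt_1_nat)
  have "card ((\<lambda>i. p ^ i) ` {..k}) = k + 1"
    using p by (subst card_image) (auto simp: inj_on_def)
  moreover have "card ((\<lambda>i. p ^ i) ` {..k}) \<le> num_divisors (p ^ k)"
    unfolding num_divisors_def using p by (intro card_mono) (auto intro: le_imp_power_dvd)
  ultimately show ?thesis by simp
qed

text \<open>By the Bezout identity \<open>t / (q1 q2) = u t / q1 + v t / q2\<close>, so the
  character factors, and the Chinese remainder theorem factors the set of inverse pairs.\<close>

lemma kloosterman_mult: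
  assumes pos: "q1 > 0" "q2 > 0" and cop: "coprime q1 q2"
    and bezout: "u * int q2 + v * int q1 = 1"
  shows "kloosterman (q1 * q2) m n = kloosterman q1 (u * m) (u * n) * kloosterman q2 (v * m) (v * n)"
proof -
  let ?f = "\<lambda>z :: int \<times> int. ((fst z mod int q1, snd z mod int q1), (fst z mod int q2, snd z mod int q2))"
  let ?F1 = "\<lambda>z :: int \<times> int. ec q1 (u * m * fst z + u * n * snd z)"
  let ?F2 = "\<lambda>z :: int \<times> int. ec q2 (v * m * fst z + v * n * snd z)"
  have copi: "coprime (int q1) (int q2)" using cop by simp
  have bij: "bij_betw ?f (inv_pairs (q1 * q2)) (inv_pairs q1 \<times> inv_pairs q2)"
    unfolding bij_betw_def
  proof
    have crt: "x = x'" if "x \<in> {0..<int (q1 * q2)}" "x' \<in> {0..<int (q1 * q2)}"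
      "x mod int q1 = x' mod int q1" "x mod int q2 = x' mod int q2" for x x'
    proof -
      have "[x = x'] (mod int q1 * int q2)"
        using that(3,4) copi by (intro coprime_cong_mult) (auto simp: cong_def)
      then show ?thesis using that(1,2) by (simp add: cong_def)
    qed
    show "inj_on ?f (inv_pairs (q1 * q2))"
    proof (rule inj_onI)
      fix z z' assume z: "z \<in> inv_pairs (q1 * q2)" "z' \<in> inv_pairs (q1 * q2)" and eq: "?f z = ?f z'"
      have "fst z = fst z'" by (rule crt) (use z eq in \<open>auto simp: inv_pairs_def\<close>)
      moreover have "snd z = snd z'" by (rule crt) (use z eq in \<open>auto simp: inv_pairs_def\<close>)
      ultimately show "z = z'" by (simp add: prod_eq_iff)
    qed
    show "?f ` inv_pairs (q1 * q2) = inv_pairs q1 \<times> inv_pairs q2"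
    proof (intro Set.set_eqI iffI)
      fix w assume "w \<in> ?f ` inv_pairs (q1 * q2)"
      then obtain x y where w: "w = ?f (x, y)" and "(x, y) \<in> inv_pairs (q1 * q2)" by auto
      then have "[x * y = 1] (mod int q1 * int q2)" by (auto simp: inv_pairs_def)
      then have "[x * y = 1] (mod int q1)" "[x * y = 1] (mod int q2)"
        by (auto elim: cong_dvd_modulus)
      then show "w \<in> inv_pairs q1 \<times> inv_pairs q2"
        using inv_pairs_modI[OF pos(1)] inv_pairs_modI[OF pos(2)] by (simp add: w)
    next
      fix w assume "w \<in> inv_pairs q1 \<times> inv_pairs q2"
      then obtain x1 y1 x2 y2 where w: "w = ((x1, y1), (x2, y2))"
        and w1: "(x1, y1) \<in> inv_pairs q1" and w2: "(x2, y2) \<in> inv_pairs q2" by auto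
      define lift where "lift = (\<lambda>a b. (a * (u * int q2) + b * (v * int q1)) mod (int q1 * int q2))"
      have l1: "lift a b mod int q1 = a mod int q1" for a b
      proof -
        have "lift a b mod int q1 = (a * (u * int q2) + b * (v * int q1)) mod int q1"
          unfolding lift_def by (rule mod_mod_cancel) simp
        also have "a * (u * int q2) + b * (v * int q1) = a + int q1 * (v * (b - a))"
          using bezout by Groebner_Basis.algebra
        finally show ?thesis by simp
      qed
      have l2: "lift a b mod int q2 = b mod int q2" for a b
      proof -
        have "lift a b mod int q2 = (a * (u * int q2) + b * (v * int q1)) mod int q2"
          unfolding lift_def by (rule mod_mod_cancel) simp
        also have "a * (u * int q2) + b * (v * int q1) = b + int q2 * (u * (a - b))"
          using bezout by Groebner_Basis.algebra
        finally show ?thesis by simp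
      qed
      have range: "lift a b \<in> {0..<int (q1 * q2)}" for a b
        using pos by (simp add: lift_def)
      have r: "x1 mod int q1 = x1" "y1 mod int q1 = y1" "x2 mod int q2 = x2" "y2 mod int q2 = y2"
        using w1 w2 by (auto simp: inv_pairs_def)
      have "[lift x1 x2 * lift y1 y2 = x1 * y1] (mod int q1)"
        by (intro cong_mult) (simp_all add: cong_def l1)
      also have "[x1 * y1 = 1] (mod int q1)" using w1 by (simp add: inv_pairs_def)
      finally have c1: "[lift x1 x2 * lift y1 y2 = 1] (mod int q1)" .
      have "[lift x1 x2 * lift y1 y2 = x2 * y2] (mod int q2)"
        by (intro cong_mult) (simp_all add: cong_def l2)
      also have "[x2 * y2 = 1] (mod int q2)" using w2 by (simp add: inv_pairs_def)
      finally have c2: "[lift x1 x2 * lift y1 y2 = 1] (mod int q2)" .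
      have "(lift x1 x2, lift y1 y2) \<in> inv_pairs (q1 * q2)"
        using coprime_cong_mult[OF c1 c2 copi] range by (simp add: inv_pairs_def)
      then show "w \<in> ?f ` inv_pairs (q1 * q2)"
        by (rule rev_image_eqI) (simp add: w l1 l2 r)
    qed
  qed
  have "kloosterman (q1 * q2) m n = (\<Sum>z\<in>inv_pairs (q1 * q2). ?F1 (fst (?f z)) * ?F2 (snd (?f z)))"
    unfolding kloosterman_def
  proof (rule sum.cong)
    fix z assume "z \<in> inv_pairs (q1 * q2)"
    define t where "t = m * fst z + n * snd z"
    have t: "t = int q2 * (u * t) + int q1 * (v * t)" using bezout by Groebner_Basis.algebra
    have "ec (q1 * q2) t = ec (q2 * q1) (int q2 * (u * t)) * ec (q1 * q2) (int q1 * (v * t))"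
      by (subst t) (simp add: ec_add mult.commute[of q1])
    also have "\<dots> = ec q1 (u * t) * ec q2 (v * t)" by (simp only: ec_scale[OF pos(2)] ec_scale[OF pos(1)])
    also have "ec q1 (u * t) = ?F1 (fst (?f z))"
    proof (rule ec_cong)
      have "[u * m * fst z + u * n * snd z = u * m * (fst z mod int q1) + u * n * (snd z mod int q1)] (mod int q1)"
        by (intro cong_add cong_scalar_left) (auto simp: cong_def)
      then show "[u * t = u * m * fst (fst (?f z)) + u * n * snd (fst (?f z))] (mod int q1)"
        by (simp add: t_def algebra_simps)
    qed
    also have "ec q2 (v * t) = ?F2 (snd (?f z))"
    proof (rule ec_cong)
      have "[v * m * fst z + v * n * snd z = v * m * (fst z mod int q2) + v * n * (snd z mod int q2)] (mod int q2)"
        by (intro cong_add cong_scalar_left) (auto simp: cong_def)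
      then show "[v * t = v * m * fst (snd (?f z)) + v * n * snd (snd (?f z))] (mod int q2)"
        by (simp add: t_def algebra_simps)
    qed
    finally show "(case z of (x, y) \<Rightarrow> ec (q1 * q2) (m * x + n * y)) = ?F1 (fst (?f z)) * ?F2 (snd (?f z))"
      by (simp add: t_def case_prod_unfold)
  qed simp
  also have "\<dots> = (\<Sum>w\<in>inv_pairs q1 \<times> inv_pairs q2. ?F1 (fst w) * ?F2 (snd w))"
    by (rule sum.reindex_bij_betw[OF bij, of "\<lambda>w. ?F1 (fst w) * ?F2 (snd w)"])
  also have "\<dots> = kloosterman q1 (u * m) (u * n) * kloosterman q2 (v * m) (v * n)"
    by (simp add: kloosterman_def sum_product sum.cartesian_product case_prod_unfold)
  finally show ?thesis .
qed

text \<open>One prime power is split off at a time. The twists \<open>u\<close>, \<open>v\<close>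
  are units for their moduli and leave the gcds unchanged; the two gcds are coprime, so their
  product divides the gcd for \<open>q\<close>.\<close>

lemma norm_kloosterman_bound:
  assumes weil: "\<And>p m n. prime p \<Longrightarrow> odd p \<Longrightarrow> \<not> int p dvd m \<Longrightarrow> \<not> int p dvd n \<Longrightarrow>
      norm (kloosterman p m n) \<le> 2 * sqrt p"
    and "q > 0"
  shows "norm (kloosterman q m n) ^ 2 \<le>
    real (num_divisors q) ^ 2 * real q * of_int (gcd (gcd m n) (int q))"
  using \<open>q > 0\<close>
proof (induction q arbitrary: m n rule: less_induct)
  case (less q)
  show ?case
  proof (cases "q = 1")
    case True
    then show ?thesis
      using norm_kloosterman_prime_power[OF two_is_prime_nat, of 0 m n]
      by (simp add: num_divisors_def)
  next
    case False
    then obtain p where p: "prime p" "p dvd q" using prime_factor_nat by blast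
    have pu: "\<not> is_unit p" "q \<noteq> 0" using p less.prems by auto
    obtain q2 where q2: "q = p ^ multiplicity p q * q2" "\<not> p dvd q2"
      using multiplicity_decompose'[OF pu(2,1)] by blast
    define k where "k = multiplicity p q"
    define q1 where "q1 = p ^ k"
    have q: "q = q1 * q2" using q2 by (simp add: q1_def k_def)
    have pos: "q1 > 0" "q2 > 0" using less.prems q by auto
    have "k > 0" using p pu by (simp add: k_def multiplicity_gt_zero_iff)
    then have "q1 > 1" unfolding q1_def using prime_gt_1_nat[OF p(1)] by (rule one_less_power[rotated])
    then have lt: "q2 < q" using pos q by simp
    have cop: "coprime q1 q2" using p q2(2) by (simp add: q1_def prime_imp_coprime)
    have copi: "coprime (int q1) (int q2)" using cop by simp
    obtain u v where uv: "u * int q2 + v * int q1 = 1"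
      using bezout_int[of "int q2" "int q1"] copi by (auto simp: coprime_iff_gcd_eq_1 gcd.commute)
    have cu: "coprime u (int q1)"
    proof (rule coprimeI)
      fix d assume "d dvd u" "d dvd int q1"
      then have "d dvd u * int q2 + v * int q1" by simp
      then show "is_unit d" using uv by simp
    qed
    have cv: "coprime v (int q2)"
    proof (rule coprimeI)
      fix d assume "d dvd v" "d dvd int q2"
      then have "d dvd u * int q2 + v * int q1" by simp
      then show "is_unit d" using uv by simp
    qed
    have gcd_unit: "gcd (gcd (w * m) (w * n)) s = gcd (gcd m n) s" if "coprime w s" for w s
    proof -
      have "gcd (gcd (w * m) (w * n)) s = gcd (w * gcd m n) s"
        by (metis abs_gcd_int abs_mult gcd_mult_distrib_int gcd_1_int gcd_abs1_int gcd_mult_left normalize_int_def gcd.normalize_left_idem normalize_mult)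
      then show ?thesis using that by (simp add: gcd_mult_left_left_cancel coprime_commute)
    qed
    let ?g1 = "gcd (gcd m n) (int q1)" and ?g2 = "gcd (gcd m n) (int q2)"
    have B1: "norm (kloosterman q1 (u * m) (u * n)) ^ 2 \<le> real (num_divisors q1) ^ 2 * real q1 * of_int ?g1"
    proof -
      have "norm (kloosterman q1 (u * m) (u * n)) ^ 2 \<le> real (k + 1) ^ 2 * real q1 * of_int ?g1"
        using norm_kloosterman_prime_power[OF p(1) weil[OF p(1)], of k "u * m" "u * n"] gcd_unit[OF cu]
        by (simp add: q1_def)
      also have "\<dots> \<le> real (num_divisors q1) ^ 2 * real q1 * of_int ?g1"
        using num_divisors_prime_power_ge[OF p(1), of k] unfolding q1_def
        by (intro mult_right_mono power_mono) auto
      finally show ?thesis .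
    qed
    have B2: "norm (kloosterman q2 (v * m) (v * n)) ^ 2 \<le> real (num_divisors q2) ^ 2 * real q2 * of_int ?g2"
      using less.IH[OF lt pos(2), of "v * m" "v * n"] gcd_unit[OF cv] by simp
    have "norm (kloosterman q m n) ^ 2 =
        norm (kloosterman q1 (u * m) (u * n)) ^ 2 * norm (kloosterman q2 (v * m) (v * n)) ^ 2"
      unfolding q kloosterman_mult[OF pos cop uv] by (simp add: norm_mult power_mult_distrib)
    also have "\<dots> \<le> (real (num_divisors q1) ^ 2 * real q1 * of_int ?g1) *
        (real (num_divisors q2) ^ 2 * real q2 * of_int ?g2)"
      by (intro mult_mono B1 B2) auto
    also have "\<dots> = real (num_divisors q1 * num_divisors q2) ^ 2 * real q * of_int (?g1 * ?g2)"
      by (simp add: q power_mult_distrib)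
    also have "\<dots> \<le> real (num_divisors q1 * num_divisors q2) ^ 2 * real q * of_int (gcd (gcd m n) (int q))"
    proof -
      have "coprime ?g1 ?g2" using copi by (meson coprime_divisors gcd_dvd2)
      then have "?g1 * ?g2 dvd gcd m n" by (intro divides_mult gcd_dvd1)
      moreover have "?g1 * ?g2 dvd int q" unfolding q of_nat_mult by (intro mult_dvd_mono) auto
      ultimately have "?g1 * ?g2 dvd gcd (gcd m n) (int q)" by simp
      moreover have "gcd (gcd m n) (int q) > 0" using less.prems by simp
      ultimately have "?g1 * ?g2 \<le> gcd (gcd m n) (int q)" by (rule zdvd_imp_le)
      then show ?thesis by (intro mult_left_mono) (simp_all only: of_int_le_iff, simp)
    qed
    also have "real (num_divisors q1 * num_divisors q2) ^ 2 * real q * of_int (gcd (gcd m n) (int q)) \<le>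
        real (num_divisors q) ^ 2 * real q * of_int (gcd (gcd m n) (int q))"
      using num_divisors_mult_ge[OF cop pos] unfolding q[symmetric]
      by (intro mult_right_mono power_mono) (simp_all only: of_nat_le_iff of_nat_0_le_iff of_int_0_le_iff gcd_ge_0_int)
    finally show ?thesis .
  qed
qed

section \<open>Fourier analysis modulo \<open>q\<close>\<close>

text \<open>Asking only for distinct residues lets the same identity serve full periods and short
  intervals.\<close>

lemma plancherel:
  fixes f :: "int \<Rightarrow> complex"
  assumes q: "q > 0" and A: "finite A" "inj_on (\<lambda>a. a mod int q) A"
  shows "(\<Sum>h\<in>{0..<int q}. norm (\<Sum>a\<in>A. f a * ec q (h * a)) ^ 2) = real q * (\<Sum>a\<in>A. norm (f a) ^ 2)"
proof -
  have "complex_of_real (\<Sum>h\<in>{0..<int q}. norm (\<Sum>a\<in>A. f a * ec q (h * a)) ^ 2) =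
      (\<Sum>h\<in>{0..<int q}. \<Sum>a\<in>A. \<Sum>b\<in>A. (f a * cnj (f b)) * ec q (h * (a - b)))"
    unfolding of_real_sum
  proof (rule sum.cong)
    fix h
    have "complex_of_real (norm (\<Sum>a\<in>A. f a * ec q (h * a)) ^ 2) =
        (\<Sum>a\<in>A. f a * ec q (h * a)) * (\<Sum>b\<in>A. cnj (f b) * ec q (- (h * b)))"
      unfolding complex_norm_square by (simp add: ec_uminus)
    also have "\<dots> = (\<Sum>a\<in>A. \<Sum>b\<in>A. (f a * cnj (f b)) * ec q (h * (a - b)))"
    proof -
      have "ec q (h * (a - b)) = ec q (h * a) * ec q (- (h * b))" for a b
        by (simp add: right_diff_distrib flip: ec_add)
      then show ?thesis unfolding sum_product by (simp add: mult_ac)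
    qed
    finally show "complex_of_real (norm (\<Sum>a\<in>A. f a * ec q (h * a)) ^ 2) =
        (\<Sum>a\<in>A. \<Sum>b\<in>A. (f a * cnj (f b)) * ec q (h * (a - b)))" .
  qed simp
  also have "\<dots> = (\<Sum>a\<in>A. \<Sum>b\<in>A. (f a * cnj (f b)) * (\<Sum>h\<in>{0..<int q}. ec q (h * (a - b))))"
    unfolding sum_distrib_left
    by (rule trans[OF sum.swap]) (intro sum.cong refl sum.swap)
  also have "\<dots> = (\<Sum>a\<in>A. \<Sum>b\<in>A. if b = a then of_nat q * (f a * cnj (f a)) else 0)"
  proof (intro sum.cong refl)
    fix a b assume ab: "a \<in> A" "b \<in> A"
    have "int q dvd a - b \<longleftrightarrow> a = b" using A(2) ab by (auto simp: inj_on_def mod_eq_dvd_iff)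
    then show "(f a * cnj (f b)) * (\<Sum>h\<in>{0..<int q}. ec q (h * (a - b))) =
        (if b = a then of_nat q * (f a * cnj (f a)) else 0)"
      by (simp add: ec_sum[OF q])
  qed
  also have "\<dots> = (\<Sum>a\<in>A. of_nat q * (f a * cnj (f a)))" using A(1) by simp
  also have "\<dots> = complex_of_real (real q * (\<Sum>a\<in>A. norm (f a) ^ 2))"
    by (simp only: of_real_mult of_real_sum complex_norm_square of_real_of_nat_eq sum_distrib_left)
  finally show ?thesis by (simp only: of_real_eq_iff)
qed

lemma inj_on_mod_interval:
  assumes "L \<le> int q" shows "inj_on (\<lambda>a. a mod int q) {1..L}"
proof (rule inj_onI)
  fix a b assume ab: "a \<in> {1..L}" "b \<in> {1..L}" "a mod int q = b mod int q"
  then have "int q dvd a - b" by (simp add: mod_eq_dvd_iff)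
  moreover have "\<bar>a - b\<bar> < int q" using ab assms by auto
  ultimately show "a = b" by (metis dvd_imp_le_int abs_of_nat eq_iff_diff_eq_0 not_le)
qed

lemma sum_periodic_shift:
  fixes f :: "int \<Rightarrow> complex"
  assumes q: "q > 0" and per: "\<And>t. f (t mod int q) = f t"
  shows "(\<Sum>a\<in>{1..int q}. f (a + i)) = (\<Sum>x\<in>{0..<int q}. f x)"
proof -
  have inj: "inj_on (\<lambda>a. (a + i) mod int q) {1..int q}"
    using inj_on_mod_interval[of "int q" q] by (auto simp: inj_on_def mod_eq_dvd_iff)
  have "(\<lambda>a. (a + i) mod int q) ` {1..int q} = {0..<int q}"
    by (rule card_subset_eq) (use q in \<open>auto simp: card_image[OF inj]\<close>)
  then have "bij_betw (\<lambda>a. (a + i) mod int q) {1..int q} {0..<int q}" using inj by (simp add: bij_betw_def)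
  from sum.reindex_bij_betw[OF this, of f] show ?thesis by (simp add: per)
qed

definition interval_sum :: "nat \<Rightarrow> int \<Rightarrow> int \<Rightarrow> complex" where
  "interval_sum q L h = (\<Sum>x\<in>{1..L}. ec q (h * x))"

lemma sum_norm_interval_sum:
  assumes "q > 0" "0 \<le> L" "L \<le> int q"
  shows "(\<Sum>h\<in>{0..<int q}. norm (interval_sum q L h) ^ 2) = real q * of_int L"
  using plancherel[OF assms(1) _ inj_on_mod_interval[OF assms(3)], of "\<lambda>_. 1"] assms(2)
  by (simp add: interval_sum_def)

text \<open>At a nonzero frequency a full period sums to 0. This matters when the modulus is lowered
  to a divisor of \<open>q\<close> that may be smaller than \<open>L\<close>.\<close>

lemma interval_sum_add_period:
  assumes q: "q > 0" and h: "\<not> int q dvd h" and L: "L \<ge> 0"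
  shows "interval_sum q (L + int q * int t) h = interval_sum q L h"
proof (induction t)
  case (Suc t)
  let ?L = "L + int q * int t"
  have L0: "?L \<ge> 0" using L by simp
  have "{1..?L + int q} = {1..?L} \<union> {?L + 1..?L + int q}" using L0 q by auto
  then have "interval_sum q (?L + int q) h = interval_sum q ?L h + (\<Sum>x\<in>{?L + 1..?L + int q}. ec q (h * x))"
    unfolding interval_sum_def by (simp only:) (rule sum.union_disjoint, auto)
  also have "(\<Sum>x\<in>{?L + 1..?L + int q}. ec q (h * x)) = (\<Sum>a\<in>{1..int q}. ec q (h * (a + ?L)))"
    by (rule sum.reindex_bij_witness[of _ "\<lambda>a. a + ?L" "\<lambda>x. x - ?L"]) auto
  also have "\<dots> = (\<Sum>x\<in>{0..<int q}. ec q (h * x))"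
    by (rule sum_periodic_shift[OF q]) (intro ec_cong cong_scalar_left, simp add: cong_def)
  also have "\<dots> = 0" using ec_sum[OF q, of h] h by (simp add: mult.commute)
  finally show ?case using Suc by (simp add: algebra_simps)
qed simp

text \<open>With frequency 0 left out, the estimate survives for intervals longer than the modulus,
  since \<open>L\<close> may be replaced by its residue.\<close>

lemma sum_nonzero_norm_interval_sum_le:
  assumes q: "q > 0" and L: "L \<ge> 0"
  shows "(\<Sum>h\<in>{1..<int q}. norm (interval_sum q L h) ^ 2) \<le> real q * of_int L"
proof -
  define r where "r = L mod int q"
  define t where "t = nat (L div int q)"
  have r: "0 \<le> r" "r \<le> int q" "r \<le> L" using q L by (auto simp: r_def zmod_le_nonneg_dividend intro: less_imp_le)
  have Lt: "L = r + int q * int t"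
    using q L by (simp add: r_def t_def pos_imp_zdiv_nonneg_iff)
  have "(\<Sum>h\<in>{1..<int q}. norm (interval_sum q L h) ^ 2) = (\<Sum>h\<in>{1..<int q}. norm (interval_sum q r h) ^ 2)"
  proof (rule sum.cong)
    fix h assume "h \<in> {1..<int q}"
    then have "\<not> int q dvd h" by (auto dest: zdvd_imp_le)
    then show "norm (interval_sum q L h) ^ 2 = norm (interval_sum q r h) ^ 2"
      unfolding Lt by (simp add: interval_sum_add_period[OF q _ r(1)])
  qed simp
  also have "\<dots> \<le> (\<Sum>h\<in>{0..<int q}. norm (interval_sum q r h) ^ 2)"
    by (rule sum_mono2) auto
  also have "\<dots> = real q * of_int r" using r by (intro sum_norm_interval_sum[OF q])
  also have "\<dots> \<le> real q * of_int L" using r by (intro mult_left_mono) auto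
  finally show ?thesis .
qed

text \<open>The gcd is at most the sum of the common divisors \<open>d\<close>. The frequencies
  divisible by \<open>d\<close> are those of the modulus \<open>Q = q / d\<close>, so each
  \<open>d\<close> costs at most \<open>d * (Q * L) = q * L\<close>.\<close>

lemma sum_gcd_norm_interval_sum_le:
  assumes q: "q > 0" and L: "L \<ge> 0"
  shows "(\<Sum>h\<in>{1..<int q}. of_int (gcd h (int q)) * norm (interval_sum q L h) ^ 2) \<le>
    real (num_divisors q) * (real q * of_int L)"
proof -
  let ?E = "\<lambda>h. norm (interval_sum q L h) ^ 2"
  let ?D = "{d. d dvd q}"
  have finD: "finite ?D" using q by simp
  have "(\<Sum>h\<in>{1..<int q}. of_int (gcd h (int q)) * ?E h) \<le>
      (\<Sum>h\<in>{1..<int q}. \<Sum>d\<in>?D. if int d dvd h then real d * ?E h else 0)"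
  proof (rule sum_mono)
    fix h
    let ?g = "nat (gcd h (int q))"
    have g: "?g \<in> ?D" "int ?g dvd h" by (auto simp: nat_dvd_iff)
    have "of_int (gcd h (int q)) * ?E h = (\<Sum>d\<in>{?g}. if int d dvd h then real d * ?E h else 0)"
      using g(2) by simp
    also have "\<dots> \<le> (\<Sum>d\<in>?D. if int d dvd h then real d * ?E h else 0)"
      by (rule sum_mono2) (use finD g in auto)
    finally show "of_int (gcd h (int q)) * ?E h \<le> (\<Sum>d\<in>?D. if int d dvd h then real d * ?E h else 0)" .
  qed
  also have "\<dots> = (\<Sum>d\<in>?D. \<Sum>h\<in>{1..<int q}. if int d dvd h then real d * ?E h else 0)"
    by (rule sum.swap)
  also have "\<dots> \<le> (\<Sum>d\<in>?D. real q * of_int L)"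
  proof (rule sum_mono)
    fix d assume "d \<in> ?D"
    then obtain Q where Q: "q = d * Q" by (auto elim: dvdE)
    then have pos: "d > 0" "Q > 0" using q by auto
    have "(\<Sum>h\<in>{1..<int q}. if int d dvd h then real d * ?E h else 0) =
        (\<Sum>h\<in>{h\<in>{1..<int q}. int d dvd h}. real d * ?E h)"
      by (rule sum.inter_filter[symmetric]) simp
    also have "\<dots> = (\<Sum>k\<in>{1..<int Q}. real d * norm (interval_sum Q L k) ^ 2)"
    proof (rule sum.reindex_bij_witness[of _ "\<lambda>k. int d * k" "\<lambda>h. h div int d"])
      fix h assume "h \<in> {h\<in>{1..<int q}. int d dvd h}"
      then obtain k where k: "h = int d * k" and h: "1 \<le> h" "h < int d * int Q" by (auto simp: Q elim: dvdE)
      show "int d * (h div int d) = h" using k pos by simp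
      have "k > 0" using h(1) k pos by (metis zero_less_mult_pos int_one_le_iff_zero_less of_nat_0_less_iff)
      moreover have "k < int Q" using h(2) k pos by simp
      ultimately show "h div int d \<in> {1..<int Q}" using k pos by simp
      have "interval_sum q L h = interval_sum Q L k"
        unfolding interval_sum_def Q k by (simp add: ec_scale[OF pos(1)] mult.assoc)
      then show "real d * norm (interval_sum Q L (h div int d)) ^ 2 = real d * ?E h"
        using k pos by simp
    next
      fix k assume k: "k \<in> {1..<int Q}"
      show "int d * k div int d = k" using pos by simp
      have "1 * 1 \<le> int d * k" using k pos by (intro mult_mono) auto
      then show "int d * k \<in> {h\<in>{1..<int q}. int d dvd h}" using k pos by (simp add: Q)
    qed
    also have "\<dots> = real d * (\<Sum>k\<in>{1..<int Q}. norm (interval_sum Q L k) ^ 2)"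
      by (simp add: sum_distrib_left)
    also have "\<dots> \<le> real d * (real Q * of_int L)"
      by (intro mult_left_mono sum_nonzero_norm_interval_sum_le) (use pos L in auto)
    also have "\<dots> = real q * of_int L" by (simp add: Q)
    finally show "(\<Sum>h\<in>{1..<int q}. if int d dvd h then real d * ?E h else 0) \<le> real q * of_int L" .
  qed
  also have "\<dots> = real (num_divisors q) * (real q * of_int L)" by (simp add: num_divisors_def)
  finally show ?thesis .
qed

section \<open>The variance\<close>

text \<open>For \<open>y\<close> coprime to \<open>q\<close> exactly one residue \<open>x\<close>
  solves the congruence, so subtracting \<open>1 / q\<close> makes the sum over a period in
  \<open>x\<close> vanish for every single \<open>y\<close>.\<close>

definition deviation :: "nat \<Rightarrow> int \<Rightarrow> int \<Rightarrow> int \<Rightarrow> real" where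
  "deviation q c x y =
    (if coprime y (int q) then (if [x * y = c] (mod int q) then 1 else 0) - 1 / real q else 0)"

lemma count_diff_eq_sum_deviation:
  "hyperbola_count q c L1 L2 a b - 1 / real q * coprime_box_count q L1 L2 a b =
    (\<Sum>i\<in>{1..L1}. \<Sum>j\<in>{1..L2}. deviation q c (a + i) (b + j))"
proof -
  let ?I = "{a<..a + L1}" and ?J = "{b<..b + L2}"
  have "hyperbola_count q c L1 L2 a b =
      sum (\<lambda>_. 1) {z \<in> ?I \<times> ?J. coprime (snd z) (int q) \<and> [fst z * snd z = c] (mod int q)}"
    unfolding hyperbola_count_def by (rule sum.cong) auto
  also have "\<dots> = (\<Sum>z\<in>?I \<times> ?J. if coprime (snd z) (int q) \<and> [fst z * snd z = c] (mod int q) then 1 else 0)"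
    by (rule sum.inter_filter) simp
  also have "\<dots> = (\<Sum>x\<in>?I. \<Sum>y\<in>?J. if coprime y (int q) \<and> [x * y = c] (mod int q) then 1 else 0)"
    by (simp add: sum.cartesian_product case_prod_unfold)
  finally have H: "hyperbola_count q c L1 L2 a b = \<dots>" .
  have B: "coprime_box_count q L1 L2 a b = (\<Sum>x\<in>?I. \<Sum>y\<in>?J. if coprime y (int q) then 1 else 0)"
    unfolding coprime_box_count_def by (rule sum.cong[OF refl], rule sum.inter_filter) simp
  have "hyperbola_count q c L1 L2 a b - 1 / real q * coprime_box_count q L1 L2 a b =
      (\<Sum>x\<in>?I. \<Sum>y\<in>?J. deviation q c x y)"
    unfolding H B sum_distrib_left sum_subtractf[symmetric]
    by (intro sum.cong refl) (auto simp: deviation_def)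
  also have "\<dots> = (\<Sum>i\<in>{1..L1}. \<Sum>y\<in>?J. deviation q c (a + i) y)"
    by (rule sum.reindex_bij_witness[of _ "\<lambda>i. a + i" "\<lambda>x. x - a"]) auto
  also have "\<dots> = (\<Sum>i\<in>{1..L1}. \<Sum>j\<in>{1..L2}. deviation q c (a + i) (b + j))"
    by (intro sum.cong refl sum.reindex_bij_witness[of _ "\<lambda>j. b + j" "\<lambda>y. y - b"]) auto
  finally show ?thesis .
qed

lemma snd_image_inv_pairs: "q > 0 \<Longrightarrow> snd ` inv_pairs q = {y \<in> {0..<int q}. coprime y (int q)}"
proof -
  assume q: "q > 0"
  have "snd ` inv_pairs q = fst ` inv_pairs q"
    by (auto simp: image_iff) (metis inv_pairs_sym fst_conv snd_conv)+
  then show ?thesis by (simp add: fst_image_inv_pairs[OF q])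
qed

text \<open>For \<open>y\<close> with inverse \<open>u\<close> the indicator selects
  \<open>x = c u\<close> and yields the Kloosterman phase; the subtracted mean is visible only at
  \<open>h = 0\<close>, where it cancels this contribution exactly.\<close>

lemma deviation_transform:
  assumes q: "q > 0" and h: "h \<in> {0..<int q}"
  shows "(\<Sum>x\<in>{0..<int q}. \<Sum>y\<in>{0..<int q}. of_real (deviation q c x y) * ec q (h * x + k * y)) =
    (if h = 0 then 0 else kloosterman q (h * c) k)"
proof -
  let ?Z = "{0..<int q}"
  let ?P = "\<lambda>x y. of_real (deviation q c x y) * ec q (h * x + k * y)"
  let ?\<delta> = "if h = 0 then 1 else 0 :: complex"
  have "(\<Sum>x\<in>?Z. \<Sum>y\<in>?Z. ?P x y) = (\<Sum>y\<in>?Z. \<Sum>x\<in>?Z. ?P x y)" by (rule sum.swap)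
  also have "\<dots> = (\<Sum>y\<in>{y \<in> ?Z. coprime y (int q)}. \<Sum>x\<in>?Z. ?P x y)"
    by (rule sum.mono_neutral_right) (auto simp: deviation_def)
  also have "\<dots> = (\<Sum>z\<in>inv_pairs q. \<Sum>x\<in>?Z. ?P x (snd z))"
    unfolding snd_image_inv_pairs[OF q, symmetric]
    by (subst sum.reindex[OF inj_on_snd_inv_pairs]) simp
  also have "\<dots> = (\<Sum>z\<in>inv_pairs q. ec q (h * c * fst z + k * snd z) - ?\<delta> * ec q (k * snd z))"
  proof (rule sum.cong)
    fix z assume z: "z \<in> inv_pairs q"
    obtain u y where uy: "z = (u, y)" by (cases z)
    have cop: "coprime y (int q)" and inv: "[u * y = 1] (mod int q)"
      using z inv_pairs_coprime by (auto simp: uy inv_pairs_def)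
    have iff: "[x * y = c] (mod int q) \<longleftrightarrow> x = (c * u) mod int q" if "x \<in> ?Z" for x
    proof
      assume "[x * y = c] (mod int q)"
      then have "[x * y * u = c * u] (mod int q)" by (rule cong_scalar_right)
      moreover have "[x * (u * y) = x * 1] (mod int q)" using inv by (rule cong_scalar_left)
      ultimately have "[x = c * u] (mod int q)"
        by (metis cong_sym cong_trans mult.assoc mult.commute mult.right_neutral)
      then show "x = (c * u) mod int q" using that by (simp add: cong_def)
    next
      assume "x = (c * u) mod int q"
      then have "[x * y = c * u * y] (mod int q)" by (intro cong_scalar_right) (simp add: cong_def)
      also have "c * u * y = c * (u * y)" by simp
      also have "[c * (u * y) = c * 1] (mod int q)" using inv by (rule cong_scalar_left)
      finally show "[x * y = c] (mod int q)" by simp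
    qed
    have "(\<Sum>x\<in>?Z. ?P x y) = (\<Sum>x\<in>?Z. (if x = (c * u) mod int q then ec q (h * x + k * y) else 0) -
        1 / of_nat q * (ec q (k * y) * ec q (x * h)))"
    proof (rule sum.cong)
      fix x assume x: "x \<in> ?Z"
      have e: "ec q (k * y) * ec q (x * h) = ec q (h * x + k * y)" by (simp add: ec_add mult.commute)
      then show "?P x y = (if x = (c * u) mod int q then ec q (h * x + k * y) else 0) -
          1 / of_nat q * (ec q (k * y) * ec q (x * h))"
        unfolding e using cop iff[OF x]
        by (cases "x = (c * u) mod int q") (simp_all only: deviation_def, simp_all add: left_diff_distrib)
    qed simp
    also have "\<dots> = ec q (h * ((c * u) mod int q) + k * y) -
        1 / of_nat q * (ec q (k * y) * (\<Sum>x\<in>?Z. ec q (x * h)))"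
      using q by (simp add: sum_subtractf sum_distrib_left sum_divide_distrib)
    also have "ec q (h * ((c * u) mod int q) + k * y) = ec q (h * c * u + k * y)"
    proof (rule ec_cong)
      have "[h * ((c * u) mod int q) + k * y = h * (c * u) + k * y] (mod int q)"
        by (intro cong_add cong_scalar_left) (auto simp: cong_def)
      then show "[h * ((c * u) mod int q) + k * y = h * c * u + k * y] (mod int q)"
        by (simp add: mult.assoc)
    qed
    also have "(\<Sum>x\<in>?Z. ec q (x * h)) = ?\<delta> * of_nat q"
      using h ec_sum[OF q, of h] by (auto dest: zdvd_imp_le)
    finally show "(\<Sum>x\<in>?Z. ?P x (snd z)) = ec q (h * c * fst z + k * snd z) - ?\<delta> * ec q (k * snd z)"
      using q by (simp add: uy)
  qed simp
  also have "\<dots> = (if h = 0 then 0 else kloosterman q (h * c) k)"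
    by (simp add: kloosterman_def case_prod_unfold)
  finally show ?thesis .
qed

lemma deviation_mod:
  "deviation q c (x mod int q) y = deviation q c x y"
  "deviation q c x (y mod int q) = deviation q c x y" if "q > 0"
  using that by (auto simp: deviation_def cong_def mod_simps coprime_mod_left_iff)

text \<open>The box sum is a periodic correlation of \<open>deviation\<close> with the two
  intervals, so its transform is a product.\<close>

lemma box_deviation_transform:
  assumes q: "q > 0"
  shows "(\<Sum>a\<in>{1..int q}. \<Sum>b\<in>{1..int q}.
      of_real (\<Sum>i\<in>{1..L1}. \<Sum>j\<in>{1..L2}. deviation q c (a + i) (b + j)) * ec q (h * a + k * b)) =
    cnj (interval_sum q L1 h) * cnj (interval_sum q L2 k) *
      (\<Sum>x\<in>{0..<int q}. \<Sum>y\<in>{0..<int q}. of_real (deviation q c x y) * ec q (h * x + k * y))"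
    (is "?lhs = _ * _ * ?\<Phi>")
proof -
  let ?A = "{1..int q}" and ?Z = "{0..<int q}"
  define P where "P = (\<lambda>x y. of_real (deviation q c x y) * ec q (h * x + k * y))"
  have ecm: "ec q (h * x + k * (y mod int q)) = ec q (h * x + k * y)"
    "ec q (h * (x mod int q) + k * y) = ec q (h * x + k * y)" for x y
    by (rule ec_cong, intro cong_add cong_scalar_left, auto simp: cong_def)+
  have Pm: "P x (y mod int q) = P x y" "P (x mod int q) y = P x y" for x y
    by (simp_all add: P_def deviation_mod[OF q] ecm)
  have full: "(\<Sum>a\<in>?A. \<Sum>b\<in>?A. P (a + i) (b + j)) = ?\<Phi>" for i j
  proof -
    have "(\<Sum>a\<in>?A. \<Sum>b\<in>?A. P (a + i) (b + j)) = (\<Sum>a\<in>?A. \<Sum>y\<in>?Z. P (a + i) y)"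
      by (intro sum.cong refl sum_periodic_shift[OF q] Pm)
    also have "\<dots> = (\<Sum>x\<in>?Z. \<Sum>y\<in>?Z. P x y)"
      by (rule sum_periodic_shift[OF q, of "\<lambda>x. \<Sum>y\<in>?Z. P x y"]) (simp add: Pm)
    finally show ?thesis by (simp add: P_def)
  qed
  have "?lhs = (\<Sum>a\<in>?A. \<Sum>b\<in>?A. \<Sum>i\<in>{1..L1}. \<Sum>j\<in>{1..L2}.
      (ec q (- (h * i)) * ec q (- (k * j))) * P (a + i) (b + j))"
  proof (intro sum.cong refl)
    fix a b
    have e: "ec q (h * a + k * b) = ec q (- (h * i)) * ec q (- (k * j)) * ec q (h * (a + i) + k * (b + j))" for i j
      by (simp add: algebra_simps flip: ec_add)
    have "of_real (deviation q c (a + i) (b + j)) * ec q (h * a + k * b) =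
        (ec q (- (h * i)) * ec q (- (k * j))) * P (a + i) (b + j)" for i j
      unfolding P_def by (subst e[of i j]) (simp only: mult_ac)
    then show "of_real (\<Sum>i\<in>{1..L1}. \<Sum>j\<in>{1..L2}. deviation q c (a + i) (b + j)) * ec q (h * a + k * b) =
        (\<Sum>i\<in>{1..L1}. \<Sum>j\<in>{1..L2}. (ec q (- (h * i)) * ec q (- (k * j))) * P (a + i) (b + j))"
      by (simp add: sum_distrib_right)
  qed
  also have "\<dots> = (\<Sum>a\<in>?A. \<Sum>i\<in>{1..L1}. \<Sum>b\<in>?A. \<Sum>j\<in>{1..L2}.
      (ec q (- (h * i)) * ec q (- (k * j))) * P (a + i) (b + j))"
    by (intro sum.cong refl sum.swap)
  also have "\<dots> = (\<Sum>i\<in>{1..L1}. \<Sum>a\<in>?A. \<Sum>b\<in>?A. \<Sum>j\<in>{1..L2}.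
      (ec q (- (h * i)) * ec q (- (k * j))) * P (a + i) (b + j))"
    by (rule sum.swap)
  also have "\<dots> = (\<Sum>i\<in>{1..L1}. \<Sum>a\<in>?A. \<Sum>j\<in>{1..L2}. \<Sum>b\<in>?A.
      (ec q (- (h * i)) * ec q (- (k * j))) * P (a + i) (b + j))"
    by (intro sum.cong refl sum.swap)
  also have "\<dots> = (\<Sum>i\<in>{1..L1}. \<Sum>j\<in>{1..L2}. \<Sum>a\<in>?A. \<Sum>b\<in>?A.
      (ec q (- (h * i)) * ec q (- (k * j))) * P (a + i) (b + j))"
    by (intro sum.cong refl sum.swap)
  also have "\<dots> = (\<Sum>i\<in>{1..L1}. \<Sum>j\<in>{1..L2}. (ec q (- (h * i)) * ec q (- (k * j))) * ?\<Phi>)"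
    by (intro sum.cong refl) (simp only: full flip: sum_distrib_left)
  also have "\<dots> = (\<Sum>i\<in>{1..L1}. ec q (- (h * i))) * (\<Sum>j\<in>{1..L2}. ec q (- (k * j))) * ?\<Phi>"
  proof -
    have "(\<Sum>i\<in>I. \<Sum>j\<in>J. (u i * w j) * s) = (\<Sum>i\<in>I. u i) * (\<Sum>j\<in>J. w j) * s"
      for u w :: "int \<Rightarrow> complex" and I J s
      by (simp add: sum_product flip: sum_distrib_right)
    then show ?thesis .
  qed
  finally show ?thesis by (simp add: interval_sum_def ec_uminus)
qed

lemma plancherel_two_dim:
  fixes f :: "int \<Rightarrow> int \<Rightarrow> complex"
  assumes q: "q > 0"
  shows "(\<Sum>h\<in>{0..<int q}. \<Sum>k\<in>{0..<int q}.
      norm (\<Sum>a\<in>{1..int q}. \<Sum>b\<in>{1..int q}. f a b * ec q (h * a + k * b)) ^ 2) =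
    real q ^ 2 * (\<Sum>a\<in>{1..int q}. \<Sum>b\<in>{1..int q}. norm (f a b) ^ 2)"
proof -
  let ?A = "{1..int q}" and ?Z = "{0..<int q}"
  note pl = plancherel[OF q finite_atLeastAtMost_int inj_on_mod_interval[OF order.refl]]
  have "(\<Sum>h\<in>?Z. \<Sum>k\<in>?Z. norm (\<Sum>a\<in>?A. \<Sum>b\<in>?A. f a b * ec q (h * a + k * b)) ^ 2) =
      (\<Sum>h\<in>?Z. \<Sum>k\<in>?Z. norm (\<Sum>b\<in>?A. (\<Sum>a\<in>?A. f a b * ec q (h * a)) * ec q (k * b)) ^ 2)"
  proof (intro sum.cong refl)
    fix h k
    have "(\<Sum>a\<in>?A. \<Sum>b\<in>?A. f a b * ec q (h * a + k * b)) =
        (\<Sum>b\<in>?A. \<Sum>a\<in>?A. f a b * ec q (h * a + k * b))" by (rule sum.swap)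
    also have "\<dots> = (\<Sum>b\<in>?A. (\<Sum>a\<in>?A. f a b * ec q (h * a)) * ec q (k * b))"
      by (simp add: sum_distrib_right ec_add mult.assoc)
    finally show "norm (\<Sum>a\<in>?A. \<Sum>b\<in>?A. f a b * ec q (h * a + k * b)) ^ 2 =
        norm (\<Sum>b\<in>?A. (\<Sum>a\<in>?A. f a b * ec q (h * a)) * ec q (k * b)) ^ 2" by simp
  qed
  also have "\<dots> = (\<Sum>h\<in>?Z. real q * (\<Sum>b\<in>?A. norm (\<Sum>a\<in>?A. f a b * ec q (h * a)) ^ 2))"
    by (intro sum.cong refl pl)
  also have "\<dots> = real q * (\<Sum>b\<in>?A. \<Sum>h\<in>?Z. norm (\<Sum>a\<in>?A. f a b * ec q (h * a)) ^ 2)"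
    unfolding sum_distrib_left[symmetric] by (subst sum.swap) simp
  also have "\<dots> = real q * (\<Sum>b\<in>?A. real q * (\<Sum>a\<in>?A. norm (f a b) ^ 2))"
    by (simp only: pl)
  also have "\<dots> = real q ^ 2 * (\<Sum>a\<in>?A. \<Sum>b\<in>?A. norm (f a b) ^ 2)"
    unfolding sum_distrib_left[symmetric] by (subst sum.swap) (simp add: power2_eq_square)
  finally show ?thesis .
qed

lemma hyperbola_variance_bound:
  assumes q: "q > 0" and L1: "0 \<le> L1" and L2: "0 \<le> L2" "L2 \<le> int q" and c: "coprime c (int q)"
    and kl: "\<And>m n. norm (kloosterman q m n) ^ 2 \<le>
      real (num_divisors q) ^ 2 * real q * of_int (gcd (gcd m n) (int q))"
  shows "(\<Sum>a\<in>{1..int q}. \<Sum>b\<in>{1..int q}.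
      (hyperbola_count q c L1 L2 a b - 1 / real q * coprime_box_count q L1 L2 a b)\<^sup>2) \<le>
    of_int L1 * of_int L2 * real q * real (num_divisors q) ^ 3"
proof -
  let ?A = "{1..int q}" and ?Z = "{0..<int q}"
  let ?D = "\<lambda>a b. \<Sum>i\<in>{1..L1}. \<Sum>j\<in>{1..L2}. deviation q c (a + i) (b + j)"
  let ?E = "\<lambda>h. norm (interval_sum q L1 h) ^ 2" and ?F = "\<lambda>k. norm (interval_sum q L2 k) ^ 2"
  let ?d = "real (num_divisors q)"
  define V where "V = (\<Sum>a\<in>?A. \<Sum>b\<in>?A. (?D a b)\<^sup>2)"
  have sumF: "(\<Sum>k\<in>?Z. ?F k) = real q * of_int L2" by (rule sum_norm_interval_sum[OF q L2])
  have "real q ^ 2 * V = (\<Sum>h\<in>?Z. \<Sum>k\<in>?Z.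
      norm (\<Sum>a\<in>?A. \<Sum>b\<in>?A. of_real (?D a b) * ec q (h * a + k * b)) ^ 2)"
    unfolding V_def plancherel_two_dim[OF q, of "\<lambda>a b. of_real (?D a b)"]
    by (simp only: norm_of_real power2_abs)
  also have "\<dots> = (\<Sum>h\<in>?Z. \<Sum>k\<in>?Z. ?E h * ?F k * norm (if h = 0 then 0 else kloosterman q (h * c) k) ^ 2)"
    by (intro sum.cong refl)
      (simp only: box_deviation_transform[OF q] deviation_transform[OF q] norm_mult power_mult_distrib complex_mod_cnj)
  also have "\<dots> \<le> (\<Sum>h\<in>?Z. \<Sum>k\<in>?Z. ?F k * (?d ^ 2 * real q * (if h = 0 then 0 else of_int (gcd h (int q)) * ?E h)))"
  proof (intro sum_mono)
    fix h k assume h: "h \<in> ?Z"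
    show "?E h * ?F k * norm (if h = 0 then 0 else kloosterman q (h * c) k) ^ 2 \<le>
        ?F k * (?d ^ 2 * real q * (if h = 0 then 0 else of_int (gcd h (int q)) * ?E h))"
    proof (cases "h = 0")
      case False
      \<comment> \<open>Dropping \<open>k\<close> from the gcd separates the sums over
        \<open>h\<close> and \<open>k\<close>; \<open>c\<close> disappears because it is a unit
        modulo \<open>q\<close>.\<close>
      have "gcd (gcd (h * c) k) (int q) dvd gcd (h * c) (int q)"
        by (meson dvd_trans gcd_dvd1 gcd_dvd2 gcd_greatest)
      also have "gcd (h * c) (int q) = gcd h (int q)"
        using c by (simp add: gcd_mult_left_right_cancel coprime_commute)
      finally have "gcd (gcd (h * c) k) (int q) \<le> gcd h (int q)"
        using q by (intro zdvd_imp_le) auto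
      then have "?d ^ 2 * real q * of_int (gcd (gcd (h * c) k) (int q)) \<le> ?d ^ 2 * real q * of_int (gcd h (int q))"
        by (intro mult_left_mono) auto
      with kl[of "h * c" k] have "norm (kloosterman q (h * c) k) ^ 2 \<le> ?d ^ 2 * real q * of_int (gcd h (int q))"
        by linarith
      then have "?E h * ?F k * norm (kloosterman q (h * c) k) ^ 2 \<le>
          ?E h * ?F k * (?d ^ 2 * real q * of_int (gcd h (int q)))"
        by (intro mult_left_mono) auto
      then show ?thesis using False by (simp add: mult_ac)
    qed simp
  qed
  also have "\<dots> = (real q * of_int L2) * (?d ^ 2 * real q) * (\<Sum>h\<in>?Z. if h = 0 then 0 else of_int (gcd h (int q)) * ?E h)"
    by (simp add: sumF flip: sum_distrib_left sum_distrib_right)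
  also have "(\<Sum>h\<in>?Z. if h = 0 then 0 else of_int (gcd h (int q)) * ?E h) =
      (\<Sum>h\<in>{1..<int q}. of_int (gcd h (int q)) * ?E h)"
    by (rule sum.mono_neutral_cong_right) auto
  also have "(real q * of_int L2) * (?d ^ 2 * real q) * \<dots> \<le>
      (real q * of_int L2) * (?d ^ 2 * real q) * (?d * (real q * of_int L1))"
    using L2 by (intro mult_left_mono sum_gcd_norm_interval_sum_le[OF q L1]) auto
  also have "\<dots> = real q ^ 2 * (of_int L1 * of_int L2 * real q * ?d ^ 3)"
    by (simp add: power2_eq_square power3_eq_cube)
  finally have "V \<le> of_int L1 * of_int L2 * real q * ?d ^ 3" using q by simp
  then show ?thesis unfolding V_def count_diff_eq_sum_deviation .
qed

section \<open>The choice of a characteristic\<close>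

definition weil_bound :: "nat \<Rightarrow> bool" where
  "weil_bound p \<longleftrightarrow> (\<forall>m n. \<not> int p dvd m \<longrightarrow> \<not> int p dvd n \<longrightarrow> norm (kloosterman p m n) \<le> 2 * sqrt p)"

text \<open>Types cannot depend on the variable \<open>p\<close>. We therefore fix, by choice, an odd prime violating
  the bound if there is one, and build the field with that many elements as a type.\<close>

definition critical_prime :: nat where
  "critical_prime = (SOME p. prime p \<and> odd p \<and> ((\<exists>p'. prime p' \<and> odd p' \<and> \<not> weil_bound p') \<longrightarrow> \<not> weil_bound p))"

lemma critical_prime:
  "prime critical_prime" "odd critical_prime"
  "prime p \<Longrightarrow> odd p \<Longrightarrow> \<not> weil_bound p \<Longrightarrow> \<not> weil_bound critical_prime"
proof -
  have "prime (3::nat) \<and> odd (3::nat)" by simp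
  then have "\<exists>p. prime p \<and> odd p \<and> ((\<exists>p'. prime p' \<and> odd p' \<and> \<not> weil_bound p') \<longrightarrow> \<not> weil_bound p)" by blast
  from someI_ex[OF this, folded critical_prime_def]
  show "prime critical_prime" "odd critical_prime"
    "prime p \<Longrightarrow> odd p \<Longrightarrow> \<not> weil_bound p \<Longrightarrow> \<not> weil_bound critical_prime" by blast+
qed

typedef critical_index = "{0..<critical_prime}"
  using prime_gt_0_nat[OF critical_prime(1)] by (intro exI[of _ 0]) simp

lemma card_critical_index: "CARD(critical_index) = critical_prime"
  using type_definition.card[OF type_definition_critical_index] by simp

instance critical_index :: finite
  by standard (metis card_critical_index prime_gt_0_nat[OF critical_prime(1)] card_gt_0_iff)

instance critical_index :: prime_card
  by standard (simp add: card_critical_index critical_prime)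

lemma weil_bound_odd_prime:
  assumes "prime p" "odd p"
  shows "weil_bound p"
proof (rule ccontr)
  assume "\<not> weil_bound p"
  then have bad: "\<not> weil_bound critical_prime" using critical_prime(3) assms by blast
  \<comment> \<open>\<open>critical_index mod_ring\<close> is the prime field, and its algebraic
    closure contains all the fields \<open>Fq n\<close> at once.\<close>
  interpret finite_subfields critical_prime "TYPE(critical_index mod_ring alg_closure)"
    by unfold_locales (simp_all add: critical_prime card_critical_index)
  show False using bad weil_kloosterman by (auto simp: weil_bound_def)
qed

theorem theorem2:
  shows "\<exists>C::real. C > 0 \<and>
    (\<forall>(q::nat) (L1::int) (L2::int) (c::int).
       q \<ge> 1 \<longrightarrow> 1 \<le> L1 \<longrightarrow> L1 \<le> int q \<longrightarrow> 1 \<le> L2 \<longrightarrow> L2 \<le> int q \<longrightarrow> coprime c (int q) \<longrightarrow>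
       (\<Sum>a\<in>{1..int q}. \<Sum>b\<in>{1..int q}.
          (hyperbola_count q c L1 L2 a b - 1 / real q * coprime_box_count q L1 L2 a b)\<^sup>2)
       \<le> C * real_of_int L1 * real_of_int L2 * real q * real (num_divisors q) ^ 3)"
proof (rule exI[of _ 1], intro conjI allI impI)
  fix q :: nat and L1 L2 c :: int
  assume q: "q \<ge> 1" and L: "1 \<le> L1" "L1 \<le> int q" "1 \<le> L2" "L2 \<le> int q" and c: "coprime c (int q)"
  have "norm (kloosterman q m n) ^ 2 \<le> real (num_divisors q) ^ 2 * real q * of_int (gcd (gcd m n) (int q))" for m n
    by (rule norm_kloosterman_bound) (use weil_bound_odd_prime q in \<open>auto simp: weil_bound_def\<close>)
  then show "(\<Sum>a\<in>{1..int q}. \<Sum>b\<in>{1..int q}.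
          (hyperbola_count q c L1 L2 a b - 1 / real q * coprime_box_count q L1 L2 a b)\<^sup>2)
       \<le> 1 * real_of_int L1 * real_of_int L2 * real q * real (num_divisors q) ^ 3"
    using hyperbola_variance_bound[of q L1 L2 c] q L c by simp
qed simp

end
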